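(* Let $\mathbb{F}$ be an infinite field, let $\Delta$ be a $2m$-dimensional $\mathbb{F}$-homology sphere, and suppose that $\Delta'$ is obtained from $\Delta$ by a bistellar move which replaces $A\star\partial B$ with $\partial A\star B$, where $|A|\neq|B|$. Then $\mathbb{F}[\Delta']$ has weak Lefschetz elements if and only if $\mathbb{F}[\Delta]$ has weak Lefschetz elements.
   Context: Simplicial complexes are finite, connected and pure; a $(d-1)$-dimensional complex $\Delta$ has vertex set $\{1,\dots,f_0\}$ (here $d=2m+1$). An $\mathbb{F}$-homology manifold is a $(d-1)$-dimensional complex in which the link of every nonempty face $\sigma$ has the $\mathbb{F}$-homology of $S^{d-|\sigma|-1}$; it is an $\mathbb{F}$-homology sphere if in addition it has the $\mathbb{F}$-homology of $S^{d-1}$. Face ring: let $R=\mathbb{F}[x_1,\dots,x_{f_0}]$ and $\mathbb{F}[\Delta]=R/I_\Delta$, where $I_\Delta$ is generated by the monomials $x_{i_1}\cdots x_{i_k}$ with $\{i_1,\dots,i_k\}\notin\Delta$. A linear system of parameters (l.s.o.p.) is a set $\theta_1,\dots,\theta_d$ of one-forms, generating an ideal $\Theta$, such that $\mathbb{F}(\Delta):=\mathbb{F}[\Delta]/\Theta$ is finite-dimensional over $\mathbb{F}$; $\mathbb{F}(\Delta)_i$ is its degree $i$ component. "Generic" means within a nonempty Zariski open subset of the space of coefficients. A one-form $\omega\in R_1$ is a weak Lefschetz element if multiplication $\cdot\omega:\mathbb{F}(\Delta)_i\to\mathbb{F}(\Delta)_{i+1}$ is injective or surjective for every $0\le i\le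 d-1$. $\mathbb{F}[\Delta]$ has weak Lefschetz elements if this holds for generic choices of l.s.o.p. and $\omega$ (equivalently, for at least one choice of both). Bistellar move: let $A,B$ be disjoint nonempty vertex sets with $|A|+|B|=d+1$ such that the subcomplex of $\Delta$ induced on $A\cup B$ is $A\star\partial B$, the join of the simplex on $A$ with the boundary of the simplex on $B$ (if $|B|=1$, $B$ is a single new vertex not in $\Delta$, $\partial B=\{\emptyset\}$ and $A$ is a facet). The ($(|B|-1)$-)bistellar move removes $A\star\partial B$ from $\Delta$ and replaces it with $\partial A\star B$. The join is $\Delta'\star\Delta''=\{\sigma\cup\tau:\sigma\in\Delta',\tau\in\Delta''\}$. *)

theory Defs
  imports "HOL-Library.Poly_Mapping" "HOL-Library.FuncSet" "HOL-Algebra.Embedded_Algebras" "HOL-Algebra.QuotRing"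
begin

abbreviation (input) keys :: "('a \<Rightarrow>\<^sub>0 'b::zero) \<Rightarrow> 'a set" where
  "keys \<equiv> Poly_Mapping.keys"

abbreviation (input) lookup :: "('a \<Rightarrow>\<^sub>0 'b::zero) \<Rightarrow> 'a \<Rightarrow> 'b" where
  "lookup \<equiv> Poly_Mapping.lookup"

section \<open>Simplicial complexes\<close>

text \<open>A complex is the set of its faces, the empty face included. Vertices may carry arbitrary
  labels from a linearly ordered type, rather than being exactly \<open>1, \<dots>, f\<^sub>0\<close>: a bistellar move may
  introduce or delete a vertex. The linear order serves only to orient simplices.\<close>

definition simplicial_complex :: "'v set set \<Rightarrow> bool" where
  "simplicial_complex \<Delta> \<longleftrightarrow> finite (\<Union>\<Delta>) \<and> {} \<in> \<Delta> \<and> (\<forall>\<sigma>\<in>\<Delta>. \<forall>\<tau>. \<tau> \<subseteq> \<sigma> \<longrightarrow> \<tau> \<in> \<Delta>)"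

abbreviation vertices :: "'v set set \<Rightarrow> 'v set" where
  "vertices \<Delta> \<equiv> \<Union>\<Delta>"

definition facet :: "'v set set \<Rightarrow> 'v set \<Rightarrow> bool" where
  "facet \<Delta> \<sigma> \<longleftrightarrow> \<sigma> \<in> \<Delta> \<and> (\<forall>\<tau>\<in>\<Delta>. \<sigma> \<subseteq> \<tau> \<longrightarrow> \<tau> = \<sigma>)"

text \<open>The number \<open>d\<close> for which \<open>\<Delta>\<close> is \<open>(d - 1)\<close>-dimensional.\<close>

definition rank_of :: "'v set set \<Rightarrow> nat" where
  "rank_of \<Delta> = Max (card ` \<Delta>)"

definition pure_complex :: "'v set set \<Rightarrow> bool" where
  "pure_complex \<Delta> \<longleftrightarrow> (\<forall>\<sigma>. facet \<Delta> \<sigma> \<longrightarrow> card \<sigma> = rank_of \<Delta>)"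

definition connected_complex :: "'v set set \<Rightarrow> bool" where
  "connected_complex \<Delta> \<longleftrightarrow>
    (\<forall>u\<in>vertices \<Delta>. \<forall>v\<in>vertices \<Delta>. (u, v) \<in> {(a, b). {a, b} \<in> \<Delta>}\<^sup>*)"

definition link :: "'v set set \<Rightarrow> 'v set \<Rightarrow> 'v set set" where
  "link \<Delta> \<sigma> = {\<tau> \<in> \<Delta>. \<tau> \<inter> \<sigma> = {} \<and> \<tau> \<union> \<sigma> \<in> \<Delta>}"

definition simplex_boundary :: "'v set \<Rightarrow> 'v set set" where
  "simplex_boundary \<sigma> = Pow \<sigma> - {\<sigma>}"

definition induced_subcomplex :: "'v set set \<Rightarrow> 'v set \<Rightarrow> 'v set set" where
  "induced_subcomplex \<Delta> W = {\<sigma> \<in> \<Delta>. \<sigma> \<subseteq> W}"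

definition join :: "'v set set \<Rightarrow> 'v set set \<Rightarrow> 'v set set" (infixl \<open>\<star>\<close> 70) where
  "\<Delta>1 \<star> \<Delta>2 = {\<sigma> \<union> \<tau> | \<sigma> \<tau>. \<sigma> \<in> \<Delta>1 \<and> \<tau> \<in> \<Delta>2}"

text \<open>\<open>\<Delta>'\<close> arises from \<open>\<Delta>\<close> by replacing \<open>A \<star> \<partial>B\<close> with \<open>\<partial>A \<star> B\<close>. The faces of
  \<open>\<partial>A \<star> \<partial>B\<close> are removed together with \<open>A \<star> \<partial>B\<close> and put back as part of \<open>\<partial>A \<star> B\<close>.
  No separate clause is needed for \<open>B = {v}\<close>: the condition on the induced subcomplex then says
  that \<open>v\<close> is not a vertex of \<open>\<Delta>\<close> and that \<open>A\<close>, having \<open>d\<close> elements, is a facet.\<close>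

definition bistellar_move ::
    "'v set set \<Rightarrow> 'v set \<Rightarrow> 'v set \<Rightarrow> 'v set set \<Rightarrow> bool" where
  "bistellar_move \<Delta> A B \<Delta>' \<longleftrightarrow>
    finite A \<and> finite B \<and> A \<noteq> {} \<and> B \<noteq> {} \<and> A \<inter> B = {} \<and>
    card A + card B = rank_of \<Delta> + 1 \<and>
    induced_subcomplex \<Delta> (A \<union> B) = Pow A \<star> simplex_boundary B \<and>
    \<Delta>' = (\<Delta> - Pow A \<star> simplex_boundary B) \<union> simplex_boundary A \<star> Pow B"


section \<open>Simplicial homology over a field\<close>

text \<open>Chains are formal linear combinations of faces. They are graded by the cardinality of the
  faces, so degree \<open>k\<close> here is homological degree \<open>k - 1\<close>. The empty face spans degree \<open>0\<close>, hence
  the homology is reduced.\<close>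

definition chain_scale :: "'f::field \<Rightarrow> ('v set \<Rightarrow>\<^sub>0 'f) \<Rightarrow> ('v set \<Rightarrow>\<^sub>0 'f)" where
  "chain_scale a c = Poly_Mapping.map ((*) a) c"

lemma lookup_chain_scale: "lookup (chain_scale a c) \<sigma> = a * lookup c \<sigma>"
  by (simp add: chain_scale_def Poly_Mapping.map.rep_eq when_def)

lemma vector_space_chain_scale: "vector_space chain_scale"
  by unfold_locales (auto intro!: poly_mapping_eqI simp: lookup_chain_scale Poly_Mapping.lookup_add algebra_simps)

definition chains :: "'v set set \<Rightarrow> nat \<Rightarrow> ('v set \<Rightarrow>\<^sub>0 'f::field) set" where
  "chains \<Delta> k = {c. keys c \<subseteq> {\<sigma> \<in> \<Delta>. card \<sigma> = k}}"

definition bdry :: "('v::linorder set \<Rightarrow>\<^sub>0 'f::field) \<Rightarrow> ('v set \<Rightarrow>\<^sub>0 'f)" where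
  "bdry c = (\<Sum>\<sigma>\<in>keys c. \<Sum>v\<in>\<sigma>.
     Poly_Mapping.single (\<sigma> - {v}) ((-1) ^ card {u \<in> \<sigma>. u < v} * lookup c \<sigma>))"

definition cycles :: "'v::linorder set set \<Rightarrow> nat \<Rightarrow> ('v set \<Rightarrow>\<^sub>0 'f::field) set" where
  "cycles \<Delta> k = {c \<in> chains \<Delta> k. bdry c = 0}"

definition boundaries :: "'v::linorder set set \<Rightarrow> nat \<Rightarrow> ('v set \<Rightarrow>\<^sub>0 'f::field) set" where
  "boundaries \<Delta> k = bdry ` chains \<Delta> (Suc k)"

text \<open>The dimension over \<open>'f\<close> of the \<open>(k - 1)\<close>-st reduced homology, cycles modulo boundaries.\<close>

definition reduced_betti :: "'f::field itself \<Rightarrow> 'v::linorder set set \<Rightarrow> nat \<Rightarrow> nat" where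
  "reduced_betti _ \<Delta> k =
     vector_space.dim chain_scale (cycles \<Delta> k :: ('v set \<Rightarrow>\<^sub>0 'f) set) -
     vector_space.dim chain_scale (boundaries \<Delta> k :: ('v set \<Rightarrow>\<^sub>0 'f) set)"

text \<open>Having the homology of the sphere \<open>S\<^bsup>n-1\<^esup>\<close>; for \<open>n = 0\<close> this is \<open>S\<^bsup>-1\<^esup>\<close>, the complex
  \<open>{\<emptyset>}\<close>.\<close>

definition homology_of_sphere :: "'f::field itself \<Rightarrow> nat \<Rightarrow> 'v::linorder set set \<Rightarrow> bool" where
  "homology_of_sphere F n \<Delta> \<longleftrightarrow> (\<forall>k. reduced_betti F \<Delta> k = (if k = n then 1 else 0))"

definition homology_manifold :: "'f::field itself \<Rightarrow> 'v::linorder set set \<Rightarrow> bool" where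
  "homology_manifold F \<Delta> \<longleftrightarrow>
    (\<forall>\<sigma>\<in>\<Delta>. \<sigma> \<noteq> {} \<longrightarrow> homology_of_sphere F (rank_of \<Delta> - card \<sigma>) (link \<Delta> \<sigma>))"

definition homology_sphere :: "'f::field itself \<Rightarrow> 'v::linorder set set \<Rightarrow> bool" where
  "homology_sphere F \<Delta> \<longleftrightarrow> homology_manifold F \<Delta> \<and> homology_of_sphere F (rank_of \<Delta>) \<Delta>"


section \<open>Polynomials and generic points\<close>

type_synonym ('x, 'f) mpoly = "('x \<Rightarrow>\<^sub>0 nat) \<Rightarrow>\<^sub>0 'f"

definition polys_in :: "'x set \<Rightarrow> ('x, 'f::field) mpoly set" where
  "polys_in X = {p. \<forall>m\<in>keys p. keys m \<subseteq> X}"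

definition homogeneous_part :: "'x set \<Rightarrow> nat \<Rightarrow> ('x, 'f::field) mpoly set" where
  "homogeneous_part X i = {p \<in> polys_in X. \<forall>m\<in>keys p. (\<Sum>x\<in>keys m. lookup m x) = i}"

definition const_poly :: "'f::field \<Rightarrow> ('x, 'f) mpoly" where
  "const_poly a = Poly_Mapping.single 0 a"

definition pvar :: "'x \<Rightarrow> ('x, 'f::field) mpoly" where
  "pvar x = Poly_Mapping.single (Poly_Mapping.single x 1) 1"

definition poly_value :: "('x, 'f::field) mpoly \<Rightarrow> ('x \<Rightarrow> 'f) \<Rightarrow> 'f" where
  "poly_value p c = (\<Sum>m\<in>keys p. lookup p m * (\<Prod>x\<in>keys m. c x ^ lookup m x))"

definition zariski_open :: "'x set \<Rightarrow> ('x \<Rightarrow> 'f::field) set \<Rightarrow> bool" where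
  "zariski_open X U \<longleftrightarrow>
    (\<exists>G\<subseteq>polys_in X. U = {c \<in> X \<rightarrow>\<^sub>E UNIV. \<exists>g\<in>G. poly_value g c \<noteq> 0})"

definition holds_generically :: "'x set \<Rightarrow> (('x \<Rightarrow> 'f::field) \<Rightarrow> bool) \<Rightarrow> bool" where
  "holds_generically X P \<longleftrightarrow> (\<exists>U. zariski_open X U \<and> U \<noteq> {} \<and> (\<forall>c\<in>U. P c))"


section \<open>Face rings and weak Lefschetz elements\<close>

definition poly_ring :: "'x set \<Rightarrow> ('x, 'f::field) mpoly ring" where
  "poly_ring X = \<lparr>carrier = polys_in X, mult = (*), one = 1, zero = 0, add = (+)\<rparr>"

definition face_ideal :: "'v set set \<Rightarrow> ('v, 'f::field) mpoly set" where
  "face_ideal \<Delta> =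
     genideal (poly_ring (vertices \<Delta>)) {\<Prod>v\<in>\<sigma>. pvar v | \<sigma>. \<sigma> \<subseteq> vertices \<Delta> \<and> \<sigma> \<notin> \<Delta>}"

definition face_ring :: "'v set set \<Rightarrow> ('v, 'f::field) mpoly set ring" where
  "face_ring \<Delta> = poly_ring (vertices \<Delta>) Quot face_ideal \<Delta>"

definition face_class :: "'v set set \<Rightarrow> ('v, 'f::field) mpoly \<Rightarrow> ('v, 'f) mpoly set" where
  "face_class \<Delta> p = face_ideal \<Delta> +>\<^bsub>poly_ring (vertices \<Delta>)\<^esub> p"

text \<open>Throughout, \<open>\<theta> 0, \<dots>, \<theta> (d - 1)\<close> with \<open>d = rank_of \<Delta>\<close> are one-forms in the polynomial ring; other
  values of \<open>\<theta>\<close> are ignored. \<open>artinian_quotient \<Delta> \<theta>\<close> is the ring \<open>\<bbbF>(\<Delta>) = \<bbbF>[\<Delta>]/\<Theta>\<close>, which is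
  finite-dimensional only if \<open>\<theta>\<close> is a linear system of parameters.\<close>

definition theta_ideal ::
    "'v set set \<Rightarrow> (nat \<Rightarrow> ('v, 'f::field) mpoly) \<Rightarrow> ('v, 'f) mpoly set set" where
  "theta_ideal \<Delta> \<theta> = genideal (face_ring \<Delta>) ((\<lambda>i. face_class \<Delta> (\<theta> i)) ` {..<rank_of \<Delta>})"

definition artinian_quotient ::
    "'v set set \<Rightarrow> (nat \<Rightarrow> ('v, 'f::field) mpoly) \<Rightarrow> ('v, 'f) mpoly set set ring" where
  "artinian_quotient \<Delta> \<theta> = face_ring \<Delta> Quot theta_ideal \<Delta> \<theta>"

definition artinian_class ::
    "'v set set \<Rightarrow> (nat \<Rightarrow> ('v, 'f::field) mpoly) \<Rightarrow> ('v, 'f) mpoly \<Rightarrow> ('v, 'f) mpoly set set" where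
  "artinian_class \<Delta> \<theta> p = theta_ideal \<Delta> \<theta> +>\<^bsub>face_ring \<Delta>\<^esub> face_class \<Delta> p"

definition artinian_component ::
    "'v set set \<Rightarrow> (nat \<Rightarrow> ('v, 'f::field) mpoly) \<Rightarrow> nat \<Rightarrow> ('v, 'f) mpoly set set set" where
  "artinian_component \<Delta> \<theta> i = artinian_class \<Delta> \<theta> ` homogeneous_part (vertices \<Delta>) i"

definition lsop :: "'v set set \<Rightarrow> (nat \<Rightarrow> ('v, 'f::field) mpoly) \<Rightarrow> bool" where
  "lsop \<Delta> \<theta> \<longleftrightarrow>
    (\<forall>i<rank_of \<Delta>. \<theta> i \<in> homogeneous_part (vertices \<Delta>) 1) \<and>
    ring.finite_dimension (artinian_quotient \<Delta> \<theta>)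
      (range (\<lambda>a. artinian_class \<Delta> \<theta> (const_poly a)))
      (carrier (artinian_quotient \<Delta> \<theta>))"

definition weak_lefschetz_element ::
    "'v set set \<Rightarrow> (nat \<Rightarrow> ('v, 'f::field) mpoly) \<Rightarrow> ('v, 'f) mpoly \<Rightarrow> bool" where
  "weak_lefschetz_element \<Delta> \<theta> \<omega> \<longleftrightarrow>
    \<omega> \<in> homogeneous_part (vertices \<Delta>) 1 \<and>
    (\<forall>i<rank_of \<Delta>.
      let mult_\<omega> = (\<lambda>x. artinian_class \<Delta> \<theta> \<omega> \<otimes>\<^bsub>artinian_quotient \<Delta> \<theta>\<^esub> x)
      in inj_on mult_\<omega> (artinian_component \<Delta> \<theta> i) \<or>
         mult_\<omega> ` artinian_component \<Delta> \<theta> i = artinian_component \<Delta> \<theta> (Suc i))"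

definition linear_form :: "'v set \<Rightarrow> ('v \<Rightarrow> 'f::field) \<Rightarrow> ('v, 'f) mpoly" where
  "linear_form V a = (\<Sum>v\<in>V. const_poly (a v) * pvar v)"

text \<open>A choice of one-forms \<open>\<theta>\<^sub>0, \<dots>, \<theta>\<^bsub>d-1\<^esub>, \<omega>\<close> is a point \<open>c\<close> of the affine space with coordinates
  \<open>{0..d} \<times> V\<close>: row \<open>i < d\<close> holds the coefficients of \<open>\<theta>\<^sub>i\<close>, row \<open>d\<close> those of \<open>\<omega>\<close>.\<close>

definition has_weak_lefschetz_elements :: "'f::field itself \<Rightarrow> 'v set set \<Rightarrow> bool" where
  "has_weak_lefschetz_elements _ \<Delta> \<longleftrightarrow>
    holds_generically ({0..rank_of \<Delta>} \<times> vertices \<Delta>) (\<lambda>c :: nat \<times> 'v \<Rightarrow> 'f.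
      let \<theta> = (\<lambda>i. linear_form (vertices \<Delta>) (\<lambda>v. c (i, v)));
          \<omega> = linear_form (vertices \<Delta>) (\<lambda>v. c (rank_of \<Delta>, v))
      in lsop \<Delta> \<theta> \<and> weak_lefschetz_element \<Delta> \<theta> \<omega>)"


subsection \<open>The polynomial ring is a commutative ring\<close>

lemma polys_in_add: "p \<in> polys_in X \<Longrightarrow> q \<in> polys_in X \<Longrightarrow> p + q \<in> polys_in X"
  unfolding polys_in_def using Poly_Mapping.keys_add[of p q] by blast

lemma polys_in_mult:
  assumes "p \<in> polys_in X" "q \<in> polys_in X"
  shows "p * q \<in> polys_in X"
  unfolding polys_in_def
proof (intro CollectI ballI)
  fix m assume "m \<in> keys (p * q)"
  then obtain a b where m: "m = a + b" and "a \<in> keys p" "b \<in> keys q"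
    using Poly_Mapping.keys_mult[of p q] by blast
  then have "keys a \<subseteq> X" "keys b \<subseteq> X"
    using assms by (auto simp: polys_in_def)
  then show "keys m \<subseteq> X"
    unfolding m using Poly_Mapping.keys_add[of a b] by blast
qed

lemma cring_poly_ring: "cring (poly_ring X :: ('x, 'f::field) mpoly ring)"
proof (rule cringI)
  show "abelian_group (poly_ring X :: ('x, 'f) mpoly ring)"
  proof (rule abelian_groupI)
    fix p :: "('x, 'f) mpoly" assume "p \<in> carrier (poly_ring X)"
    then have "- p \<in> carrier (poly_ring X)"
      by (simp add: poly_ring_def polys_in_def)
    then show "\<exists>q\<in>carrier (poly_ring X). q \<oplus>\<^bsub>poly_ring X\<^esub> p = \<zero>\<^bsub>poly_ring X\<^esub>"
      by (intro bexI[of _ "- p"]) (simp_all add: poly_ring_def)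
  qed (simp_all add: poly_ring_def polys_in_add add.assoc add.commute, simp add: polys_in_def)
  show "comm_monoid (poly_ring X :: ('x, 'f) mpoly ring)"
    by (rule comm_monoidI)
       (simp_all add: poly_ring_def polys_in_mult mult.assoc mult.commute, simp add: polys_in_def)
qed (simp add: poly_ring_def distrib_right)

end

theory Submission
  imports Defs "HOL-Library.Function_Algebras" "HOL-Computational_Algebra.Polynomial"
    "Jordan_Normal_Form.Determinant"
begin

text \<open>Everything takes place in the graded dual: the dual of \<open>\<bbbF>(\<Delta>)\<close> consists of the functions on monomials that
  are supported on \<open>\<Delta>\<close> and killed by the contraction operators of \<open>\<theta>\<^sub>1, \<dots>, \<theta>\<^sub>d\<close>. For a homology sphere it is
  generated under contraction by a single element \<open>\<psi>\<close> of degree \<open>d\<close>. This is proved by downward induction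
  on faces \<open>\<tau>\<close>, for the star of \<open>\<tau>\<close>: the stars of the faces \<open>\<tau> \<union> \<rho>\<close> form a complex that, in each multidegree,
  computes the homology of a cone or of the link of \<open>\<tau>\<close>, and dividing out the one-forms one by one moves the
  top homology class of the link to the place where it becomes \<open>\<psi>\<close>.

  With \<open>d = 2 m + 1\<close>, the weak Lefschetz property then says that \<open>p \<psi> = 0\<close> whenever \<open>p\<close> has degree \<open>m\<close> and \<open>\<omega> p \<psi> = 0\<close>:
  the pairing given by \<open>\<psi>\<close> is perfect, so injectivity in the middle degree propagates downwards and
  surjectivity upwards.

  The one-forms restricted to \<open>A \<union> B\<close> have a one-dimensional kernel, spanned by a vector \<open>k\<close> without zero entries. Let
  \<open>\<kappa>\<close> be evaluation of degree \<open>d\<close> monomials at \<open>k\<close>. On monomials divisible by \<open>x\<^sub>A\<close>, \<open>\<psi>\<close> is a multiple of \<open>\<kappa>\<close>, and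
  subtracting this multiple from \<open>\<psi>\<close> gives the dual generator \<open>\<psi>'\<close> of \<open>\<Delta>'\<close>. If \<open>|B| \<le> m\<close>, then \<open>x\<^sub>B\<close> kills \<open>\<psi>\<close> but not
  \<open>\<kappa>\<close>, which makes the middle condition for \<open>\<psi>\<close> and for \<open>\<psi>' = \<psi> - a \<kappa>\<close> equivalent; if \<open>|A| \<le> m\<close>, the two exchange roles.\<close>

section \<open>Monomials and contraction\<close>

abbreviation evar :: "'x \<Rightarrow> ('x \<Rightarrow>\<^sub>0 nat)" where
  "evar x \<equiv> Poly_Mapping.single x (Suc 0)"

definition mdeg :: "('x \<Rightarrow>\<^sub>0 nat) \<Rightarrow> nat" where
  "mdeg \<mu> = (\<Sum>x\<in>keys \<mu>. lookup \<mu> x)"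

lemma mdeg_superset:
  assumes "finite S" "keys \<mu> \<subseteq> S"
  shows "mdeg \<mu> = (\<Sum>x\<in>S. lookup \<mu> x)"
  unfolding mdeg_def by (rule sum.mono_neutral_left) (use assms in \<open>auto simp: in_keys_iff\<close>)

lemma keys_add_nat: "keys (\<mu> + \<nu> :: 'x \<Rightarrow>\<^sub>0 nat) = keys \<mu> \<union> keys \<nu>"
  by (auto simp: in_keys_iff lookup_add)

lemma keys_evar [simp]: "keys (evar x :: 'x \<Rightarrow>\<^sub>0 nat) = {x}"
  by simp

lemma mdeg_add [simp]: "mdeg (\<mu> + \<nu>) = mdeg \<mu> + mdeg \<nu>"
proof -
  let ?S = "keys \<mu> \<union> keys \<nu>"
  have "mdeg (\<mu> + \<nu>) = (\<Sum>x\<in>?S. lookup (\<mu> + \<nu>) x)"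
    by (rule mdeg_superset) (auto simp: keys_add_nat)
  also have "\<dots> = (\<Sum>x\<in>?S. lookup \<mu> x) + (\<Sum>x\<in>?S. lookup \<nu> x)"
    by (simp add: lookup_add sum.distrib)
  also have "\<dots> = mdeg \<mu> + mdeg \<nu>"
    by (simp add: mdeg_superset[of ?S])
  finally show ?thesis .
qed

lemma mdeg_zero [simp]: "mdeg 0 = 0"
  by (simp add: mdeg_def)

lemma mdeg_single [simp]: "mdeg (Poly_Mapping.single x n) = n"
  by (simp add: mdeg_def)

lemma mdeg_eq_0_iff: "mdeg \<mu> = 0 \<longleftrightarrow> \<mu> = 0"
proof
  assume "mdeg \<mu> = 0"
  then have "lookup \<mu> x = 0" for x
    by (cases "x \<in> keys \<mu>") (auto simp: mdeg_def in_keys_iff)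
  then show "\<mu> = 0" by (auto intro!: poly_mapping_eqI)
qed simp

lemma in_keys_imp_evar_add:
  assumes "x \<in> keys \<mu>"
  obtains \<nu> where "\<mu> = \<nu> + evar x"
proof
  show "\<mu> = (\<mu> - evar x) + evar x"
    using assms by (auto intro!: poly_mapping_eqI simp: lookup_add lookup_minus lookup_single in_keys_iff when_def)
qed

lemma monomial_induct [case_names zero add]:
  assumes "P 0" and "\<And>\<mu> x. P \<mu> \<Longrightarrow> P (\<mu> + evar x)"
  shows "P (\<mu> :: 'x \<Rightarrow>\<^sub>0 nat)"
proof (induction "mdeg \<mu>" arbitrary: \<mu>)
  case 0
  then show ?case using assms(1) mdeg_eq_0_iff by metis
next
  case (Suc n)
  then have "\<mu> \<noteq> 0" by auto
  then obtain x where "x \<in> keys \<mu>" by (meson all_not_in_conv keys_eq_empty)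
  then obtain \<nu> where \<nu>: "\<mu> = \<nu> + evar x" by (rule in_keys_imp_evar_add)
  then have "n = mdeg \<nu>" using Suc(2) by simp
  then show ?case using Suc(1) assms(2) \<nu> by blast
qed

lemma mdeg_split:
  assumes "i \<le> mdeg \<mu>"
  obtains \<nu> \<rho> where "\<mu> = \<nu> + \<rho>" "mdeg \<nu> = i"
  using assms
proof (induction \<mu> arbitrary: thesis i rule: monomial_induct)
  case zero
  then show ?case by (metis add_0 le_zero_eq mdeg_zero)
next
  case (add \<mu> x)
  show ?case
  proof (cases "i \<le> mdeg \<mu>")
    case True
    then obtain \<nu> \<rho> where "\<mu> = \<nu> + \<rho>" "mdeg \<nu> = i" using add.IH by blast
    then show ?thesis using add.prems(1)[of \<nu> "\<rho> + evar x"] by (simp add: add.assoc)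
  next
    case False
    then have "i = mdeg (\<mu> + evar x)" using add.prems(2) by simp
    then show ?thesis using add.prems(1)[of "\<mu> + evar x" 0] by simp
  qed
qed

text \<open>Exponent vector of the squarefree monomial x_S; contraction by it detects the monomials
  whose support contains \<open>S\<close>.\<close>

definition ind :: "'x set \<Rightarrow> ('x \<Rightarrow>\<^sub>0 nat)" where
  "ind S = (\<Sum>x\<in>S. evar x)"

lemma ind_empty [simp]: "ind {} = 0"
  by (simp add: ind_def)

lemma ind_insert: "finite S \<Longrightarrow> x \<notin> S \<Longrightarrow> ind (insert x S) = ind S + evar x"
  by (simp add: ind_def add.commute)

lemma keys_ind: "finite S \<Longrightarrow> keys (ind S) = S"
  by (induction S rule: finite_induct) (auto simp: ind_insert keys_add_nat simp del: One_nat_def)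

lemma mdeg_ind: "finite S \<Longrightarrow> mdeg (ind S) = card S"
  by (induction S rule: finite_induct) (auto simp: ind_insert)

lemma lookup_ind: "finite S \<Longrightarrow> lookup (ind S) x = (if x \<in> S then 1 else 0)"
  by (induction S rule: finite_induct) (auto simp: ind_insert lookup_add lookup_single when_def)

lemma ind_dvd:
  assumes "finite S" "S \<subseteq> keys \<mu>"
  obtains \<nu> where "\<mu> = \<nu> + ind S"
proof
  show "\<mu> = (\<mu> - ind S) + ind S"
    using assms by (auto intro!: poly_mapping_eqI simp: lookup_add lookup_minus lookup_ind in_keys_iff subset_iff Suc_leI)
qed

text \<open>A function \<open>f\<close> is read as the functional taking the value
  \<open>f \<mu>\<close> on the monomial with exponent \<mu>. Contraction is then the transpose of
  multiplication by \<open>p\<close>. Unlike differentiation it produces no factorials, so it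
  behaves alike in every characteristic. The value \<open>act p f 0\<close> is the pairing of
  \<open>p\<close> with \<open>f\<close>.\<close>

definition act :: "('x, 'f::field) mpoly \<Rightarrow> (('x \<Rightarrow>\<^sub>0 nat) \<Rightarrow> 'f) \<Rightarrow> (('x \<Rightarrow>\<^sub>0 nat) \<Rightarrow> 'f)" where
  "act p f = (\<lambda>\<mu>. \<Sum>\<nu>\<in>keys p. lookup p \<nu> * f (\<mu> + \<nu>))"

lemma act_superset:
  assumes "finite S" "keys p \<subseteq> S"
  shows "act p f \<mu> = (\<Sum>\<nu>\<in>S. lookup p \<nu> * f (\<mu> + \<nu>))"
  unfolding act_def by (rule sum.mono_neutral_left) (use assms in \<open>auto simp: in_keys_iff\<close>)

lemma act_single [simp]: "act (Poly_Mapping.single \<nu> a) f = (\<lambda>\<mu>. a * f (\<mu> + \<nu>))"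
  by (auto simp: act_superset[of "{\<nu>}"])

lemma act_add_left: "act (p + q) f = act p f + act q f"
proof
  fix \<mu>
  let ?S = "keys p \<union> keys q"
  have "keys (p + q) \<subseteq> ?S" by (rule Poly_Mapping.keys_add)
  then show "act (p + q) f \<mu> = (act p f + act q f) \<mu>"
    by (simp add: act_superset[of ?S] lookup_add sum.distrib distrib_right)
qed

lemma act_zero_left [simp]: "act 0 f = 0"
  by (auto simp: act_def)

lemma act_zero_right [simp]: "act p 0 = 0"
  by (auto simp: act_def)

lemma act_one [simp]: "act 1 f = f"
  using act_single[of 0 1 f] by simp

lemma act_add_right: "act p (f + g) = act p f + act p g"
  by (auto simp: act_def sum.distrib distrib_left)

lemma act_scale_right: "act p (\<lambda>\<mu>. a * f \<mu>) = (\<lambda>\<mu>. a * act p f \<mu>)"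
  by (auto simp: act_def sum_distrib_left mult.left_commute)

lemma act_diff_right: "act p (f - g) = act p f - act p g"
  by (auto simp: act_def sum_subtractf right_diff_distrib)

lemma act_uminus_left: "act (- p) f = - act p f"
  by (auto simp: act_def sum_negf)

lemma act_diff_left: "act (p - q) f = act p f - act q f"
  by (metis act_add_left act_uminus_left diff_conv_add_uminus)

lemma act_sum_left: "act (\<Sum>i\<in>I. p i) f = (\<Sum>i\<in>I. act (p i) f)"
  by (induction I rule: infinite_finite_induct) (simp_all add: act_add_left)

lemma act_sum_right: "act p (\<Sum>i\<in>I. f i) = (\<Sum>i\<in>I. act p (f i))"
  by (induction I rule: infinite_finite_induct) (simp_all only: sum.infinite sum.empty sum.insert act_zero_right act_add_right simp_thms)

lemma mpoly_sum_singles: "(p :: 'a \<Rightarrow>\<^sub>0 'b::comm_monoid_add) = (\<Sum>\<nu>\<in>keys p. Poly_Mapping.single \<nu> (lookup p \<nu>))"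
  by (rule poly_mapping_eqI) (auto simp: lookup_sum lookup_single when_def in_keys_iff)

text \<open>This makes the functions on monomials a module over the polynomial ring. Both sides are
  bilinear in \<open>p\<close> and \<open>q\<close>, which leaves the case of two monomials.\<close>

lemma act_mult: "act (p * q) f = act p (act q f)"
proof -
  have *: "act (Poly_Mapping.single \<nu> a * q) f = act (Poly_Mapping.single \<nu> a) (act q f)" for \<nu> a
  proof -
    have "act (Poly_Mapping.single \<nu> a * Poly_Mapping.single \<nu>' b) f
        = act (Poly_Mapping.single \<nu> a) (act (Poly_Mapping.single \<nu>' b) f)" for \<nu>' b
      by (auto simp: mult_single ac_simps)
    then have "act (Poly_Mapping.single \<nu> a * (\<Sum>\<nu>'\<in>keys q. Poly_Mapping.single \<nu>' (lookup q \<nu>'))) f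
       = act (Poly_Mapping.single \<nu> a) (act (\<Sum>\<nu>'\<in>keys q. Poly_Mapping.single \<nu>' (lookup q \<nu>')) f)"
      by (simp only: act_sum_left act_sum_right sum_distrib_left)
    then show ?thesis by (simp only: mpoly_sum_singles[of q, symmetric])
  qed
  have "act ((\<Sum>\<nu>\<in>keys p. Poly_Mapping.single \<nu> (lookup p \<nu>)) * q) f
       = act (\<Sum>\<nu>\<in>keys p. Poly_Mapping.single \<nu> (lookup p \<nu>)) (act q f)"
    unfolding sum_distrib_right act_sum_left * ..
  then show ?thesis by (simp only: mpoly_sum_singles[of p, symmetric])
qed

lemma act_commute: "act p (act q f) = act q (act p f)"
  by (metis act_mult mult.commute)

lemma act_const_poly [simp]: "act (const_poly a) f = (\<lambda>\<mu>. a * f \<mu>)"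
  by (simp add: const_poly_def)

lemma act_pvar [simp]: "act (pvar x) f = (\<lambda>\<mu>. f (\<mu> + evar x))"
  by (simp add: pvar_def)

lemma const_poly_mult_pvar: "const_poly a * pvar x = Poly_Mapping.single (evar x) a"
  by (simp add: const_poly_def pvar_def mult_single)

lemma act_linear_form: "act (linear_form V a) f = (\<lambda>\<mu>. \<Sum>v\<in>V. a v * f (\<mu> + evar v))"
  by (rule ext, simp add: linear_form_def act_sum_left const_poly_mult_pvar)
     (induction V rule: infinite_finite_induct, auto)

lemma sum_fun_apply: "(\<Sum>i\<in>I. f i) x = (\<Sum>i\<in>I. f i x)" for f :: "'i \<Rightarrow> 'a \<Rightarrow> 'b::comm_monoid_add"
  by (induction I rule: infinite_finite_induct) auto

text \<open>The values may lie in any commutative monoid: below they are field elements (evaluation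
  at a point), polynomials in several variables (change of coordinates) and polynomials in one
  variable (restriction to a line).\<close>

definition msub :: "('x \<Rightarrow> 'a::comm_monoid_mult) \<Rightarrow> ('x \<Rightarrow>\<^sub>0 nat) \<Rightarrow> 'a" where
  "msub \<gamma> \<mu> = (\<Prod>x\<in>keys \<mu>. \<gamma> x ^ lookup \<mu> x)"

lemma msub_superset:
  assumes "finite S" "keys \<mu> \<subseteq> S"
  shows "msub \<gamma> \<mu> = (\<Prod>x\<in>S. \<gamma> x ^ lookup \<mu> x)"
  unfolding msub_def by (rule prod.mono_neutral_left) (use assms in \<open>auto simp: in_keys_iff\<close>)

lemma msub_zero [simp]: "msub \<gamma> 0 = 1"
  by (simp add: msub_def)

lemma msub_add: "msub \<gamma> (\<mu> + \<nu>) = msub \<gamma> \<mu> * msub \<gamma> \<nu>"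
proof -
  let ?S = "keys \<mu> \<union> keys \<nu>"
  have "msub \<gamma> (\<mu> + \<nu>) = (\<Prod>x\<in>?S. \<gamma> x ^ lookup (\<mu> + \<nu>) x)"
    by (rule msub_superset) (auto simp: keys_add_nat)
  then show ?thesis
    by (simp add: msub_superset[of ?S] lookup_add power_add prod.distrib)
qed

lemma msub_evar [simp]: "msub \<gamma> (evar x) = \<gamma> x"
  by (simp add: msub_def)

lemma msub_eq_0_iff: "msub \<gamma> \<mu> = 0 \<longleftrightarrow> (\<exists>x\<in>keys \<mu>. \<gamma> x = (0::'f::field))"
  by (auto simp: msub_def in_keys_iff)

lemma poly_value_msub: "poly_value p c = (\<Sum>\<mu>\<in>keys p. lookup p \<mu> * msub c \<mu>)"
  by (simp add: poly_value_def msub_def)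

section \<open>Homogeneous functions and homogeneous polynomials\<close>

definition homog :: "nat \<Rightarrow> (('x \<Rightarrow>\<^sub>0 nat) \<Rightarrow> 'f::zero) \<Rightarrow> bool" where
  "homog i f \<longleftrightarrow> (\<forall>\<mu>. f \<mu> \<noteq> 0 \<longrightarrow> mdeg \<mu> = i)"

definition proj :: "nat \<Rightarrow> (('x \<Rightarrow>\<^sub>0 nat) \<Rightarrow> 'f::zero) \<Rightarrow> (('x \<Rightarrow>\<^sub>0 nat) \<Rightarrow> 'f)" where
  "proj i f = (\<lambda>\<mu>. if mdeg \<mu> = i then f \<mu> else 0)"

definition hpoly :: "nat \<Rightarrow> ('x, 'f::field) mpoly \<Rightarrow> bool" where
  "hpoly i p \<longleftrightarrow> (\<forall>\<mu>\<in>keys p. mdeg \<mu> = i)"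

lemma homog_proj [simp]: "homog i (proj i f)"
  by (simp add: homog_def proj_def)

lemma homog_zero [simp]: "homog i 0" "homog i (\<lambda>_. 0)"
  by (simp_all add: homog_def)

lemma homog_diff: "homog i f \<Longrightarrow> homog i g \<Longrightarrow> homog i (f - g)" for f :: "('x \<Rightarrow>\<^sub>0 nat) \<Rightarrow> 'f::field"
  by (auto simp: homog_def) (metis diff_zero)

lemma homog_scale: "homog i f \<Longrightarrow> homog i (\<lambda>\<mu>. a * f \<mu>)" for f :: "('x \<Rightarrow>\<^sub>0 nat) \<Rightarrow> 'f::field"
  by (auto simp: homog_def)

lemma homog_act:
  assumes "hpoly j p" "homog (i + j) f"
  shows "homog i (act p f)"
  unfolding homog_def
proof (intro allI impI)
  fix \<mu> assume "act p f \<mu> \<noteq> 0"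
  then obtain \<nu> where "\<nu> \<in> keys p" "f (\<mu> + \<nu>) \<noteq> 0"
    unfolding act_def by (metis (no_types, lifting) mult_zero_right sum.neutral)
  then show "mdeg \<mu> = i" using assms by (auto simp: homog_def hpoly_def)
qed

lemma hpoly_pvar [simp]: "hpoly 1 (pvar x)" "hpoly (Suc 0) (pvar x)"
  by (auto simp: hpoly_def pvar_def)

lemma hpoly_single [simp]: "hpoly (mdeg \<mu>) (Poly_Mapping.single \<mu> a)"
  by (auto simp: hpoly_def)

lemma hpoly_zero [simp]: "hpoly i 0"
  by (auto simp: hpoly_def)

lemma hpoly_add: "hpoly i p \<Longrightarrow> hpoly i q \<Longrightarrow> hpoly i (p + q)"
  using Poly_Mapping.keys_add[of p q] by (auto simp: hpoly_def)

lemma hpoly_uminus: "hpoly i p \<Longrightarrow> hpoly i (- p)"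
  by (auto simp: hpoly_def)

lemma hpoly_diff: "hpoly i p \<Longrightarrow> hpoly i q \<Longrightarrow> hpoly i (p - q)"
  using hpoly_add[of i p "- q"] hpoly_uminus[of i q] by simp

lemma hpoly_sum: "(\<And>x. x \<in> I \<Longrightarrow> hpoly i (p x)) \<Longrightarrow> hpoly i (\<Sum>x\<in>I. p x)"
  by (induction I rule: infinite_finite_induct) (auto intro: hpoly_add)

lemma hpoly_mult: "hpoly i p \<Longrightarrow> hpoly j q \<Longrightarrow> hpoly (i + j) (p * q)"
  using Poly_Mapping.keys_mult[of p q] by (fastforce simp: hpoly_def)

lemma hpoly_const_mult: "hpoly i p \<Longrightarrow> hpoly i (const_poly a * p)"
  using hpoly_mult[of 0 "const_poly a" i p] by (auto simp: hpoly_def const_poly_def)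

lemma hpoly_linear_form [simp]: "hpoly 1 (linear_form V a)" "hpoly (Suc 0) (linear_form V a)"
  unfolding linear_form_def by (auto intro!: hpoly_sum hpoly_const_mult)

section \<open>Inverse systems of linear forms\<close>

locale coeff_rows =
  fixes V :: "'v::linorder set" and c :: "nat \<times> 'v \<Rightarrow> 'f::field"
  assumes finite_V: "finite V"
begin

definition Th :: "nat \<Rightarrow> (('v \<Rightarrow>\<^sub>0 nat) \<Rightarrow> 'f) \<Rightarrow> (('v \<Rightarrow>\<^sub>0 nat) \<Rightarrow> 'f)" where
  "Th k f = act (linear_form V (\<lambda>v. c (k, v))) f"

text \<open>The graded dual of the quotient of the face ring of \<open>X\<close> by the first \<open>s\<close> one-forms.\<close>

definition E :: "nat \<Rightarrow> 'v set set \<Rightarrow> (('v \<Rightarrow>\<^sub>0 nat) \<Rightarrow> 'f) set" where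
  "E s X = {f. (\<forall>\<mu>. f \<mu> \<noteq> 0 \<longrightarrow> keys \<mu> \<in> X) \<and> (\<forall>k<s. Th k f = 0)}"

text \<open>\<open>G\<close> is a two-sided inverse of the square matrix formed by the first
  \<open>card \<sigma>\<close> rows and the columns \<sigma>. Since a set carries no order of its
  columns, an explicit inverse replaces the determinant.\<close>

definition nonsing :: "'v set \<Rightarrow> bool" where
  "nonsing \<sigma> \<longleftrightarrow> (\<exists>G :: 'v \<Rightarrow> nat \<Rightarrow> 'f.
     (\<forall>u\<in>\<sigma>. \<forall>v\<in>\<sigma>. (\<Sum>k<card \<sigma>. G u k * c (k, v)) = (if u = v then 1 else 0)) \<and>
     (\<forall>k<card \<sigma>. \<forall>l<card \<sigma>. (\<Sum>v\<in>\<sigma>. c (k, v) * G v l) = (if k = l then 1 else 0)))"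

lemma Th_apply: "Th k f \<mu> = (\<Sum>v\<in>V. c (k, v) * f (\<mu> + evar v))"
  by (simp add: Th_def act_linear_form)

lemma Th_add: "Th k (f + g) = Th k f + Th k g"
  by (simp only: Th_def act_add_right)

lemma Th_diff: "Th k (f - g) = Th k f - Th k g"
  by (simp only: Th_def act_diff_right)

lemma Th_scale: "Th k (\<lambda>\<mu>. a * f \<mu>) = (\<lambda>\<mu>. a * Th k f \<mu>)"
  by (simp only: Th_def act_scale_right)

lemma Th_zero [simp]: "Th k 0 = 0"
  by (simp only: Th_def act_zero_right)

lemma Th_act: "Th k (act p f) = act p (Th k f)"
  by (simp only: Th_def act_commute)

lemma Th_proj: "Th k (proj i f) \<mu> = (if mdeg \<mu> + 1 = i then Th k f \<mu> else 0)"
  by (simp add: Th_apply proj_def)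

lemma homog_Th: "homog (Suc i) f \<Longrightarrow> homog i (Th k f)"
  unfolding Th_def using homog_act[of 1 _ i f] by simp

lemma Th_homog_0: "homog 0 f \<Longrightarrow> Th k f = 0"
  by (rule ext) (auto simp: Th_apply homog_def intro!: sum.neutral)

lemma E_I: "(\<And>\<mu>. f \<mu> \<noteq> 0 \<Longrightarrow> keys \<mu> \<in> X) \<Longrightarrow> (\<And>k. k < s \<Longrightarrow> Th k f = 0) \<Longrightarrow> f \<in> E s X"
  by (simp add: E_def)

lemma E_keys: "f \<in> E s X \<Longrightarrow> f \<mu> \<noteq> 0 \<Longrightarrow> keys \<mu> \<in> X"
  by (simp add: E_def)

lemma E_keys': "f \<in> E s X \<Longrightarrow> keys \<mu> \<notin> X \<Longrightarrow> f \<mu> = 0"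
  by (auto simp: E_def)

lemma E_Th: "f \<in> E s X \<Longrightarrow> k < s \<Longrightarrow> Th k f = 0"
  by (simp add: E_def)

lemma E_mono: "f \<in> E s X \<Longrightarrow> X \<subseteq> Y \<Longrightarrow> f \<in> E s Y"
  by (auto simp: E_def)

lemma E_le: "f \<in> E s X \<Longrightarrow> s' \<le> s \<Longrightarrow> f \<in> E s' X"
  by (auto simp: E_def)

lemma E_Suc: "f \<in> E (Suc s) X \<longleftrightarrow> f \<in> E s X \<and> Th s f = 0"
  by (auto simp: E_def less_Suc_eq)

lemma E_zero [simp]: "0 \<in> E s X"
  by (auto intro!: E_I)

lemma E_zero' [simp]: "(\<lambda>_. 0) \<in> E s X"
  using E_zero by (simp add: zero_fun_def)

lemma E_add: "f \<in> E s X \<Longrightarrow> g \<in> E s X \<Longrightarrow> f + g \<in> E s X"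
  by (rule E_I) (auto simp: Th_add E_Th dest: E_keys, metis E_keys add_cancel_right_left)

lemma E_scale: "f \<in> E s X \<Longrightarrow> (\<lambda>\<mu>. a * f \<mu>) \<in> E s X"
  by (rule E_I) (auto simp: Th_scale E_Th dest: E_keys)

lemma E_diff: "f \<in> E s X \<Longrightarrow> g \<in> E s X \<Longrightarrow> f - g \<in> E s X"
  using E_add[of f s X "\<lambda>\<mu>. (-1) * g \<mu>"] E_scale[of g s X "-1"]
  by (simp add: plus_fun_def fun_diff_def)

lemma E_sum: "(\<And>i. i \<in> I \<Longrightarrow> f i \<in> E s X) \<Longrightarrow> (\<Sum>i\<in>I. f i) \<in> E s X"
proof (induction I rule: infinite_finite_induct)
  case (insert x F)
  have "f x + sum f F \<in> E s X" by (rule E_add) (use insert in auto)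
  then show ?case by (subst sum.insert) (use insert in auto)
next
  case (infinite A)
  then show ?case by (subst sum.infinite) auto
next
  case empty
  show ?case by (subst sum.empty) auto
qed

lemma E_proj: "f \<in> E s X \<Longrightarrow> proj i f \<in> E s X"
proof (rule E_I)
  fix k assume "f \<in> E s X" "k < s"
  then have "Th k f = 0" by (rule E_Th)
  then show "Th k (proj i f) = 0" by (intro ext) (simp add: Th_proj)
qed (auto simp: proj_def dest: E_keys split: if_splits)

lemma E_act:
  assumes "f \<in> E s X" and "\<And>\<sigma> \<tau>. \<sigma> \<in> X \<Longrightarrow> \<tau> \<subseteq> \<sigma> \<Longrightarrow> \<tau> \<in> X"
  shows "act p f \<in> E s X"
proof (rule E_I)
  fix \<mu> assume "act p f \<mu> \<noteq> 0"
  then obtain \<nu> where "f (\<mu> + \<nu>) \<noteq> 0"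
    unfolding act_def by (metis (no_types, lifting) mult_zero_right sum.neutral)
  then show "keys \<mu> \<in> X"
    using E_keys[OF assms(1)] assms(2) by (metis keys_add_nat sup_ge1)
qed (simp add: Th_act E_Th[OF assms(1)])

lemma E_Th_closed:
  assumes "f \<in> E s X" and "\<And>\<sigma> \<tau>. \<sigma> \<in> X \<Longrightarrow> \<tau> \<subseteq> \<sigma> \<Longrightarrow> \<tau> \<in> X"
  shows "Th k f \<in> E s X"
  unfolding Th_def by (rule E_act[OF assms])

text \<open>Contraction by a monomial sees only its multiples, so the support shrinks to sets that
  span a face together with \<open>keys \<nu>\<close>.\<close>

lemma E_act_link:
  assumes f: "f \<in> E s X" and "\<And>\<mu> :: 'v \<Rightarrow>\<^sub>0 nat. keys \<mu> \<union> keys \<nu> \<in> X \<Longrightarrow> keys \<mu> \<in> Y"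
  shows "act (Poly_Mapping.single \<nu> a) f \<in> E s Y"
proof (rule E_I)
  fix \<mu> assume "act (Poly_Mapping.single \<nu> a) f \<mu> \<noteq> 0"
  then have "keys (\<mu> + \<nu>) \<in> X" using E_keys[OF f] by auto
  then show "keys \<mu> \<in> Y" using assms(2) by (simp add: keys_add_nat)
qed (simp add: E_Th[OF f] Th_act del: act_single)

lemma Th_Pow:
  assumes "f \<in> E s (Pow \<sigma>)" "\<sigma> \<subseteq> V"
  shows "Th k f \<mu> = (\<Sum>v\<in>\<sigma>. c (k, v) * f (\<mu> + evar v))"
  unfolding Th_apply
  by (rule sum.mono_neutral_right)
     (use assms in \<open>auto simp: finite_V keys_add_nat simp del: One_nat_def dest!: E_keys\<close>)

text \<open>On functions supported on the simplex \<sigma> only the columns in \<sigma> count, so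
  the inverse matrix recovers each variable from the one-forms.\<close>

lemma nonsing_shift:
  assumes "\<sigma> \<subseteq> V" and G: "\<And>u v. u \<in> \<sigma> \<Longrightarrow> v \<in> \<sigma> \<Longrightarrow> (\<Sum>k<n. G u k * c (k, v)) = (if u = v then 1 else 0)"
    and f: "f \<in> E s (Pow \<sigma>)" and u: "u \<in> \<sigma>"
  shows "f (\<mu> + evar u) = (\<Sum>k<n. G u k * Th k f \<mu>)"
proof -
  have fin: "finite \<sigma>" using assms(1) finite_V finite_subset by blast
  have "(\<Sum>k<n. G u k * Th k f \<mu>) = (\<Sum>k<n. \<Sum>v\<in>\<sigma>. G u k * c (k, v) * f (\<mu> + evar v))"
    by (simp add: Th_Pow[OF f assms(1)] sum_distrib_left mult.assoc)
  also have "\<dots> = (\<Sum>v\<in>\<sigma>. (\<Sum>k<n. G u k * c (k, v)) * f (\<mu> + evar v))"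
    by (subst sum.swap) (simp add: sum_distrib_right)
  also have "\<dots> = (\<Sum>v\<in>\<sigma>. if u = v then f (\<mu> + evar v) else 0)"
    by (rule sum.cong) (use G u in auto)
  also have "\<dots> = f (\<mu> + evar u)" using fin u by simp
  finally show ?thesis ..
qed

text \<open>The first \<open>card \<sigma>\<close> forms restrict to a basis of the linear forms on
  \<sigma>, so modulo them every variable of the simplex is 0 and only the constant monomial
  survives.\<close>

lemma E_Pow_eq_0:
  assumes "\<sigma> \<subseteq> V" "nonsing \<sigma>" "f \<in> E s (Pow \<sigma>)" "card \<sigma> \<le> s" "\<mu> \<noteq> 0"
  shows "f \<mu> = 0"
proof (rule ccontr)
  assume "f \<mu> \<noteq> 0"
  then have "keys \<mu> \<subseteq> \<sigma>" using assms(3) E_keys by blast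
  moreover obtain u where u: "u \<in> keys \<mu>" using assms(5) by (meson all_not_in_conv keys_eq_empty)
  ultimately have "u \<in> \<sigma>" by blast
  obtain \<nu> where \<nu>: "\<mu> = \<nu> + evar u" using u by (rule in_keys_imp_evar_add)
  obtain G :: "'v \<Rightarrow> nat \<Rightarrow> 'f" where
    G: "\<And>u v. u \<in> \<sigma> \<Longrightarrow> v \<in> \<sigma> \<Longrightarrow> (\<Sum>k<card \<sigma>. G u k * c (k, v)) = (if u = v then 1 else 0)"
    using assms(2) unfolding nonsing_def by metis
  have "f \<mu> = (\<Sum>k<card \<sigma>. G u k * Th k f \<nu>)"
    unfolding \<nu> using nonsing_shift[OF assms(1) G assms(3) \<open>u \<in> \<sigma>\<close>] by blast
  also have "\<dots> = 0"
    by (rule sum.neutral) (use E_Th[OF assms(3)] assms(4) in auto)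
  finally show False using \<open>f \<mu> \<noteq> 0\<close> by simp
qed

text \<open>The change of coordinates \<open>\<Phi> f \<nu> = (\<theta>\<^sup>\<nu> f) 0\<close> turns the operators \<open>Th k\<close> into shifts,
  for which the claim is evident.\<close>

lemma Th_surj_Pow:
  assumes "\<sigma> \<subseteq> V" "nonsing \<sigma>" "g \<in> E s (Pow \<sigma>)" "s < card \<sigma>"
  shows "\<exists>f\<in>E s (Pow \<sigma>). Th s f = g"
proof -
  have fin: "finite \<sigma>" using assms(1) finite_V finite_subset by blast
  define t where "t = card \<sigma>"
  obtain G :: "'v \<Rightarrow> nat \<Rightarrow> 'f" where G:
    "\<forall>u\<in>\<sigma>. \<forall>v\<in>\<sigma>. (\<Sum>k<t. G u k * c (k, v)) = (if u = v then 1 else 0)"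
    "\<forall>k<t. \<forall>l<t. (\<Sum>v\<in>\<sigma>. c (k, v) * G v l) = (if k = l then 1 else 0)"
    using assms(2) unfolding nonsing_def t_def by blast
  note G1 = G(1)[rule_format] and G2 = G(2)[rule_format]
  define \<theta> where "\<theta> k = linear_form V (\<lambda>v. c (k, v))" for k
  have Th: "Th k f = act (\<theta> k) f" for k f by (simp add: Th_def \<theta>_def)
  define \<Phi> where "\<Phi> f = (\<lambda>\<nu>. act (msub \<theta> \<nu>) f 0)" for f
  \<comment> \<open>\<open>\<gamma> u\<close> is the variable \<open>u\<close> expressed in the
    coordinates given by the one-forms.\<close>
  define \<gamma> where "\<gamma> u = (\<Sum>l<t. const_poly (G u l) * pvar l)" for u
  have \<Phi>_shift: "act (pvar k) (\<Phi> f) = \<Phi> (Th k f)" for k f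
    by (auto simp: \<Phi>_def msub_add Th act_mult)
  have \<Phi>_add: "\<Phi> (f + g) = \<Phi> f + \<Phi> g" for f g
    by (rule ext) (simp add: \<Phi>_def act_add_right)
  have act_\<gamma>: "act (\<gamma> u) (\<Phi> f) = \<Phi> (act (pvar u) f)" if f: "f \<in> E 0 (Pow \<sigma>)" and u: "u \<in> \<sigma>" for u f
  proof -
    have eq: "act (pvar u) f = (\<Sum>l<t. act (const_poly (G u l)) (Th l f))"
      by (rule ext) (simp add: sum_fun_apply nonsing_shift[OF assms(1) G1 f u])
    have "\<Phi> (\<Sum>l<t. act (const_poly (G u l)) (Th l f)) = (\<Sum>l<t. act (const_poly (G u l)) (\<Phi> (Th l f)))"
      by (rule ext) (simp only: \<Phi>_def act_sum_right sum_fun_apply act_const_poly act_scale_right)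
    then show ?thesis
      by (simp only: eq \<gamma>_def act_sum_left act_mult \<Phi>_shift)
  qed
  have pow_E: "act p f \<in> E 0 (Pow \<sigma>)" if "f \<in> E 0 (Pow \<sigma>)" for p f
    using E_act[OF that] by auto
  have act_msub: "act (msub \<gamma> \<mu>) (\<Phi> f) = \<Phi> (act (Poly_Mapping.single \<mu> 1) f)"
    if "f \<in> E 0 (Pow \<sigma>)" "keys \<mu> \<subseteq> \<sigma>" for \<mu> f
    using that
  proof (induction \<mu> arbitrary: f rule: monomial_induct)
    case zero
    then show ?case by simp
  next
    case (add \<mu> x)
    then have x: "x \<in> \<sigma>" and m: "keys \<mu> \<subseteq> \<sigma>" by (auto simp: keys_add_nat)
    have "act (msub \<gamma> (\<mu> + evar x)) (\<Phi> f) = act (msub \<gamma> \<mu>) (\<Phi> (act (pvar x) f))"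
      by (simp only: msub_add msub_evar act_mult act_\<gamma>[OF add.prems(1) x])
    also have "\<dots> = \<Phi> (act (Poly_Mapping.single \<mu> 1) (act (pvar x) f))"
      by (rule add.IH[OF pow_E[OF add.prems(1)] m])
    also have "act (Poly_Mapping.single \<mu> 1) (act (pvar x) f) = act (Poly_Mapping.single (\<mu> + evar x) 1) f"
      by (simp add: add.assoc)
    finally show ?case .
  qed
  have g0: "g \<in> E 0 (Pow \<sigma>)" using assms(3) E_le by blast
  \<comment> \<open>In the new coordinates \<open>h\<close> has to become \<open>\<Phi> g\<close>
    under the shift by \<open>s\<close>. Setting it to 0 on monomials without \<open>s\<close> also
    keeps its shifts by \<open>l < s\<close> equal to 0, because \<open>g\<close> is killed by the
    forms \<open>l < s\<close>.\<close>
  define h where "h \<nu> = (if 0 < lookup \<nu> s then \<Phi> g (\<nu> - evar s) else 0)" for \<nu>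
  \<comment> \<open>\<open>h\<close> is carried back to the original variables by the inverse
    substitution.\<close>
  define f where "f \<mu> = (if keys \<mu> \<subseteq> \<sigma> then act (msub \<gamma> \<mu>) h 0 else 0)" for \<mu>
  have f0: "f \<in> E 0 (Pow \<sigma>)" by (rule E_I) (auto simp: f_def split: if_splits)
  have h_s: "act (pvar s) h = \<Phi> g"
    by (rule ext) (simp add: h_def lookup_add)
  have h_l: "act (pvar l) h = 0" if "l < s" for l
  proof
    fix \<nu>
    have "\<Phi> g (\<nu> + evar l - evar s) = 0" if "0 < lookup \<nu> s"
    proof -
      have "s \<in> keys \<nu>" using that by (simp add: in_keys_iff)
      then obtain \<rho> where "\<nu> = \<rho> + evar s" by (rule in_keys_imp_evar_add)
      then have "\<nu> + evar l = (\<rho> + evar l) + evar s" by (simp add: ac_simps)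
      then have "\<nu> + evar l - evar s = \<rho> + evar l"
        by (simp only: add_diff_cancel_right')
      moreover have "\<Phi> g (\<rho> + evar l) = 0"
        using \<Phi>_shift[of l g] E_Th[OF assms(3) \<open>l < s\<close>] by (simp add: fun_eq_iff \<Phi>_def)
      ultimately show ?thesis by simp
    qed
    then show "act (pvar l) h \<nu> = 0 \<nu>"
      using that by (simp add: h_def lookup_add lookup_single)
  qed
  have Thf: "Th k f \<mu> = (if keys \<mu> \<subseteq> \<sigma> then act (msub \<gamma> \<mu>) (act (pvar k) h) 0 else 0)" if "k < t" for k \<mu>
  proof (cases "keys \<mu> \<subseteq> \<sigma>")
    case True
    have "(\<Sum>v\<in>\<sigma>. const_poly (c (k, v)) * \<gamma> v) = pvar k"
    proof -
      have "(\<Sum>v\<in>\<sigma>. const_poly (c (k, v)) * \<gamma> v)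
          = (\<Sum>v\<in>\<sigma>. \<Sum>l<t. Poly_Mapping.single (evar l) (c (k, v) * G v l))"
        unfolding \<gamma>_def sum_distrib_left
        by (intro sum.cong refl) (simp add: const_poly_def pvar_def mult_single)
      also have "\<dots> = (\<Sum>l<t. Poly_Mapping.single (evar l) (\<Sum>v\<in>\<sigma>. c (k, v) * G v l))"
        by (subst sum.swap) (rule sum.cong[OF refl], rule poly_mapping_eqI, simp add: lookup_sum lookup_single when_def)
      also have "\<dots> = (\<Sum>l<t. if k = l then Poly_Mapping.single (evar l) 1 else 0)"
        by (rule sum.cong) (use G2 that in auto)
      also have "\<dots> = pvar k" using that by (simp add: pvar_def)
      finally show ?thesis .
    qed
    note eq = this
    have "Th k f \<mu> = (\<Sum>v\<in>\<sigma>. c (k, v) * act (msub \<gamma> \<mu> * \<gamma> v) h 0)"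
      using True by (simp add: Th_Pow[OF f0 assms(1)] f_def keys_add_nat msub_add)
    also have "\<dots> = act ((\<Sum>v\<in>\<sigma>. const_poly (c (k, v)) * \<gamma> v) * msub \<gamma> \<mu>) h 0"
      by (simp add: sum_distrib_right act_sum_left sum_fun_apply act_mult act_commute[of "\<gamma> _"])
    also have "\<dots> = act (msub \<gamma> \<mu>) (act (pvar k) h) 0"
      unfolding eq by (simp only: act_mult act_commute)
    finally show ?thesis using True by simp
  next
    case False
    then show ?thesis by (auto simp: Th_apply f_def keys_add_nat intro!: sum.neutral)
  qed
  have "f \<in> E s (Pow \<sigma>)"
  proof (rule E_I)
    fix k assume k: "k < s"
    then have "k < t" using assms(4) by (simp add: t_def)
    then show "Th k f = 0"
      using Thf[of k] h_l[OF k] by (intro ext) (simp add: act_zero_right)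
  qed (use E_keys[OF f0] in auto)
  moreover have "Th s f = g"
  proof
    fix \<mu>
    show "Th s f \<mu> = g \<mu>"
    proof (cases "keys \<mu> \<subseteq> \<sigma>")
      case True
      then have "Th s f \<mu> = \<Phi> (act (Poly_Mapping.single \<mu> 1) g) 0"
        using Thf[of s] assms(4) h_s act_msub[OF g0] by (simp add: t_def del: act_single)
      also have "\<dots> = g \<mu>" by (simp add: \<Phi>_def)
      finally show ?thesis .
    next
      case False
      then show ?thesis using Thf[of s] assms(4) E_keys'[OF g0] by (simp add: t_def)
    qed
  qed
  ultimately show ?thesis by blast
qed

end

section \<open>Boundaries of chains\<close>

definition sg :: "'v::linorder \<Rightarrow> 'v set \<Rightarrow> 'f::field" where
  "sg v \<rho> = (- 1) ^ card {u \<in> \<rho>. u < v}"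

text \<open>The boundary read on coefficients: the value at \<open>\<rho>\<close> collects the
  cofaces \<open>insert v \<rho>\<close>. On bare functions it can be applied separately for every
  monomial.\<close>

definition bnd :: "'v::linorder set \<Rightarrow> ('v set \<Rightarrow> 'f) \<Rightarrow> 'v set \<Rightarrow> 'f::field" where
  "bnd V g \<rho> = (\<Sum>v\<in>V - \<rho>. sg v \<rho> * g (insert v \<rho>))"

lemma sg_insert:
  assumes "finite \<rho>" "v \<notin> \<rho>"
  shows "sg w (insert v \<rho>) = (if v < w then - sg w \<rho> else sg w \<rho> :: 'f::field)"
proof -
  have "{u \<in> insert v \<rho>. u < w} = (if v < w then insert v {u \<in> \<rho>. u < w} else {u \<in> \<rho>. u < w})"
    by auto
  then show ?thesis using assms by (simp add: sg_def)
qed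

lemma sg_insert_same [simp]: "sg v (insert v \<rho>) = (sg v \<rho> :: 'f::field)"
proof -
  have "{u \<in> insert v \<rho>. u < v} = {u \<in> \<rho>. u < v}" by auto
  then show ?thesis by (simp add: sg_def)
qed

lemma sg_remove: "v \<in> \<sigma> \<Longrightarrow> sg v (\<sigma> - {v}) = (sg v \<sigma> :: 'f::field)"
  using sg_insert_same[of v "\<sigma> - {v}", where 'f='f] by (simp add: insert_absorb)

lemma sg_empty [simp]: "sg v {} = 1"
  by (simp add: sg_def)

lemma sg_square [simp]: "sg v \<rho> * sg v \<rho> = (1 :: 'f::field)"
  by (simp add: sg_def flip: power_add mult_2)

lemma bnd_bnd:
  assumes "finite V" "finite \<rho>"
  shows "bnd V (bnd V g) \<rho> = (0 :: 'f::field)"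
proof -
  define W where "W = V - \<rho>"
  have W: "finite W" using assms by (simp add: W_def)
  define h :: "'a \<Rightarrow> 'a \<Rightarrow> 'f" where "h v w = sg v \<rho> * (sg w (insert v \<rho>) * g (insert w (insert v \<rho>)))" for v w
  \<comment> \<open>Inserting \<open>v\<close> and \<open>w\<close> in either order reaches the same
    set with opposite signs, so the double sum cancels in pairs.\<close>
  have anti: "h w v = - h v w" if "v < w" "v \<in> W" "w \<in> W" for v w
  proof -
    have "\<not> w < v" using that by auto
    then show ?thesis using that assms(2) by (simp add: h_def sg_insert W_def insert_commute)
  qed
  have "bnd V (bnd V g) \<rho> = (\<Sum>v\<in>W. \<Sum>w\<in>W - {v}. h v w)"
    unfolding bnd_def sum_distrib_left W_def h_def by (intro sum.cong) auto
  also have "\<dots> = (\<Sum>(v, w)\<in>Sigma W (\<lambda>v. W - {v}). h v w)"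
    by (rule sum.Sigma) (use W in auto)
  also have "Sigma W (\<lambda>v. W - {v}) = {(v, w) \<in> W \<times> W. v < w} \<union> {(v, w) \<in> W \<times> W. w < v}"
    by auto
  also have "(\<Sum>(v, w)\<in>\<dots>. h v w) = (\<Sum>(v, w)\<in>{(v, w) \<in> W \<times> W. v < w}. h v w) + (\<Sum>(v, w)\<in>{(v, w) \<in> W \<times> W. w < v}. h v w)"
    by (rule sum.union_disjoint) (use W in \<open>auto intro: finite_subset[OF _ finite_cartesian_product[OF W W]]\<close>)
  also have "(\<Sum>(v, w)\<in>{(v, w) \<in> W \<times> W. w < v}. h v w) = (\<Sum>(v, w)\<in>{(v, w) \<in> W \<times> W. v < w}. h w v)"
    by (rule sum.reindex_bij_witness[of _ prod.swap prod.swap]) auto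
  also have "\<dots> = (\<Sum>(v, w)\<in>{(v, w) \<in> W \<times> W. v < w}. - h v w)"
    by (rule sum.cong) (auto simp: anti)
  finally show ?thesis by (simp add: sum_negf case_prod_unfold)
qed

definition cone :: "'v::linorder \<Rightarrow> ('v set \<Rightarrow> 'f) \<Rightarrow> 'v set \<Rightarrow> 'f::field" where
  "cone x g \<rho> = (if x \<in> \<rho> then sg x \<rho> * g (\<rho> - {x}) else 0)"

text \<open>The homotopy formula for a cone: the boundary of \<open>cone x g\<close> is
  \<open>g\<close> minus the cone over the boundary of \<open>g\<close>. At \<open>\<rho>\<close>
  the second term involves only the boundary of \<open>g\<close> at
  \<open>\<rho> - {x}\<close>.\<close>

lemma bnd_cone:
  assumes "finite V" "x \<in> V" "finite \<rho>" "bnd V g (\<rho> - {x}) = 0"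
  shows "bnd V (cone x g) \<rho> = g \<rho>"
proof (cases "x \<in> \<rho>")
  case False
  have "bnd V (cone x g) \<rho> = (\<Sum>v\<in>V - \<rho>. if v = x then g \<rho> else 0)"
    unfolding bnd_def
    by (rule sum.cong) (use False in \<open>auto simp: cone_def mult.assoc[symmetric]\<close>)
  also have "\<dots> = g \<rho>" using False assms by simp
  finally show ?thesis .
next
  case True
  define \<rho>' where "\<rho>' = \<rho> - {x}"
  have \<rho>: "\<rho> = insert x \<rho>'" "x \<notin> \<rho>'" "finite \<rho>'" using True assms by (auto simp: \<rho>'_def)
  have *: "sg v \<rho> * sg x (insert v \<rho>) = - (sg x \<rho>' * sg v \<rho>' :: 'b)" if "v \<in> V - \<rho>" for v
  proof -
    have "v \<noteq> x" "v \<notin> \<rho>'" using that \<rho> by auto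
    moreover have "sg x (insert v (insert x \<rho>')) = sg x (insert x (insert v \<rho>'))"
      by (simp add: insert_commute)
    ultimately show ?thesis
      using \<rho> by (auto simp: sg_insert \<rho>(1) not_less order.strict_iff_order)
  qed
  have "bnd V (cone x g) \<rho> = (\<Sum>v\<in>V - \<rho>. (sg v \<rho> * sg x (insert v \<rho>)) * g (insert v \<rho>'))"
    unfolding bnd_def cone_def
    by (rule sum.cong) (use True in \<open>auto simp: mult.assoc \<rho>'_def insert_Diff_if\<close>)
  also have "\<dots> = - (sg x \<rho>' * (\<Sum>v\<in>V - \<rho>. sg v \<rho>' * g (insert v \<rho>')))"
    by (simp add: * sum_distrib_left mult.assoc sum_negf)
  also have "(\<Sum>v\<in>V - \<rho>. sg v \<rho>' * g (insert v \<rho>')) = - (sg x \<rho>' * g \<rho>)"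
  proof -
    have V: "V - \<rho>' = insert x (V - \<rho>)" using \<rho> assms(2) by auto
    have "bnd V g \<rho>' = sg x \<rho>' * g (insert x \<rho>') + (\<Sum>v\<in>V - \<rho>. sg v \<rho>' * g (insert v \<rho>'))"
      unfolding bnd_def V by (rule sum.insert) (use assms(1) True in auto)
    then show ?thesis using assms(4) by (simp add: \<rho>(1)[symmetric] \<rho>'_def[symmetric] eq_neg_iff_add_eq_0 add.commute)
  qed
  finally show ?thesis by (simp flip: mult.assoc)
qed

text \<open>\<open>bdry\<close> sums over pairs of a face and a deleted vertex. Grouping these pairs
  by the face that is left over turns it into \<open>bnd\<close>.\<close>

lemma lookup_bdry:
  assumes "keys c \<subseteq> Pow V" "finite V"
  shows "lookup (bdry c) \<rho> = bnd V (lookup c) \<rho>"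
proof -
  have fin: "\<And>\<sigma>. \<sigma> \<in> keys c \<Longrightarrow> finite \<sigma>" using assms finite_subset by blast
  have sub: "\<And>\<sigma> v. \<sigma> \<in> keys c \<Longrightarrow> v \<in> \<sigma> \<Longrightarrow> v \<in> V" using assms by blast
  define P where "P = {(\<sigma>, v). \<sigma> \<in> keys c \<and> v \<in> \<sigma> \<and> \<sigma> - {v} = \<rho>}"
  have "lookup (bdry c) \<rho> = (\<Sum>\<sigma>\<in>keys c. \<Sum>v\<in>\<sigma>. if \<sigma> - {v} = \<rho> then sg v \<sigma> * lookup c \<sigma> else 0)"
    unfolding bdry_def lookup_sum lookup_single sg_def when_def by (intro sum.cong refl)
  also have "\<dots> = (\<Sum>(\<sigma>, v)\<in>Sigma (keys c) (\<lambda>\<sigma>. \<sigma>). if \<sigma> - {v} = \<rho> then sg v \<sigma> * lookup c \<sigma> else 0)"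
    by (rule sum.Sigma) (use fin in auto)
  also have "\<dots> = (\<Sum>(\<sigma>, v)\<in>P. sg v \<sigma> * lookup c \<sigma>)"
    by (rule sum.mono_neutral_cong_right) (use fin in \<open>auto simp: P_def split: if_splits\<close>)
  also have "\<dots> = (\<Sum>v\<in>{v \<in> V - \<rho>. insert v \<rho> \<in> keys c}. sg v \<rho> * lookup c (insert v \<rho>))"
    by (rule sum.reindex_bij_witness[of _ "\<lambda>v. (insert v \<rho>, v)" snd])
       (use sub in \<open>auto simp: P_def insert_absorb sg_remove\<close>)
  also have "\<dots> = bnd V (lookup c) \<rho>"
    unfolding bnd_def by (rule sum.mono_neutral_left) (use assms in \<open>auto simp: in_keys_iff\<close>)
  finally show ?thesis .
qed

section \<open>From reduced Betti numbers to cycles and fillings given by coefficient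
  functions\<close>

interpretation chain_space: vector_space chain_scale
  by (rule vector_space_chain_scale)

text \<open>The finite spanning set matters: an infinite basis has cardinality 0, so without it an
  inequality of dimensions would carry no information.\<close>

lemma (in vector_space) finite_dim_subspace_diff:
  assumes S: "subspace S" and ST: "S \<subseteq> T" and T: "T \<subseteq> span F" and F: "finite F" and dim: "dim T \<le> dim S"
  shows "T = S"
proof -
  obtain B where B: "B \<subseteq> S" "independent B" "S \<subseteq> span B" "card B = dim S"
    using basis_exists by blast
  obtain B' where B': "B \<subseteq> B'" "B' \<subseteq> T" "independent B'" "T \<subseteq> span B'"
    using maximal_independent_subset_extend[of B T] B ST by (metis order_trans)
  have fin: "finite B'" using independent_span_bound[OF F B'(3)] B'(2) T by blast
  have "card B' = dim T" using B' by (metis basis_card_eq_dim)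
  then have "B = B'" using fin B'(1) B(4) dim by (metis card_seteq)
  then have "T \<subseteq> S" using B B' S by (metis span_minimal order_trans)
  then show ?thesis using ST by blast
qed

lemma (in vector_space) dim_1_obtain:
  assumes T: "subspace T" and dim: "dim T = 1"
  obtains z where "z \<in> T" "z \<noteq> 0" "\<And>x. x \<in> T \<Longrightarrow> \<exists>a. x = scale a z"
proof -
  obtain B where B: "B \<subseteq> T" "independent B" "T \<subseteq> span B" "card B = dim T"
    using basis_exists by blast
  obtain z where z: "B = {z}" using B(4) dim by (metis card_1_singletonE)
  have "z \<noteq> 0" using B(2) z dependent_zero by auto
  then show ?thesis using that[of z] B z by (auto simp: span_singleton)
qed

lemma finite_complex: "\<Delta> \<subseteq> Pow V \<Longrightarrow> finite V \<Longrightarrow> finite \<Delta>"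
  using finite_subset by blast

lemma chains_span:
  "(chains L k :: ('v set \<Rightarrow>\<^sub>0 'f::field) set) \<subseteq> chain_space.span ((\<lambda>\<sigma>. Poly_Mapping.single \<sigma> 1) ` L)"
proof
  fix c :: "'v set \<Rightarrow>\<^sub>0 'f" assume "c \<in> chains L k"
  then have c: "keys c \<subseteq> L" by (auto simp: chains_def)
  have "c = (\<Sum>\<sigma>\<in>keys c. chain_scale (lookup c \<sigma>) (Poly_Mapping.single \<sigma> 1))"
    by (rule poly_mapping_eqI)
       (simp add: lookup_sum lookup_chain_scale lookup_single mult_when, simp add: when_def in_keys_iff)
  also have "\<dots> \<in> chain_space.span ((\<lambda>\<sigma>. Poly_Mapping.single \<sigma> 1) ` L)"
    by (intro chain_space.span_sum chain_space.span_scale chain_space.span_base) (use c in auto)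
  finally show "c \<in> chain_space.span ((\<lambda>\<sigma>. Poly_Mapping.single \<sigma> 1) ` L)" .
qed

lemma subspace_chains: "chain_space.subspace (chains L k :: ('v set \<Rightarrow>\<^sub>0 'f::field) set)"
proof -
  have "(chains L k :: ('v set \<Rightarrow>\<^sub>0 'f) set) = {c. \<forall>\<sigma>. \<not> (\<sigma> \<in> L \<and> card \<sigma> = k) \<longrightarrow> lookup c \<sigma> = 0}"
    by (auto simp: chains_def in_keys_iff)
  then show ?thesis
    by (simp add: chain_space.subspace_def lookup_chain_scale lookup_add)
qed

lemma bnd_add: "bnd V (f + g) \<rho> = bnd V f \<rho> + bnd V g \<rho>"
  by (simp add: bnd_def distrib_left sum.distrib)

lemma bnd_scale: "bnd V (\<lambda>\<rho>. a * f \<rho>) \<rho> = a * bnd V f \<rho>"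
  by (simp add: bnd_def sum_distrib_left mult.left_commute)

lemma chain_of_function:
  assumes "finite L" "\<And>\<rho>. \<gamma> \<rho> \<noteq> 0 \<Longrightarrow> \<rho> \<in> L \<and> card \<rho> = j"
  obtains c where "c \<in> chains L j" "lookup c = \<gamma>"
proof -
  have "finite {\<rho>. \<gamma> \<rho> \<noteq> 0}" by (rule finite_subset[OF _ assms(1)]) (use assms(2) in auto)
  then have l: "lookup (Abs_poly_mapping \<gamma>) = \<gamma>" by simp
  show ?thesis
    by (rule that[of "Abs_poly_mapping \<gamma>"]) (use assms(2) l in \<open>auto simp: chains_def in_keys_iff\<close>)
qed

context
  fixes V :: "'v::linorder set" and L :: "'v set set" and n :: nat and F :: "'f::field itself"
  assumes finV: "finite V" and LV: "L \<subseteq> Pow V"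
    and down: "\<And>\<sigma> \<tau>. \<sigma> \<in> L \<Longrightarrow> \<tau> \<subseteq> \<sigma> \<Longrightarrow> \<tau> \<in> L"
    and hs: "homology_of_sphere F n L"
begin

lemma finite_face: "\<sigma> \<in> L \<Longrightarrow> finite \<sigma>"
  using LV finV by (auto intro: finite_subset)

lemma chains_lookup_bdry:
  assumes "(c :: 'v set \<Rightarrow>\<^sub>0 'f) \<in> chains L k"
  shows "lookup (bdry c) = bnd V (lookup c)"
proof -
  have "keys c \<subseteq> Pow V" using assms LV by (auto simp: chains_def)
  then show ?thesis using lookup_bdry finV by (intro ext) blast
qed

lemma bdry_chains:
  assumes "(c :: 'v set \<Rightarrow>\<^sub>0 'f) \<in> chains L (Suc k)"
  shows "bdry c \<in> chains L k"
  unfolding chains_def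
proof (rule CollectI, rule subsetI)
  fix \<rho> assume "\<rho> \<in> keys (bdry c)"
  then have "bnd V (lookup c) \<rho> \<noteq> 0" using chains_lookup_bdry[OF assms] by (simp add: in_keys_iff)
  then obtain v where v: "v \<in> V - \<rho>" "lookup c (insert v \<rho>) \<noteq> 0"
    unfolding bnd_def by (metis (no_types, lifting) mult_zero_right sum.neutral)
  then have i: "insert v \<rho> \<in> L" "card (insert v \<rho>) = Suc k"
    using assms unfolding chains_def by (auto simp: in_keys_iff subset_iff)
  then have "finite \<rho>" using finite_face[of "insert v \<rho>"] by simp
  then have "card \<rho> = k" using i(2) v by simp
  moreover have "\<rho> \<in> L" using i(1) by (rule down) auto
  ultimately show "\<rho> \<in> {\<sigma> \<in> L. card \<sigma> = k}" by simp
qed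

lemma bdry_bdry:
  assumes "(c :: 'v set \<Rightarrow>\<^sub>0 'f) \<in> chains L (Suc k)"
  shows "bdry (bdry c) = 0"
proof (rule poly_mapping_eqI)
  fix \<rho>
  have "lookup (bdry (bdry c)) \<rho> = bnd V (bnd V (lookup c)) \<rho>"
    using chains_lookup_bdry[OF bdry_chains[OF assms]] chains_lookup_bdry[OF assms] by simp
  also have "\<dots> = 0"
  proof (cases "finite \<rho>")
    case False
    have "lookup c \<sigma> = 0" if "infinite \<sigma>" for \<sigma>
      using assms that finite_face[of \<sigma>] by (auto simp: chains_def in_keys_iff subset_iff)
    then show ?thesis using False by (simp add: bnd_def)
  qed (simp add: bnd_bnd finV)
  finally show "lookup (bdry (bdry c)) \<rho> = lookup 0 \<rho>" by simp
qed

lemma subspace_cycles: "chain_space.subspace (cycles L k :: ('v set \<Rightarrow>\<^sub>0 'f) set)"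
proof -
  have *: "c \<in> cycles L k \<longleftrightarrow> c \<in> chains L k \<and> (\<forall>\<rho>. bnd V (lookup c) \<rho> = 0)" for c :: "'v set \<Rightarrow>\<^sub>0 'f"
    using chains_lookup_bdry[of c k] by (auto simp: cycles_def poly_mapping_eq_iff fun_eq_iff)
  have add: "lookup (x + y) = lookup x + lookup y" for x y :: "'v set \<Rightarrow>\<^sub>0 'f"
    by (rule ext) (simp add: lookup_add)
  have scale: "lookup (chain_scale a x) = (\<lambda>\<rho>. a * lookup x \<rho>)" for x :: "'v set \<Rightarrow>\<^sub>0 'f" and a
    by (rule ext) (simp add: lookup_chain_scale)
  note S = subspace_chains[of L k, where 'f='f, unfolded chain_space.subspace_def]
  show ?thesis
    unfolding chain_space.subspace_def
  proof (intro conjI ballI allI)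
    show "0 \<in> (cycles L k :: ('v set \<Rightarrow>\<^sub>0 'f) set)"
      unfolding * using S by (simp add: bnd_def)
    show "x + y \<in> cycles L k" if "x \<in> cycles L k" "y \<in> cycles L k" for x y :: "'v set \<Rightarrow>\<^sub>0 'f"
      using that S unfolding * add bnd_add by simp
    show "chain_scale a x \<in> cycles L k" if "x \<in> cycles L k" for x :: "'v set \<Rightarrow>\<^sub>0 'f" and a
      using that S unfolding * scale bnd_scale by simp
  qed
qed

lemma subspace_boundaries: "chain_space.subspace (boundaries L k :: ('v set \<Rightarrow>\<^sub>0 'f) set)"
  unfolding chain_space.subspace_def boundaries_def
proof (intro conjI ballI allI)
  note S = subspace_chains[of L "Suc k", where 'f='f, unfolded chain_space.subspace_def]
  show "0 \<in> bdry ` (chains L (Suc k) :: ('v set \<Rightarrow>\<^sub>0 'f) set)"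
    by (rule image_eqI[of _ _ 0]) (use S in \<open>auto simp: bdry_def\<close>)
  show "x + y \<in> bdry ` chains L (Suc k)" if xy: "x \<in> bdry ` chains L (Suc k)" "y \<in> bdry ` chains L (Suc k)"
    for x y :: "'v set \<Rightarrow>\<^sub>0 'f"
  proof -
    obtain a b :: "'v set \<Rightarrow>\<^sub>0 'f" where ab: "a \<in> chains L (Suc k)" "b \<in> chains L (Suc k)" "x = bdry a" "y = bdry b"
      using xy by blast
    have l: "lookup (a + b) = lookup a + lookup b" by (auto simp: lookup_add)
    have m: "a + b \<in> chains L (Suc k)" using S ab by blast
    have "x + y = bdry (a + b)"
      by (rule poly_mapping_eqI)
         (simp add: ab(3,4) lookup_add chains_lookup_bdry[OF m] chains_lookup_bdry[OF ab(1)]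
            chains_lookup_bdry[OF ab(2)] l bnd_add del: plus_fun_apply)
    then show ?thesis using S ab by blast
  qed
  show "chain_scale a x \<in> bdry ` chains L (Suc k)" if xy: "x \<in> bdry ` chains L (Suc k)"
    for x :: "'v set \<Rightarrow>\<^sub>0 'f" and a
  proof -
    obtain b :: "'v set \<Rightarrow>\<^sub>0 'f" where b: "b \<in> chains L (Suc k)" "x = bdry b" using xy by blast
    have l: "lookup (chain_scale a b) = (\<lambda>\<rho>. a * lookup b \<rho>)" by (auto simp: lookup_chain_scale)
    have m: "chain_scale a b \<in> chains L (Suc k)" using S b by blast
    have "chain_scale a x = bdry (chain_scale a b)"
      by (rule poly_mapping_eqI)
         (simp add: b(2) lookup_chain_scale chains_lookup_bdry[OF m] chains_lookup_bdry[OF b(1)] l bnd_scale)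
    then show ?thesis using S b by blast
  qed
qed

lemma boundaries_subset_cycles: "(boundaries L k :: ('v set \<Rightarrow>\<^sub>0 'f) set) \<subseteq> cycles L k"
  using bdry_chains bdry_bdry by (auto simp: boundaries_def cycles_def)

text \<open>Through truncated subtraction, a Betti number 0 says only that the dimension of the
  cycles is at most that of the boundaries. Together with the inclusion of boundaries in cycles, and
  finite dimension, this forces equality.\<close>

lemma sphere_exact:
  fixes \<gamma> :: "'v set \<Rightarrow> 'f"
  assumes "j \<noteq> n" "\<And>\<rho>. \<gamma> \<rho> \<noteq> 0 \<Longrightarrow> \<rho> \<in> L \<and> card \<rho> = j" "\<And>\<rho>. bnd V \<gamma> \<rho> = 0"
  obtains \<eta> where "\<And>\<rho>. \<eta> \<rho> \<noteq> 0 \<Longrightarrow> \<rho> \<in> L \<and> card \<rho> = Suc j" "\<And>\<rho>. bnd V \<eta> \<rho> = \<gamma> \<rho>"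
proof -
  have finL: "finite L" using finite_complex[OF LV finV] .
  obtain c :: "'v set \<Rightarrow>\<^sub>0 'f" where c: "c \<in> chains L j" "lookup c = \<gamma>" using chain_of_function[OF finL assms(2)] by blast
  have "bdry c = 0" by (rule poly_mapping_eqI) (simp add: chains_lookup_bdry[OF c(1)] c(2) assms(3))
  then have "c \<in> cycles L j" using c by (simp add: cycles_def)
  moreover have "(cycles L j :: ('v set \<Rightarrow>\<^sub>0 'f) set) = boundaries L j"
  proof (rule chain_space.finite_dim_subspace_diff[OF subspace_boundaries boundaries_subset_cycles])
    show "(cycles L j :: ('v set \<Rightarrow>\<^sub>0 'f) set) \<subseteq> chain_space.span ((\<lambda>\<sigma>. Poly_Mapping.single \<sigma> 1) ` L)"
      using chains_span[of L j] by (auto simp: cycles_def)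
    show "chain_space.dim (cycles L j :: ('v set \<Rightarrow>\<^sub>0 'f) set) \<le> chain_space.dim (boundaries L j :: ('v set \<Rightarrow>\<^sub>0 'f) set)"
    proof -
      have "reduced_betti F L j = 0" using hs assms(1) by (simp add: homology_of_sphere_def)
      then show ?thesis by (simp add: reduced_betti_def)
    qed
  qed (use finL in auto)
  ultimately obtain e :: "'v set \<Rightarrow>\<^sub>0 'f" where e: "e \<in> chains L (Suc j)" "c = bdry e" by (auto simp: boundaries_def)
  show ?thesis
    by (rule that[of "lookup e"])
       (use e c(2) chains_lookup_bdry[OF e(1)] in \<open>auto simp: chains_def in_keys_iff\<close>)
qed

text \<open>Without faces of \<open>Suc n\<close> vertices there are no nonzero boundaries in degree
  \<open>n\<close>, so the Betti number 1 is the dimension of the space of cycles itself;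
  \<open>z\<close> is the fundamental class.\<close>

lemma sphere_top:
  assumes "\<And>\<rho>. \<rho> \<in> L \<Longrightarrow> card \<rho> \<noteq> Suc n"
  obtains z :: "'v set \<Rightarrow> 'f" where "\<And>\<rho>. z \<rho> \<noteq> 0 \<Longrightarrow> \<rho> \<in> L \<and> card \<rho> = n" "\<And>\<rho>. bnd V z \<rho> = 0" "z \<noteq> 0"
    "\<And>\<gamma>. (\<And>\<rho>. \<gamma> \<rho> \<noteq> 0 \<Longrightarrow> \<rho> \<in> L \<and> card \<rho> = n) \<Longrightarrow> (\<And>\<rho>. bnd V \<gamma> \<rho> = 0) \<Longrightarrow> \<exists>a. \<gamma> = (\<lambda>\<rho>. a * z \<rho>)"
proof -
  have finL: "finite L" using finite_complex[OF LV finV] .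
  have "(chains L (Suc n) :: ('v set \<Rightarrow>\<^sub>0 'f) set) = {0}"
  proof -
    have "{\<sigma> \<in> L. card \<sigma> = Suc n} = {}" using assms by blast
    then show ?thesis unfolding chains_def by (simp only: subset_empty keys_eq_empty) simp
  qed
  then have "(boundaries L n :: ('v set \<Rightarrow>\<^sub>0 'f) set) = {0}"
    by (simp add: boundaries_def bdry_def)
  moreover have "reduced_betti F L n = 1" using hs by (simp add: homology_of_sphere_def)
  ultimately have "chain_space.dim (cycles L n :: ('v set \<Rightarrow>\<^sub>0 'f) set) = 1"
    using chain_space.dim_le_card[of "{0 :: 'v set \<Rightarrow>\<^sub>0 'f}" "{}"] by (simp add: reduced_betti_def)
  then obtain c :: "'v set \<Rightarrow>\<^sub>0 'f" where c: "c \<in> cycles L n" "c \<noteq> 0" "\<And>x. x \<in> cycles L n \<Longrightarrow> \<exists>a. x = chain_scale a c"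
    using chain_space.dim_1_obtain[OF subspace_cycles] by blast
  have cc: "c \<in> chains L n" and bc: "bdry c = 0" using c(1) by (auto simp: cycles_def)
  show ?thesis
  proof (rule that[of "lookup c"])
    show "bnd V (lookup c) \<rho> = 0" for \<rho>
      using chains_lookup_bdry[OF cc] bc by (metis lookup_zero)
    show "lookup c \<rho> \<noteq> 0 \<Longrightarrow> \<rho> \<in> L \<and> card \<rho> = n" for \<rho>
      using cc by (auto simp: chains_def in_keys_iff)
    show "lookup c \<noteq> 0" using c(2) by (auto simp: poly_mapping_eq_iff fun_eq_iff)
    fix \<gamma> :: "'v set \<Rightarrow> 'f"
    assume g: "\<And>\<rho>. \<gamma> \<rho> \<noteq> 0 \<Longrightarrow> \<rho> \<in> L \<and> card \<rho> = n" "\<And>\<rho>. bnd V \<gamma> \<rho> = 0"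
    obtain e :: "'v set \<Rightarrow>\<^sub>0 'f" where e: "e \<in> chains L n" "lookup e = \<gamma>" using chain_of_function[OF finL g(1)] by blast
    have "bdry e = 0" by (rule poly_mapping_eqI) (simp add: chains_lookup_bdry[OF e(1)] e(2) g(2))
    then have "e \<in> cycles L n" using e by (simp add: cycles_def)
    then obtain a where "e = chain_scale a c" using c(3) by blast
    then have "\<gamma> = (\<lambda>\<rho>. a * lookup c \<rho>)" using e(2) lookup_chain_scale by fastforce
    then show "\<exists>a. \<gamma> = (\<lambda>\<rho>. a * lookup c \<rho>)" by blast
  qed
qed

end

section \<open>The dual partition complex\<close>

text \<open>\<open>sphere_links\<close> includes the empty face, hence the homology of \<Delta>
  itself. \<open>nonsing_faces\<close> is imposed on all faces, so that the first
  \<open>card \<tau>\<close> forms are coordinates on every face \<tau>, not only on facets.\<close>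

locale sphere_rows = coeff_rows V c
  for V :: "'v::linorder set" and c :: "nat \<times> 'v \<Rightarrow> 'f::field" +
  fixes \<Delta> :: "'v set set" and d :: nat
  assumes down: "\<And>\<sigma> \<tau>. \<sigma> \<in> \<Delta> \<Longrightarrow> \<tau> \<subseteq> \<sigma> \<Longrightarrow> \<tau> \<in> \<Delta>"
    and empty_face: "{} \<in> \<Delta>"
    and faces_subset: "\<Delta> \<subseteq> Pow V"
    and facet_ext: "\<And>\<sigma>. \<sigma> \<in> \<Delta> \<Longrightarrow> \<exists>F\<in>\<Delta>. \<sigma> \<subseteq> F \<and> card F = d"
    and card_le: "\<And>\<sigma>. \<sigma> \<in> \<Delta> \<Longrightarrow> card \<sigma> \<le> d"
    and sphere_links: "\<And>\<sigma>. \<sigma> \<in> \<Delta> \<Longrightarrow> homology_of_sphere TYPE('f) (d - card \<sigma>) (link \<Delta> \<sigma>)"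
    and nonsing_faces: "\<And>\<sigma>. \<sigma> \<in> \<Delta> \<Longrightarrow> nonsing \<sigma>"
begin

definition star :: "'v set \<Rightarrow> 'v set set" where
  "star \<tau> = {\<eta>. \<eta> \<union> \<tau> \<in> \<Delta>}"

text \<open>The duals of the star complexes modulo the first \<open>s\<close> one-forms: \<open>j\<close> is the number of vertices
  of the link face \<open>\<rho>\<close>, and \<open>i\<close> the polynomial degree.\<close>

definition C :: "nat \<Rightarrow> 'v set \<Rightarrow> nat \<Rightarrow> nat \<Rightarrow> ('v set \<Rightarrow> ('v \<Rightarrow>\<^sub>0 nat) \<Rightarrow> 'f) set" where
  "C s \<tau> j i = {g. \<forall>\<rho>. (g \<rho> \<noteq> 0 \<longrightarrow> \<rho> \<in> link \<Delta> \<tau> \<and> card \<rho> = j) \<and> g \<rho> \<in> E s (star (\<tau> \<union> \<rho>)) \<and> homog i (g \<rho>)}"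

definition Bd :: "('v set \<Rightarrow> ('v \<Rightarrow>\<^sub>0 nat) \<Rightarrow> 'f) \<Rightarrow> ('v set \<Rightarrow> ('v \<Rightarrow>\<^sub>0 nat) \<Rightarrow> 'f)" where
  "Bd g = (\<lambda>\<rho> \<mu>. bnd V (\<lambda>\<rho>. g \<rho> \<mu>) \<rho>)"

definition ThC :: "nat \<Rightarrow> ('v set \<Rightarrow> ('v \<Rightarrow>\<^sub>0 nat) \<Rightarrow> 'f) \<Rightarrow> ('v set \<Rightarrow> ('v \<Rightarrow>\<^sub>0 nat) \<Rightarrow> 'f)" where
  "ThC k g = (\<lambda>\<rho>. Th k (g \<rho>))"

definition exact_at :: "nat \<Rightarrow> 'v set \<Rightarrow> nat \<Rightarrow> nat \<Rightarrow> bool" where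
  "exact_at s \<tau> j i \<longleftrightarrow> (\<forall>g\<in>C s \<tau> j i. Bd g = 0 \<longrightarrow> (\<exists>h\<in>C s \<tau> (Suc j) i. Bd h = g))"

text \<open>Surjectivity of the form \<open>s\<close> on cycles: the condition under which a filling
  can be corrected to one that the form \<open>s\<close> kills.\<close>

definition lifts :: "nat \<Rightarrow> 'v set \<Rightarrow> nat \<Rightarrow> nat \<Rightarrow> bool" where
  "lifts s \<tau> j i \<longleftrightarrow> (\<forall>w\<in>C s \<tau> j i. Bd w = 0 \<longrightarrow> (\<exists>y\<in>C s \<tau> j (Suc i). Bd y = 0 \<and> ThC s y = w))"

text \<open>Dual form of a nonzerodivisor: multiplication by the form \<open>s\<close> is injective
  on the face ring of the star modulo the earlier forms exactly when its transpose is surjective on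
  the graded dual.\<close>

definition regular :: "'v set \<Rightarrow> nat \<Rightarrow> bool" where
  "regular \<tau> s \<longleftrightarrow> (\<forall>i. \<forall>f\<in>E s (star \<tau>). homog i f \<longrightarrow> (\<exists>f'\<in>E s (star \<tau>). Th s f' = f))"

lemma finite_face: "\<sigma> \<in> \<Delta> \<Longrightarrow> finite \<sigma>"
  using faces_subset finite_V by (auto intro: finite_subset)

lemma face_in_V: "\<sigma> \<in> \<Delta> \<Longrightarrow> x \<in> \<sigma> \<Longrightarrow> x \<in> V"
  using faces_subset by blast

lemma link_iff: "\<rho> \<in> link \<Delta> \<tau> \<longleftrightarrow> \<rho> \<inter> \<tau> = {} \<and> \<rho> \<union> \<tau> \<in> \<Delta>"
  unfolding link_def using down by blast

lemma star_iff: "\<eta> \<in> star \<tau> \<longleftrightarrow> \<eta> \<union> \<tau> \<in> \<Delta>"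
  by (simp add: star_def)

lemma star_down: "\<sigma> \<in> star \<tau> \<Longrightarrow> \<sigma>' \<subseteq> \<sigma> \<Longrightarrow> \<sigma>' \<in> star \<tau>"
  unfolding star_def using down[of "\<sigma> \<union> \<tau>" "\<sigma>' \<union> \<tau>"] by blast

lemma star_mono: "\<tau> \<subseteq> \<tau>' \<Longrightarrow> star \<tau>' \<subseteq> star \<tau>"
  unfolding star_def using down by (blast intro: down)

lemma star_empty: "star {} = \<Delta>"
  by (simp add: star_def)

lemma finite_link: "\<rho> \<in> link \<Delta> \<tau> \<Longrightarrow> finite \<rho>"
  using finite_face by (auto simp: link_def)

lemma link_card: "\<rho> \<in> link \<Delta> \<tau> \<Longrightarrow> card \<rho> + card \<tau> \<le> d"
  using card_le[of "\<rho> \<union> \<tau>"] finite_face[of "\<rho> \<union> \<tau>"] by (auto simp: link_iff card_Un_disjoint)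

lemma C_I:
  "(\<And>\<rho>. g \<rho> \<noteq> 0 \<Longrightarrow> \<rho> \<in> link \<Delta> \<tau> \<and> card \<rho> = j) \<Longrightarrow> (\<And>\<rho>. g \<rho> \<in> E s (star (\<tau> \<union> \<rho>))) \<Longrightarrow>
   (\<And>\<rho>. homog i (g \<rho>)) \<Longrightarrow> g \<in> C s \<tau> j i"
  by (simp add: C_def)

lemma C_supp: "g \<in> C s \<tau> j i \<Longrightarrow> g \<rho> \<noteq> 0 \<Longrightarrow> \<rho> \<in> link \<Delta> \<tau> \<and> card \<rho> = j"
  by (simp add: C_def)

lemma C_E: "g \<in> C s \<tau> j i \<Longrightarrow> g \<rho> \<in> E s (star (\<tau> \<union> \<rho>))"
  by (simp add: C_def)

lemma C_homog: "g \<in> C s \<tau> j i \<Longrightarrow> homog i (g \<rho>)"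
  by (simp add: C_def)

lemma C_supp': "g \<in> C s \<tau> j i \<Longrightarrow> g \<rho> \<mu> \<noteq> 0 \<Longrightarrow> \<rho> \<in> link \<Delta> \<tau> \<and> card \<rho> = j"
  using C_supp by (metis zero_fun_apply)

lemma C_zero [simp]: "0 \<in> C s \<tau> j i"
  by (rule C_I) auto

lemma C_Suc: "g \<in> C (Suc s) \<tau> j i \<longleftrightarrow> g \<in> C s \<tau> j i \<and> ThC s g = 0"
  by (auto simp: C_def E_Suc ThC_def fun_eq_iff)

lemma C_diff: "g \<in> C s \<tau> j i \<Longrightarrow> h \<in> C s \<tau> j i \<Longrightarrow> g - h \<in> C s \<tau> j i"
proof (rule C_I)
  fix \<rho> assume g: "g \<in> C s \<tau> j i" and h: "h \<in> C s \<tau> j i"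
  show "(g - h) \<rho> \<in> E s (star (\<tau> \<union> \<rho>))" "homog i ((g - h) \<rho>)"
    using E_diff[OF C_E[OF g] C_E[OF h], of \<rho>] homog_diff[OF C_homog[OF g] C_homog[OF h], of \<rho> \<rho>]
    by simp_all
  assume "(g - h) \<rho> \<noteq> 0"
  then have "g \<rho> \<noteq> 0 \<or> h \<rho> \<noteq> 0" by fastforce
  then show "\<rho> \<in> link \<Delta> \<tau> \<and> card \<rho> = j" using C_supp g h by blast
qed

lemma C_scale: "g \<in> C s \<tau> j i \<Longrightarrow> (\<lambda>\<rho> \<mu>. a * g \<rho> \<mu>) \<in> C s \<tau> j i"
proof (rule C_I)
  fix \<rho> assume g: "g \<in> C s \<tau> j i"
  show "(\<lambda>\<mu>. a * g \<rho> \<mu>) \<in> E s (star (\<tau> \<union> \<rho>))" "homog i (\<lambda>\<mu>. a * g \<rho> \<mu>)"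
    using E_scale C_E g homog_scale C_homog by blast+
  assume "(\<lambda>\<mu>. a * g \<rho> \<mu>) \<noteq> 0"
  then obtain \<mu> where "g \<rho> \<mu> \<noteq> 0" by fastforce
  then show "\<rho> \<in> link \<Delta> \<tau> \<and> card \<rho> = j" using C_supp' g by blast
qed

lemma C_ThC: "g \<in> C s \<tau> j (Suc i) \<Longrightarrow> ThC k g \<in> C s \<tau> j i"
proof (rule C_I)
  fix \<rho> assume g: "g \<in> C s \<tau> j (Suc i)"
  show "ThC k g \<rho> \<in> E s (star (\<tau> \<union> \<rho>))"
    unfolding ThC_def using C_E[OF g] by (rule E_Th_closed) (rule star_down)
  show "homog i (ThC k g \<rho>)"
    unfolding ThC_def using C_homog[OF g] by (rule homog_Th)
  assume "ThC k g \<rho> \<noteq> 0"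
  then have "g \<rho> \<noteq> 0" unfolding ThC_def using Th_zero by metis
  then show "\<rho> \<in> link \<Delta> \<tau> \<and> card \<rho> = j" using C_supp g by blast
qed

lemma Bd_sum: "Bd g \<rho> = (\<Sum>v\<in>V - \<rho>. (\<lambda>\<mu>. sg v \<rho> * g (insert v \<rho>) \<mu>))"
  by (rule ext) (simp add: Bd_def bnd_def sum_fun_apply)

lemma Bd_C: "g \<in> C s \<tau> (Suc j) i \<Longrightarrow> Bd g \<in> C s \<tau> j i"
proof (rule C_I)
  fix \<rho> assume g: "g \<in> C s \<tau> (Suc j) i"
  have "g (insert v \<rho>) \<in> E s (star (\<tau> \<union> \<rho>))" for v
    using C_E[OF g, of "insert v \<rho>"] star_mono by (rule E_mono) auto
  then show "Bd g \<rho> \<in> E s (star (\<tau> \<union> \<rho>))"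
    unfolding Bd_sum by (intro E_sum E_scale)
  show "homog i (Bd g \<rho>)"
    unfolding homog_def Bd_def bnd_def
  proof (intro allI impI)
    fix \<mu> assume "(\<Sum>v\<in>V - \<rho>. sg v \<rho> * g (insert v \<rho>) \<mu>) \<noteq> 0"
    then obtain v where "g (insert v \<rho>) \<mu> \<noteq> 0"
      by (metis (no_types, lifting) mult_zero_right sum.neutral)
    then show "mdeg \<mu> = i" using C_homog[OF g] by (auto simp: homog_def)
  qed
  assume "Bd g \<rho> \<noteq> 0"
  then obtain \<mu> where "Bd g \<rho> \<mu> \<noteq> 0" by fastforce
  then have "(\<Sum>v\<in>V - \<rho>. sg v \<rho> * g (insert v \<rho>) \<mu>) \<noteq> 0" by (simp add: Bd_def bnd_def)
  then obtain v where v: "v \<in> V - \<rho>" "g (insert v \<rho>) \<mu> \<noteq> 0"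
    by (metis (no_types, lifting) mult_zero_right sum.neutral)
  then have i: "insert v \<rho> \<in> link \<Delta> \<tau>" "card (insert v \<rho>) = Suc j" using C_supp'[OF g] by blast+
  then have "finite \<rho>" using finite_link[of "insert v \<rho>"] by simp
  then have "card \<rho> = j" using i v by simp
  moreover have "\<rho> \<in> link \<Delta> \<tau>" using i(1) down[of "insert v \<rho> \<union> \<tau>" "\<rho> \<union> \<tau>"] by (auto simp: link_iff)
  ultimately show "\<rho> \<in> link \<Delta> \<tau> \<and> card \<rho> = j" by blast
qed

lemma ThC_Bd: "ThC k (Bd g) = Bd (ThC k g)"
  unfolding ThC_def Bd_def bnd_def
  by (intro ext) (simp add: Th_apply sum_distrib_left sum.swap[of _ V] mult.left_commute)

lemma Bd_zero [simp]: "Bd 0 = 0"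
  by (intro ext) (simp add: Bd_def bnd_def)

lemma Bd_diff: "Bd (g - h) = Bd g - Bd h"
  by (intro ext) (simp add: Bd_def bnd_def right_diff_distrib sum_subtractf)

lemma Bd_scale: "Bd (\<lambda>\<rho> \<mu>. a * g \<rho> \<mu>) = (\<lambda>\<rho> \<mu>. a * Bd g \<rho> \<mu>)"
  by (intro ext) (simp add: Bd_def bnd_def sum_distrib_left mult.left_commute)

lemma ThC_diff: "ThC k (g - h) = ThC k g - ThC k h"
  by (rule ext) (simp add: ThC_def Th_diff)

lemma ThC_scale: "ThC k (\<lambda>\<rho> \<mu>. a * g \<rho> \<mu>) = (\<lambda>\<rho> \<mu>. a * ThC k g \<rho> \<mu>)"
  by (rule ext) (simp add: ThC_def Th_scale)

lemma Bd_Bd: "g \<in> C s \<tau> j i \<Longrightarrow> Bd (Bd g) = 0"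
proof (intro ext)
  fix \<rho> \<mu> assume g: "g \<in> C s \<tau> j i"
  show "Bd (Bd g) \<rho> \<mu> = 0 \<rho> \<mu>"
  proof (cases "finite \<rho>")
    case True
    then show ?thesis by (simp add: Bd_def bnd_bnd finite_V)
  next
    case False
    then have "g (insert w (insert v \<rho>)) \<mu> = 0" for v w
      using C_supp'[OF g] finite_link by (metis finite_insert)
    then show ?thesis by (simp add: Bd_def bnd_def)
  qed
qed

lemma ThC_surj:
  assumes reg: "\<And>\<rho>. \<rho> \<in> link \<Delta> \<tau> \<Longrightarrow> card \<rho> = j \<Longrightarrow> regular (\<tau> \<union> \<rho>) s"
    and g: "g \<in> C s \<tau> j i"
  shows "\<exists>g'\<in>C s \<tau> j (Suc i). ThC s g' = g"
proof -
  have "\<exists>f'\<in>E s (star (\<tau> \<union> \<rho>)). Th s f' = g \<rho>" if "\<rho> \<in> link \<Delta> \<tau>" "card \<rho> = j" for \<rho>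
    using reg[OF that] C_E[OF g, of \<rho>] C_homog[OF g, of \<rho>] unfolding regular_def by blast
  then obtain F where F: "\<And>\<rho>. \<rho> \<in> link \<Delta> \<tau> \<Longrightarrow> card \<rho> = j \<Longrightarrow> F \<rho> \<in> E s (star (\<tau> \<union> \<rho>)) \<and> Th s (F \<rho>) = g \<rho>"
    by metis
  \<comment> \<open>Preimages are chosen independently for each face. They need not be homogeneous,
    and the part of degree \<open>Suc i\<close> is the one that matters.\<close>
  define g' where "g' \<rho> = (if \<rho> \<in> link \<Delta> \<tau> \<and> card \<rho> = j then proj (Suc i) (F \<rho>) else 0)" for \<rho>
  have "g' \<in> C s \<tau> j (Suc i)"
    by (rule C_I) (auto simp: g'_def F intro!: E_proj split: if_splits)
  moreover have "ThC s g' \<rho> = g \<rho>" for \<rho>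
  proof (cases "\<rho> \<in> link \<Delta> \<tau> \<and> card \<rho> = j")
    case True
    show ?thesis
    proof
      fix \<mu>
      have "ThC s g' \<rho> \<mu> = (if mdeg \<mu> = i then g \<rho> \<mu> else 0)"
        using True F[of \<rho>] by (simp add: ThC_def g'_def Th_proj)
      then show "ThC s g' \<rho> \<mu> = g \<rho> \<mu>" using C_homog[OF g, of \<rho>] by (auto simp: homog_def)
    qed
  next
    case False
    then have "g \<rho> = 0" using C_supp[OF g] by blast
    then show ?thesis unfolding ThC_def g'_def using False Th_zero by auto
  qed
  ultimately show ?thesis by blast
qed

text \<open>Part of the long exact sequence for dividing out one more form. If \<open>h\<close>
  fills \<open>g\<close> and the form kills \<open>g\<close>, then its value on \<open>h\<close> is
  a cycle; lifting that cycle to a cycle \<open>y\<close> makes \<open>h - y\<close> a filling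
  killed by the form. In degree 0 every form already acts as 0.\<close>

lemma exact_at_Suc:
  assumes X: "exact_at s \<tau> j i" and lift: "\<And>i'. i = Suc i' \<Longrightarrow> lifts s \<tau> (Suc j) i'"
  shows "exact_at (Suc s) \<tau> j i"
  unfolding exact_at_def
proof (intro ballI impI)
  fix g assume g: "g \<in> C (Suc s) \<tau> j i" and Bg: "Bd g = 0"
  then have gs: "g \<in> C s \<tau> j i" and Tg: "ThC s g = 0" by (auto simp: C_Suc)
  obtain h where h: "h \<in> C s \<tau> (Suc j) i" "Bd h = g" using X gs Bg by (auto simp: exact_at_def)
  show "\<exists>h\<in>C (Suc s) \<tau> (Suc j) i. Bd h = g"
  proof (cases i)
    case 0
    have "ThC s h = 0"
      by (rule ext) (use C_homog[OF h(1)] 0 Th_homog_0 in \<open>auto simp: ThC_def\<close>)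
    then show ?thesis using h by (auto simp: C_Suc)
  next
    case (Suc i')
    have w: "ThC s h \<in> C s \<tau> (Suc j) i'" using h(1) C_ThC Suc by blast
    have "Bd (ThC s h) = 0" using h(2) Tg by (simp flip: ThC_Bd)
    then obtain y where y: "y \<in> C s \<tau> (Suc j) (Suc i')" "Bd y = 0" "ThC s y = ThC s h"
      using lift[OF Suc] w unfolding lifts_def by blast
    have "h - y \<in> C s \<tau> (Suc j) i" using h(1) y(1) Suc C_diff by blast
    moreover have "ThC s (h - y) = 0" by (simp add: ThC_diff y(3))
    moreover have "Bd (h - y) = g" by (simp add: Bd_diff h(2) y(2))
    ultimately show ?thesis by (auto simp: C_Suc)
  qed
qed

text \<open>Fill \<open>w\<close>, lift the filling along the form, which is surjective on chains,
  and take the boundary of the lift.\<close>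

lemma exact_lifts:
  assumes X: "exact_at s \<tau> j i"
    and reg: "\<And>\<rho>. \<rho> \<in> link \<Delta> \<tau> \<Longrightarrow> card \<rho> = Suc j \<Longrightarrow> regular (\<tau> \<union> \<rho>) s"
  shows "lifts s \<tau> j i"
  unfolding lifts_def
proof (intro ballI impI)
  fix w assume w: "w \<in> C s \<tau> j i" "Bd w = 0"
  then obtain h where h: "h \<in> C s \<tau> (Suc j) i" "Bd h = w" using X by (auto simp: exact_at_def)
  obtain y where y: "y \<in> C s \<tau> (Suc j) (Suc i)" "ThC s y = h"
    using ThC_surj[OF reg h(1)] by blast
  show "\<exists>y\<in>C s \<tau> j (Suc i). Bd y = 0 \<and> ThC s y = w"
    by (rule bexI[of _ "Bd y"]) (use y h Bd_C Bd_Bd[OF y(1)] in \<open>auto simp: ThC_Bd\<close>)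
qed

text \<open>In the multidegree of a monomial with a variable \<open>x\<close> outside \<open>\<tau>\<close>, the complex computes the
  homology of a cone with apex \<open>x\<close>.\<close>

lemma cone_filling:
  assumes g: "g \<in> C 0 \<tau> j i" and Bg: "Bd g = 0" and x: "x \<in> keys \<mu>" "x \<notin> \<tau>"
  obtains \<eta> where "\<And>\<rho>. \<eta> \<rho> \<noteq> 0 \<Longrightarrow> \<rho> \<in> link \<Delta> \<tau> \<and> card \<rho> = Suc j \<and> keys \<mu> \<in> star (\<tau> \<union> \<rho>)"
    "\<And>\<rho>. bnd V \<eta> \<rho> = g \<rho> \<mu>"
proof (cases "\<forall>\<rho>. g \<rho> \<mu> = 0")
  case True
  then show ?thesis by (intro that[of "\<lambda>_. 0"]) (auto simp: bnd_def)
next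
  case False
  then obtain \<rho>0 where "g \<rho>0 \<mu> \<noteq> 0" by blast
  then have "keys \<mu> \<union> (\<tau> \<union> \<rho>0) \<in> \<Delta>" using E_keys[OF C_E[OF g]] star_iff by blast
  then have xV: "x \<in> V" using face_in_V x(1) by blast
  have B0: "bnd V (\<lambda>\<rho>. g \<rho> \<mu>) \<rho> = 0" for \<rho> using Bg by (simp add: Bd_def fun_eq_iff)
  show ?thesis
  proof (rule that[of "cone x (\<lambda>\<rho>. g \<rho> \<mu>)"])
    show "bnd V (cone x (\<lambda>\<rho>. g \<rho> \<mu>)) \<rho> = g \<rho> \<mu>" for \<rho>
    proof (cases "finite \<rho>")
      case True
      show ?thesis using bnd_cone[OF finite_V xV True B0] .
    next
      case False
      have "g \<sigma> \<mu> = 0" if "infinite \<sigma>" for \<sigma> using that C_supp'[OF g] finite_link by blast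
      then have g0: "g (insert v \<rho> - {x}) \<mu> = 0" "g \<rho> \<mu> = 0" for v using False by auto
      have "cone x (\<lambda>\<rho>. g \<rho> \<mu>) (insert v \<rho>) = 0" for v
        unfolding cone_def g0(1) by simp
      then show ?thesis using g0(2) by (simp add: bnd_def)
    qed
    fix \<rho> assume "cone x (\<lambda>\<rho>. g \<rho> \<mu>) \<rho> \<noteq> 0"
    then have r: "x \<in> \<rho>" "g (\<rho> - {x}) \<mu> \<noteq> 0" by (auto simp: cone_def split: if_splits)
    then have l: "\<rho> - {x} \<in> link \<Delta> \<tau>" "card (\<rho> - {x}) = j" using C_supp'[OF g] by blast+
    have st: "keys \<mu> \<union> (\<tau> \<union> (\<rho> - {x})) \<in> \<Delta>" using E_keys[OF C_E[OF g] r(2)] star_iff by blast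
    have eq: "keys \<mu> \<union> (\<tau> \<union> (\<rho> - {x})) = keys \<mu> \<union> (\<tau> \<union> \<rho>)" using x by blast
    have "\<rho> \<union> \<tau> \<in> \<Delta>" using st unfolding eq by (rule down) blast
    moreover have "\<rho> \<inter> \<tau> = {}" using l(1) x by (auto simp: link_iff)
    moreover have "card \<rho> = Suc j" using l finite_link r(1) by (metis card.remove finite_Diff2 finite.emptyI finite.insertI)
    ultimately show "\<rho> \<in> link \<Delta> \<tau> \<and> card \<rho> = Suc j \<and> keys \<mu> \<in> star (\<tau> \<union> \<rho>)"
      using st unfolding eq by (simp add: link_iff star_iff)
  qed
qed

lemma link_down: "\<sigma> \<in> link \<Delta> \<tau> \<Longrightarrow> \<sigma>' \<subseteq> \<sigma> \<Longrightarrow> \<sigma>' \<in> link \<Delta> \<tau>"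
  unfolding link_iff using down[of "\<sigma> \<union> \<tau>" "\<sigma>' \<union> \<tau>"] by blast

lemma link_in_Pow: "link \<Delta> \<tau> \<subseteq> Pow V"
  using faces_subset by (auto simp: link_def)

lemma link_exact:
  assumes "\<tau> \<in> \<Delta>" "j \<noteq> d - card \<tau>" "\<And>\<rho>. \<gamma> \<rho> \<noteq> 0 \<Longrightarrow> \<rho> \<in> link \<Delta> \<tau> \<and> card \<rho> = j" "\<And>\<rho>. bnd V \<gamma> \<rho> = 0"
  obtains \<eta> :: "'v set \<Rightarrow> 'f" where "\<And>\<rho>. \<eta> \<rho> \<noteq> 0 \<Longrightarrow> \<rho> \<in> link \<Delta> \<tau> \<and> card \<rho> = Suc j" "\<And>\<rho>. bnd V \<eta> \<rho> = \<gamma> \<rho>"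
proof (rule sphere_exact[where V = V and L = "link \<Delta> \<tau>" and n = "d - card \<tau>" and F = "TYPE('f)" and j = j and \<gamma> = \<gamma>])
  show "\<sigma>' \<in> link \<Delta> \<tau>" if "\<sigma> \<in> link \<Delta> \<tau>" "\<sigma>' \<subseteq> \<sigma>" for \<sigma> \<sigma>'
    using link_down that by blast
qed (use that assms link_in_Pow sphere_links finite_V in auto)

lemma link_top:
  assumes "\<tau> \<in> \<Delta>"
  obtains z :: "'v set \<Rightarrow> 'f" where "\<And>\<rho>. z \<rho> \<noteq> 0 \<Longrightarrow> \<rho> \<in> link \<Delta> \<tau> \<and> card \<rho> = d - card \<tau>"
    "\<And>\<rho>. bnd V z \<rho> = 0" "z \<noteq> 0"
    "\<And>\<gamma>. (\<And>\<rho>. \<gamma> \<rho> \<noteq> 0 \<Longrightarrow> \<rho> \<in> link \<Delta> \<tau> \<and> card \<rho> = d - card \<tau>) \<Longrightarrow> (\<And>\<rho>. bnd V \<gamma> \<rho> = 0) \<Longrightarrow> \<exists>a. \<gamma> = (\<lambda>\<rho>. a * z \<rho>)"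
proof (rule sphere_top[where V = V and L = "link \<Delta> \<tau>" and n = "d - card \<tau>" and F = "TYPE('f)"])
  show "\<sigma>' \<in> link \<Delta> \<tau>" if "\<sigma> \<in> link \<Delta> \<tau>" "\<sigma>' \<subseteq> \<sigma>" for \<sigma> \<sigma>'
    using link_down that by blast
  show "card \<rho> \<noteq> Suc (d - card \<tau>)" if "\<rho> \<in> link \<Delta> \<tau>" for \<rho>
    using link_card[OF that] by simp
next
  fix z :: "'v set \<Rightarrow> 'f"
  assume "\<And>\<rho>. z \<rho> \<noteq> 0 \<Longrightarrow> \<rho> \<in> link \<Delta> \<tau> \<and> card \<rho> = d - card \<tau>" "\<And>\<rho>. bnd V z \<rho> = 0" "z \<noteq> 0"
    "\<And>\<gamma>. (\<And>\<rho>. \<gamma> \<rho> \<noteq> 0 \<Longrightarrow> \<rho> \<in> link \<Delta> \<tau> \<and> card \<rho> = d - card \<tau>) \<Longrightarrow> (\<And>\<rho>. bnd V \<gamma> \<rho> = 0) \<Longrightarrow> \<exists>a. \<gamma> = (\<lambda>\<rho>. a * z \<rho>)"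
  then show thesis by (rule that)
qed (use link_in_Pow sphere_links[OF assms] finite_V in auto)

text \<open>Before any form is divided out, \<open>Bd\<close> acts on each monomial separately. A
  monomial supported in \<tau> sees the entire link of \<tau>; any other one sees a cone. The
  fillings are chosen one monomial at a time.\<close>

lemma exact_at_0:
  assumes \<tau>: "\<tau> \<in> \<Delta>" and j: "j \<noteq> d - card \<tau>"
  shows "exact_at 0 \<tau> j i"
  unfolding exact_at_def
proof (intro ballI impI)
  fix g assume g: "g \<in> C 0 \<tau> j i" and Bg: "Bd g = 0"
  have B0: "bnd V (\<lambda>\<rho>. g \<rho> \<mu>) \<rho> = 0" for \<rho> \<mu> using Bg by (simp add: Bd_def fun_eq_iff)
  have "\<exists>\<eta>. (\<forall>\<rho>. \<eta> \<rho> \<noteq> 0 \<longrightarrow> \<rho> \<in> link \<Delta> \<tau> \<and> card \<rho> = Suc j \<and> keys \<mu> \<in> star (\<tau> \<union> \<rho>) \<and> mdeg \<mu> = i)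
      \<and> (\<forall>\<rho>. bnd V \<eta> \<rho> = g \<rho> \<mu>)" for \<mu>
  proof (cases "mdeg \<mu> = i")
    case False
    then have "g \<rho> \<mu> = 0" for \<rho> using C_homog[OF g] by (auto simp: homog_def)
    then show ?thesis by (intro exI[of _ "\<lambda>_. 0"]) (auto simp: bnd_def)
  next
    case deg: True
    show ?thesis
    proof (cases "keys \<mu> \<subseteq> \<tau>")
      case True
      obtain \<eta> where \<eta>: "\<And>\<rho>. \<eta> \<rho> \<noteq> 0 \<Longrightarrow> \<rho> \<in> link \<Delta> \<tau> \<and> card \<rho> = Suc j" "\<And>\<rho>. bnd V \<eta> \<rho> = g \<rho> \<mu>"
        using link_exact[OF \<tau> j C_supp'[OF g, of _ \<mu>] B0] by blast
      have "keys \<mu> \<in> star (\<tau> \<union> \<rho>)" if "\<rho> \<in> link \<Delta> \<tau>" for \<rho>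
      proof -
        have "keys \<mu> \<union> (\<tau> \<union> \<rho>) = \<rho> \<union> \<tau>" using True by blast
        then show ?thesis using that by (simp add: star_iff link_iff)
      qed
      then show ?thesis using \<eta> deg by blast
    next
      case False
      then obtain x where "x \<in> keys \<mu>" "x \<notin> \<tau>" by blast
      then show ?thesis using cone_filling[OF g Bg] deg by metis
    qed
  qed
  then obtain H where H: "\<And>\<mu> \<rho>. H \<mu> \<rho> \<noteq> 0 \<Longrightarrow> \<rho> \<in> link \<Delta> \<tau> \<and> card \<rho> = Suc j \<and> keys \<mu> \<in> star (\<tau> \<union> \<rho>) \<and> mdeg \<mu> = i"
    "\<And>\<mu> \<rho>. bnd V (H \<mu>) \<rho> = g \<rho> \<mu>" by metis
  define h where "h = (\<lambda>\<rho> \<mu>. H \<mu> \<rho>)"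
  have "h \<in> C 0 \<tau> (Suc j) i"
  proof (rule C_I)
    fix \<rho>
    show "h \<rho> \<in> E 0 (star (\<tau> \<union> \<rho>))" by (rule E_I) (use H(1) in \<open>auto simp: h_def\<close>)
    show "homog i (h \<rho>)" using H(1) by (auto simp: homog_def h_def)
    assume "h \<rho> \<noteq> 0"
    then show "\<rho> \<in> link \<Delta> \<tau> \<and> card \<rho> = Suc j" using H(1) by (auto simp: h_def fun_eq_iff)
  qed
  moreover have "Bd h = g" using H(2) by (simp add: Bd_def h_def)
  ultimately show "\<exists>h\<in>C 0 \<tau> (Suc j) i. Bd h = g" by blast
qed

text \<open>Top cycles are the fundamental class \<open>z\<close> of the link tensored with
  functions on the simplex \<tau>. On a monomial with a variable outside \<tau>, a cycle would be
  filled by a chain on faces with \<open>Suc n\<close> vertices, and the link has none.\<close>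

lemma top_cycles:
  assumes \<tau>: "\<tau> \<in> \<Delta>" and n: "n = d - card \<tau>"
  obtains z where
    "\<And>s i f. f \<in> E s (Pow \<tau>) \<Longrightarrow> homog i f \<Longrightarrow> (\<lambda>\<rho> \<mu>. z \<rho> * f \<mu>) \<in> C s \<tau> n i \<and> Bd (\<lambda>\<rho> \<mu>. z \<rho> * f \<mu>) = 0"
    "\<And>s i g. g \<in> C s \<tau> n i \<Longrightarrow> Bd g = 0 \<Longrightarrow> \<exists>f\<in>E s (Pow \<tau>). homog i f \<and> g = (\<lambda>\<rho> \<mu>. z \<rho> * f \<mu>)"
    "\<exists>\<rho>. z \<rho> \<noteq> 0"
proof -
  have no_face: "card \<rho> \<noteq> Suc n" if "\<rho> \<in> link \<Delta> \<tau>" for \<rho> using link_card[OF that] n by simp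
  obtain z :: "'v set \<Rightarrow> 'f" where z: "\<And>\<rho>. z \<rho> \<noteq> 0 \<Longrightarrow> \<rho> \<in> link \<Delta> \<tau> \<and> card \<rho> = n" "\<And>\<rho>. bnd V z \<rho> = 0" "z \<noteq> 0"
    and zall: "\<And>\<gamma>. (\<And>\<rho>. \<gamma> \<rho> \<noteq> 0 \<Longrightarrow> \<rho> \<in> link \<Delta> \<tau> \<and> card \<rho> = n) \<Longrightarrow> (\<And>\<rho>. bnd V \<gamma> \<rho> = 0) \<Longrightarrow> \<exists>a. \<gamma> = (\<lambda>\<rho>. a * z \<rho>)"
    using link_top[OF \<tau>, folded n] by blast
  obtain \<rho>0 where \<rho>0: "z \<rho>0 \<noteq> 0" using z(3) by (auto simp: fun_eq_iff)
  show ?thesis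
  proof (rule that[of z])
    fix s i f assume f: "f \<in> E s (Pow \<tau>)" "homog i f"
    have "(\<lambda>\<mu>. z \<rho> * f \<mu>) \<in> E s (star (\<tau> \<union> \<rho>))" for \<rho>
    proof (cases "z \<rho> = 0")
      case False
      have "Pow \<tau> \<subseteq> star (\<tau> \<union> \<rho>)"
      proof
        fix \<eta> assume "\<eta> \<in> Pow \<tau>"
        then have "\<eta> \<union> (\<tau> \<union> \<rho>) = \<rho> \<union> \<tau>" by blast
        then show "\<eta> \<in> star (\<tau> \<union> \<rho>)" using z(1)[OF False] by (simp add: star_iff link_iff)
      qed
      then show ?thesis by (rule E_mono[OF E_scale[OF f(1)]])
    qed simp
    moreover have "(\<lambda>\<mu>. z \<rho> * f \<mu>) \<noteq> 0 \<Longrightarrow> z \<rho> \<noteq> 0" for \<rho> by (auto simp: fun_eq_iff)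
    ultimately have "(\<lambda>\<rho> \<mu>. z \<rho> * f \<mu>) \<in> C s \<tau> n i"
      using z(1) homog_scale[OF f(2)] by (intro C_I) simp_all
    moreover have "Bd (\<lambda>\<rho> \<mu>. z \<rho> * f \<mu>) = 0"
      using z(2) bnd_scale[of V _ z] by (intro ext) (simp add: Bd_def mult.commute[of "z _"])
    ultimately show "(\<lambda>\<rho> \<mu>. z \<rho> * f \<mu>) \<in> C s \<tau> n i \<and> Bd (\<lambda>\<rho> \<mu>. z \<rho> * f \<mu>) = 0" by blast
  next
    fix s i g assume g: "g \<in> C s \<tau> n i" and Bg: "Bd g = 0"
    have g0: "g \<in> C 0 \<tau> n i" using g E_le[of _ s _ 0] by (simp add: C_def)
    have B0: "bnd V (\<lambda>\<rho>. g \<rho> \<mu>) \<rho> = 0" for \<rho> \<mu> using Bg by (simp add: Bd_def fun_eq_iff)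
    \<comment> \<open>The simplex factor is read off at one face where \<open>z\<close> does not
      vanish.\<close>
    define f where "f = (\<lambda>\<mu>. inverse (z \<rho>0) * g \<rho>0 \<mu>)"
    have eq: "g \<rho> \<mu> = z \<rho> * f \<mu>" for \<rho> \<mu>
    proof -
      obtain a where a: "(\<lambda>\<rho>. g \<rho> \<mu>) = (\<lambda>\<rho>. a * z \<rho>)" using zall[of "\<lambda>\<rho>. g \<rho> \<mu>"] C_supp'[OF g] B0 by blast
      then have "g \<rho>0 \<mu> = a * z \<rho>0" "g \<rho> \<mu> = a * z \<rho>" by (auto simp: fun_eq_iff)
      then show ?thesis using \<rho>0 by (simp add: f_def)
    qed
    have "f \<in> E s (star (\<tau> \<union> \<rho>0))" unfolding f_def using C_E[OF g] by (rule E_scale)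
    moreover have "keys \<mu> \<subseteq> \<tau>" if "f \<mu> \<noteq> 0" for \<mu>
    proof (rule ccontr)
      assume "\<not> keys \<mu> \<subseteq> \<tau>"
      then obtain x where "x \<in> keys \<mu>" "x \<notin> \<tau>" by blast
      then obtain \<eta> where \<eta>: "\<And>\<rho>. \<eta> \<rho> \<noteq> 0 \<Longrightarrow> \<rho> \<in> link \<Delta> \<tau> \<and> card \<rho> = Suc n" "\<And>\<rho>. bnd V \<eta> \<rho> = g \<rho> \<mu>"
        using cone_filling[OF g0 Bg] by metis
      have "\<eta> \<rho> = 0" for \<rho> using \<eta>(1) no_face by blast
      then have "g \<rho>0 \<mu> = 0" using \<eta>(2)[of \<rho>0] by (simp add: bnd_def)
      then show False using that by (simp add: f_def)
    qed
    ultimately have "f \<in> E s (Pow \<tau>)" by (auto simp: E_def)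
    moreover have "homog i f" unfolding f_def using C_homog[OF g] by (rule homog_scale)
    moreover have "g = (\<lambda>\<rho> \<mu>. z \<rho> * f \<mu>)" using eq by blast
    ultimately show "\<exists>f\<in>E s (Pow \<tau>). homog i f \<and> g = (\<lambda>\<rho> \<mu>. z \<rho> * f \<mu>)" by blast
  qed (use \<rho>0 in blast)
qed

text \<open>On top cycles the form acts on the simplex factor alone, where it is surjective as long
  as fewer than \<open>card \<tau>\<close> forms have been used.\<close>

lemma lifts_top:
  assumes \<tau>: "\<tau> \<in> \<Delta>" and s: "s < card \<tau>"
  shows "lifts s \<tau> (d - card \<tau>) i"
  unfolding lifts_def
proof (intro ballI impI)
  obtain z where z1: "\<And>s i f. f \<in> E s (Pow \<tau>) \<Longrightarrow> homog i f \<Longrightarrow> (\<lambda>\<rho> \<mu>. z \<rho> * f \<mu>) \<in> C s \<tau> (d - card \<tau>) i \<and> Bd (\<lambda>\<rho> \<mu>. z \<rho> * f \<mu>) = 0"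
    and z2: "\<And>s i g. g \<in> C s \<tau> (d - card \<tau>) i \<Longrightarrow> Bd g = 0 \<Longrightarrow> \<exists>f\<in>E s (Pow \<tau>). homog i f \<and> g = (\<lambda>\<rho> \<mu>. z \<rho> * f \<mu>)"
    by (rule top_cycles[OF \<tau> refl]) blast
  fix w assume "w \<in> C s \<tau> (d - card \<tau>) i" "Bd w = 0"
  then obtain f where f: "f \<in> E s (Pow \<tau>)" "homog i f" "w = (\<lambda>\<rho> \<mu>. z \<rho> * f \<mu>)" using z2 by blast
  have "\<tau> \<subseteq> V" using \<tau> faces_subset by blast
  then obtain f' where f': "f' \<in> E s (Pow \<tau>)" "Th s f' = f"
    using Th_surj_Pow[OF _ nonsing_faces[OF \<tau>] f(1) s] by blast
  define f'' where "f'' = proj (Suc i) f'"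
  have Tf: "Th s f'' = f"
    by (rule ext) (use f'(2) f(2) in \<open>auto simp: f''_def Th_proj homog_def\<close>)
  have "ThC s (\<lambda>\<rho> \<mu>. z \<rho> * f'' \<mu>) = w"
    by (rule ext) (simp add: ThC_def Th_scale Tf f(3))
  then show "\<exists>y\<in>C s \<tau> (d - card \<tau>) (Suc i). Bd y = 0 \<and> ThC s y = w"
    using z1[of f'' s "Suc i"] E_proj[OF f'(1)] by (auto simp: f''_def)
qed

end

section \<open>Dual generators for the stars of all faces\<close>

lemma act_hpoly_0: "hpoly 0 p \<Longrightarrow> act p f = (\<lambda>\<mu>. lookup p 0 * f \<mu>)"
  by (rule ext, subst act_superset[of "{0}"]) (auto simp: hpoly_def mdeg_eq_0_iff)

lemma hpoly_const_poly [simp]: "hpoly 0 (const_poly a)"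
  by (auto simp: hpoly_def const_poly_def)

context coeff_rows
begin

text \<open>The quotient of the face ring of \<open>X\<close> by \<open>d\<close> one-forms is the Poincare duality algebra
  with socle degree \<open>n\<close> and Macaulay dual generator \<open>\<psi>\<close>.\<close>

definition generates :: "nat \<Rightarrow> 'v set set \<Rightarrow> nat \<Rightarrow> (('v \<Rightarrow>\<^sub>0 nat) \<Rightarrow> 'f) \<Rightarrow> bool" where
  "generates d X n \<psi> \<longleftrightarrow> \<psi> \<in> E d X \<and> homog n \<psi> \<and>
     (\<forall>i. \<forall>f\<in>E d X. homog i f \<longrightarrow> (n < i \<longrightarrow> f = 0) \<and> (i \<le> n \<longrightarrow> (\<exists>p. hpoly (n - i) p \<and> f = act p \<psi>)))"

lemma generatesD:
  assumes "generates d X n \<psi>"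
  shows "\<psi> \<in> E d X" "homog n \<psi>" "f \<in> E d X \<Longrightarrow> homog i f \<Longrightarrow> n < i \<Longrightarrow> f = 0"
    "f \<in> E d X \<Longrightarrow> homog i f \<Longrightarrow> i \<le> n \<Longrightarrow> \<exists>p. hpoly (n - i) p \<and> f = act p \<psi>"
  using assms unfolding generates_def by blast+
end

context sphere_rows
begin

definition link_verts :: "'v set \<Rightarrow> 'v set" where
  "link_verts \<tau> = {v. v \<notin> \<tau> \<and> insert v \<tau> \<in> \<Delta>}"

text \<open>The socle degree is that of the link, since the star is a cone over it. The nonvanishing
  on facet monomials is carried along because it allows generators of neighbouring stars to be
  compared through a common facet.\<close>

definition gorenstein_star :: "'v set \<Rightarrow> bool" where
  "gorenstein_star \<tau> \<longleftrightarrow> (\<forall>s<d. regular \<tau> s) \<and>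
     (\<exists>\<psi>. generates d (star \<tau>) (d - card \<tau>) \<psi> \<and> (\<forall>F\<in>\<Delta>. \<tau> \<subseteq> F \<longrightarrow> card F = d \<longrightarrow> \<psi> (ind (F - \<tau>)) \<noteq> 0))"

lemma link_vert_iff: "v \<in> link_verts \<tau> \<longleftrightarrow> {v} \<in> link \<Delta> \<tau>"
  by (auto simp: link_verts_def link_iff)

text \<open>Vanishing reduced homology makes the cycle v - w a boundary. If \<open>w\<close> were
  outside \<open>S\<close>, the edges of the filling that lie inside \<open>S\<close> would have
  boundary \<open>v\<close> alone, whose augmentation is 1 instead of 0.\<close>

lemma link_verts_connected:
  assumes \<tau>: "\<tau> \<in> \<Delta>" and d: "2 \<le> d - card \<tau>"
    and v: "v \<in> link_verts \<tau>" "v \<in> S" and w: "w \<in> link_verts \<tau>"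
    and closed: "\<And>x y. x \<in> S \<Longrightarrow> x \<noteq> y \<Longrightarrow> {x, y} \<in> link \<Delta> \<tau> \<Longrightarrow> y \<in> S"
  shows "w \<in> S"
proof (rule ccontr)
  assume wS: "w \<notin> S"
  then have vw: "v \<noteq> w" using v by blast
  define \<gamma> :: "'v set \<Rightarrow> 'f" where "\<gamma> \<rho> = (if \<rho> = {v} then 1 else if \<rho> = {w} then -1 else 0)" for \<rho>
  have vV: "v \<in> V" "w \<in> V" using v w by (auto simp: link_verts_def face_in_V)
  have "bnd V \<gamma> \<rho> = 0" for \<rho>
  proof (cases "\<rho> = {}")
    case True
    have "bnd V \<gamma> {} = (\<Sum>u\<in>V. (if u = v then 1 else 0) + (if u = w then -1 else 0))"
      unfolding bnd_def by (rule sum.cong) (use vw in \<open>auto simp: \<gamma>_def\<close>)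
    also have "\<dots> = 0" using vV finite_V by (simp add: sum.distrib)
    finally show ?thesis using True by simp
  next
    case False
    then have "\<gamma> (insert u \<rho>) = 0" if "u \<in> V - \<rho>" for u
      using that by (auto simp: \<gamma>_def)
    then show ?thesis by (simp add: bnd_def)
  qed
  moreover have "\<rho> \<in> link \<Delta> \<tau> \<and> card \<rho> = 1" if "\<gamma> \<rho> \<noteq> 0" for \<rho>
    using that v w by (auto simp: \<gamma>_def link_vert_iff split: if_splits)
  ultimately obtain \<eta> :: "'v set \<Rightarrow> 'f" where \<eta>: "\<And>\<rho>. \<eta> \<rho> \<noteq> 0 \<Longrightarrow> \<rho> \<in> link \<Delta> \<tau> \<and> card \<rho> = Suc 1"
    "\<And>\<rho>. bnd V \<eta> \<rho> = \<gamma> \<rho>"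
    using link_exact[OF \<tau>, of 1 \<gamma>] d by auto
  define \<eta>' where "\<eta>' \<rho> = (if \<rho> \<subseteq> S then \<eta> \<rho> else 0)" for \<rho>
  have "bnd V \<eta>' {x} = (if x \<in> S then \<gamma> {x} else 0)" for x
  proof (cases "x \<in> S")
    case True
    have "\<eta>' (insert u {x}) = \<eta> (insert u {x})" if "u \<in> V - {x}" for u
      using closed[OF True, of u] \<eta>(1)[of "{u, x}"] that True by (auto simp: \<eta>'_def insert_commute)
    then have "bnd V \<eta>' {x} = bnd V \<eta> {x}"
      unfolding bnd_def by (intro sum.cong) auto
    then show ?thesis using \<eta>(2) True by simp
  qed (simp add: bnd_def \<eta>'_def)
  then have "bnd V (bnd V \<eta>') {} = (\<Sum>x\<in>V. if x = v then 1 else 0)"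
    unfolding bnd_def[of V "bnd V \<eta>'"]
    by (intro sum.cong) (use wS v vw in \<open>auto simp: \<gamma>_def\<close>)
  also have "\<dots> = 1" using vV finite_V by simp
  finally show False using bnd_bnd[OF finite_V, of "{}" \<eta>'] by simp
qed

text \<open>The link is a 0-sphere. The cycles u - v and u - w would both be nonzero multiples of
  one generator, although only the first is nonzero at \<open>v\<close>.\<close>

lemma link_verts_rank_1:
  assumes \<tau>: "\<tau> \<in> \<Delta>" and d: "d - card \<tau> = 1"
    and "u \<in> link_verts \<tau>" "v \<in> link_verts \<tau>" "w \<in> link_verts \<tau>" "u \<noteq> v" "u \<noteq> w"
  shows "v = w"
proof (rule ccontr)
  assume "v \<noteq> w"
  obtain z :: "'v set \<Rightarrow> 'f" where "\<And>\<rho>. z \<rho> \<noteq> 0 \<Longrightarrow> \<rho> \<in> link \<Delta> \<tau> \<and> card \<rho> = 1" "\<And>\<rho>. bnd V z \<rho> = 0" "z \<noteq> 0"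
    and z: "\<And>\<gamma>. (\<And>\<rho>. \<gamma> \<rho> \<noteq> 0 \<Longrightarrow> \<rho> \<in> link \<Delta> \<tau> \<and> card \<rho> = 1) \<Longrightarrow> (\<And>\<rho>. bnd V \<gamma> \<rho> = 0) \<Longrightarrow> \<exists>a. \<gamma> = (\<lambda>\<rho>. a * z \<rho>)"
    using link_top[OF \<tau>, unfolded d] by blast
  have *: "\<exists>a. (\<lambda>\<rho>. if \<rho> = {x} then 1 else if \<rho> = {y} then -1 else 0 :: 'f) = (\<lambda>\<rho>. a * z \<rho>)" (is "\<exists>a. ?\<gamma> = _")
    if x: "x \<in> link_verts \<tau>" and y: "y \<in> link_verts \<tau>" and xy: "x \<noteq> y" for x y
  proof (rule z)
    have V: "x \<in> V" "y \<in> V" using x y by (auto simp: link_verts_def face_in_V)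
    show "bnd V ?\<gamma> \<rho> = 0" for \<rho>
    proof (cases "\<rho> = {}")
      case True
      have "bnd V ?\<gamma> {} = (\<Sum>u\<in>V. (if u = x then 1 else 0) + (if u = y then -1 else 0))"
        unfolding bnd_def by (rule sum.cong) (use xy in auto)
      also have "\<dots> = 0" using V finite_V by (simp add: sum.distrib)
      finally show ?thesis using True by simp
    next
      case False
      then have "insert u \<rho> \<noteq> {t}" if "u \<notin> \<rho>" for u t using that by blast
      then have "(if insert u \<rho> = {x} then 1 else if insert u \<rho> = {y} then -1 else 0 :: 'f) = 0"
        if "u \<in> V - \<rho>" for u using that by (metis DiffD2)
      then show ?thesis unfolding bnd_def by (intro sum.neutral ballI) (simp only: mult_zero_right)
    qed
  qed (use x y in \<open>auto simp: link_vert_iff split: if_splits\<close>)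
  obtain a where a: "(\<lambda>\<rho>. if \<rho> = {u} then 1 else if \<rho> = {v} then -1 else 0 :: 'f) = (\<lambda>\<rho>. a * z \<rho>)"
    using *[of u v] assms by blast
  obtain b where b: "(\<lambda>\<rho>. if \<rho> = {u} then 1 else if \<rho> = {w} then -1 else 0 :: 'f) = (\<lambda>\<rho>. b * z \<rho>)"
    using *[of u w] assms by blast
  have "a * z {u} = 1" "a * z {v} = -1" using fun_cong[OF a, of "{u}"] fun_cong[OF a, of "{v}"] assms by auto
  moreover have "b * z {u} = 1" "b * z {v} = 0"
    using fun_cong[OF b, of "{u}"] fun_cong[OF b, of "{v}"] assms \<open>v \<noteq> w\<close> by auto
  ultimately have "b \<noteq> 0" "z {v} \<noteq> 0" by auto
  then show False using \<open>b * z {v} = 0\<close> by simp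
qed

section \<open>The induction step, for a face that is not a facet\<close>

context
  fixes \<tau> :: "'v set"
  assumes \<tau>: "\<tau> \<in> \<Delta>" and nonfacet: "card \<tau> < d"
    and IH: "\<And>\<tau>'. \<tau>' \<in> \<Delta> \<Longrightarrow> \<tau> \<subset> \<tau>' \<Longrightarrow> gorenstein_star \<tau>'"
begin

abbreviation "n \<equiv> d - card \<tau>"

lemma IH_regular:
  assumes "\<rho> \<in> link \<Delta> \<tau>" "card \<rho> \<noteq> 0" "s < d"
  shows "regular (\<tau> \<union> \<rho>) s"
proof -
  have "\<rho> \<noteq> {}" using assms(2) by auto
  then have "\<tau> \<subset> \<tau> \<union> \<rho>" using assms(1) by (auto simp: link_iff)
  moreover have "\<tau> \<union> \<rho> \<in> \<Delta>" using assms(1) by (simp add: link_iff Un_commute)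
  ultimately show ?thesis using IH assms(3) unfolding gorenstein_star_def by blast
qed

text \<open>Up to \<open>card \<tau>\<close> forms, homology stays at the top position
  \<open>n\<close>. Descending to position \<open>n - 1\<close> needs lifts of top cycles, supplied
  by the simplex factor; elsewhere exactness and the regularity of larger faces supply the
  lifts.\<close>

lemma exact_low: "s \<le> card \<tau> \<Longrightarrow> j \<noteq> n \<Longrightarrow> exact_at s \<tau> j i"
proof (induction s arbitrary: j i)
  case 0
  then show ?case using exact_at_0 \<tau> by blast
next
  case (Suc s j i)
  show ?case
  proof (rule exact_at_Suc)
    show "exact_at s \<tau> j i" using Suc by simp
    show "lifts s \<tau> (Suc j) i'" for i'
    proof (cases "Suc j = n")
      case True
      then show ?thesis using lifts_top[OF \<tau>, of s i'] Suc.prems(1) by simp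
    next
      case False
      have "exact_at s \<tau> (Suc j) i'" using Suc False by simp
      then show ?thesis
        by (rule exact_lifts) (use IH_regular Suc.prems nonfacet in auto)
    qed
  qed
qed

text \<open>After \<open>card \<tau>\<close> forms only constants remain of the simplex
  factor.\<close>

lemma C_top_0:
  assumes "g \<in> C (card \<tau>) \<tau> n i" "Bd g = 0" "i \<noteq> 0"
  shows "g = 0"
proof -
  obtain z where "\<exists>f\<in>E (card \<tau>) (Pow \<tau>). homog i f \<and> g = (\<lambda>\<rho> \<mu>. z \<rho> * f \<mu>)"
    by (rule top_cycles[OF \<tau> refl]) (use assms(1,2) in blast)
  then obtain f where f: "f \<in> E (card \<tau>) (Pow \<tau>)" "homog i f" "g = (\<lambda>\<rho> \<mu>. z \<rho> * f \<mu>)" by blast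
  have "\<tau> \<subseteq> V" using \<tau> faces_subset by blast
  then have "f \<mu> = 0" for \<mu>
    using E_Pow_eq_0[OF _ nonsing_faces[OF \<tau>] f(1), of \<mu>] f(2) assms(3) by (cases "\<mu> = 0") (auto simp: homog_def)
  then show ?thesis by (intro ext) (simp add: f(3))
qed

text \<open>Each later form adds one position to the homology, along the antidiagonal j + i = n. The
  descent at (j, i) uses the positions (j, i) and (j + 1, i - 1) of the previous stage, and the
  second is exceptional there only if (j, i) is exceptional now.\<close>

lemma exact_high:
  assumes "l \<le> n" "\<not> (j + i = n \<and> i \<le> l)"
  shows "exact_at (card \<tau> + l) \<tau> j i"
  using assms
proof (induction l arbitrary: j i)
  case (0 j i)
  show ?case
  proof (cases "j = n")
    case True
    then have "i \<noteq> 0" using 0 by auto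
    then have "g = 0" if "g \<in> C (card \<tau>) \<tau> j i" "Bd g = 0" for g
      using C_top_0 that True by blast
    then show ?thesis unfolding exact_at_def using C_zero Bd_zero by fastforce
  qed (use exact_low in simp)
next
  case (Suc l j i)
  have "exact_at (Suc (card \<tau> + l)) \<tau> j i"
  proof (rule exact_at_Suc)
    show "exact_at (card \<tau> + l) \<tau> j i" using Suc by auto
    fix i' assume i': "i = Suc i'"
    have "exact_at (card \<tau> + l) \<tau> (Suc j) i'" using Suc i' by auto
    then show "lifts (card \<tau> + l) \<tau> (Suc j) i'"
      by (rule exact_lifts) (use IH_regular Suc.prems nonfacet in auto)
  qed
  then show ?case by simp
qed

text \<open>The one-dimensional top homology of the link moves one step down for each one-form divided out
  after the first \<open>card \<tau>\<close> ones, and ends in \<open>C d \<tau> 0 n\<close>.\<close>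

lemma homology_1:
  assumes "l \<le> n"
  shows "\<exists>z\<in>C (card \<tau> + l) \<tau> (n - l) l. Bd z = 0 \<and>
     (\<forall>u\<in>C (card \<tau> + l) \<tau> (Suc (n - l)) l. Bd u \<noteq> z) \<and>
     (\<forall>z'\<in>C (card \<tau> + l) \<tau> (n - l) l. Bd z' = 0 \<longrightarrow>
        (\<exists>a. \<exists>u\<in>C (card \<tau> + l) \<tau> (Suc (n - l)) l. z' - (\<lambda>\<rho> \<mu>. a * z \<rho> \<mu>) = Bd u))"
  using assms
proof (induction l)
  case 0
  obtain z where z1: "\<And>s i f. f \<in> E s (Pow \<tau>) \<Longrightarrow> homog i f \<Longrightarrow> (\<lambda>\<rho> \<mu>. z \<rho> * f \<mu>) \<in> C s \<tau> n i \<and> Bd (\<lambda>\<rho> \<mu>. z \<rho> * f \<mu>) = 0"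
    and z2: "\<And>s i g. g \<in> C s \<tau> n i \<Longrightarrow> Bd g = 0 \<Longrightarrow> \<exists>f\<in>E s (Pow \<tau>). homog i f \<and> g = (\<lambda>\<rho> \<mu>. z \<rho> * f \<mu>)"
    and z3: "\<exists>\<rho>. z \<rho> \<noteq> 0"
    by (rule top_cycles[OF \<tau> refl]) blast
  obtain \<rho>0 where \<rho>0: "z \<rho>0 \<noteq> 0" using z3 by blast
  define e :: "('v \<Rightarrow>\<^sub>0 nat) \<Rightarrow> 'f" where "e \<mu> = (if \<mu> = 0 then 1 else 0)" for \<mu>
  have he: "homog 0 e" by (auto simp: homog_def e_def)
  have "Th k e = 0" for k by (rule Th_homog_0[OF he])
  then have eE: "e \<in> E (card \<tau>) (Pow \<tau>)" by (intro E_I) (auto simp: e_def split: if_splits)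
  define z' where "z' = (\<lambda>\<rho> \<mu>. z \<rho> * e \<mu>)"
  have zC: "z' \<in> C (card \<tau>) \<tau> n 0" "Bd z' = 0" using z1[OF eE he] by (simp_all add: z'_def)
  have "u = 0" if u: "u \<in> C (card \<tau>) \<tau> (Suc n) 0" for u
  proof
    fix \<rho> show "u \<rho> = 0 \<rho>" using C_supp[OF u, of \<rho>] link_card[of \<rho> \<tau>] by fastforce
  qed
  moreover have "z' \<noteq> 0"
  proof
    assume "z' = 0"
    then have "z' \<rho>0 0 = 0" by simp
    then show False using \<rho>0 by (simp add: z'_def e_def)
  qed
  ultimately have nb: "Bd u \<noteq> z'" if "u \<in> C (card \<tau>) \<tau> (Suc n) 0" for u
    using that Bd_zero by metis
  have "\<exists>a. g - (\<lambda>\<rho> \<mu>. a * z' \<rho> \<mu>) = Bd 0" if g: "g \<in> C (card \<tau>) \<tau> n 0" "Bd g = 0" for g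
  proof -
    obtain f where f: "homog 0 f" "g = (\<lambda>\<rho> \<mu>. z \<rho> * f \<mu>)" using z2[OF g] by blast
    have "f \<mu> = f 0 * e \<mu>" for \<mu> using f(1) mdeg_eq_0_iff[of \<mu>] by (auto simp: homog_def e_def)
    then have "g = (\<lambda>\<rho> \<mu>. f 0 * z' \<rho> \<mu>)"
      unfolding f(2) z'_def by (metis mult.left_commute)
    then have "g - (\<lambda>\<rho> \<mu>. f 0 * z' \<rho> \<mu>) = Bd 0" by (intro ext) simp
    then show ?thesis by blast
  qed
  moreover have "0 \<in> C (card \<tau>) \<tau> (Suc n) 0" by simp
  ultimately have "\<forall>g\<in>C (card \<tau>) \<tau> n 0. Bd g = 0 \<longrightarrow>
        (\<exists>a. \<exists>u\<in>C (card \<tau>) \<tau> (Suc n) 0. g - (\<lambda>\<rho> \<mu>. a * z' \<rho> \<mu>) = Bd u)" by blast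
  then show ?case unfolding add_0_right diff_zero using zC nb by blast
next
  case (Suc l)
  define s where "s = card \<tau> + l"
  define j where "j = n - Suc l"
  have nl: "n - l = Suc j" "Suc l \<le> n" "s < d" using Suc.prems nonfacet by (auto simp: j_def s_def)
  have surj: "\<exists>g'\<in>C s \<tau> (Suc k) (Suc i). ThC s g' = g" if "g \<in> C s \<tau> (Suc k) i" for g k i
    by (rule ThC_surj[OF _ that]) (use IH_regular nl(3) in auto)
  obtain z where z: "z \<in> C s \<tau> (Suc j) l" "Bd z = 0" "\<forall>u\<in>C s \<tau> (Suc (Suc j)) l. Bd u \<noteq> z"
    "\<forall>z'\<in>C s \<tau> (Suc j) l. Bd z' = 0 \<longrightarrow> (\<exists>a. \<exists>u\<in>C s \<tau> (Suc (Suc j)) l. z' - (\<lambda>\<rho> \<mu>. a * z \<rho> \<mu>) = Bd u)"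
    using Suc.IH[OF Suc_leD[OF Suc.prems], folded s_def, unfolded nl(1)] by blast
  \<comment> \<open>The connecting homomorphism: lift \<open>z\<close> along the form
    \<open>s\<close>. The boundary of the lift is killed by that form and is the new class.\<close>
  obtain y where y: "y \<in> C s \<tau> (Suc j) (Suc l)" "ThC s y = z" using surj[OF z(1)] by blast
  have wC: "Bd y \<in> C (Suc s) \<tau> j (Suc l)"
    using Bd_C[OF y(1)] z(2) by (simp add: C_Suc ThC_Bd y(2))
  \<comment> \<open>These positions have j + i equal to n + 1 and to n, the latter with i = l + 1 >
    l, so both avoid the homology. The first keeps the new class from being a boundary, the second
    makes it span.\<close>
  have X1: "exact_at s \<tau> (Suc j) (Suc l)" unfolding s_def by (rule exact_high) (use nl in auto)
  have X2: "exact_at s \<tau> j (Suc l)" unfolding s_def by (rule exact_high) (use nl in auto)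
  have nb: "Bd y' \<noteq> Bd y" if y': "y' \<in> C (Suc s) \<tau> (Suc j) (Suc l)" for y'
  proof
    assume "Bd y' = Bd y"
    then have "Bd (y - y') = 0" by (simp add: Bd_diff)
    moreover have "y - y' \<in> C s \<tau> (Suc j) (Suc l)" using y(1) y' C_diff by (auto simp: C_Suc)
    ultimately obtain u where u: "u \<in> C s \<tau> (Suc (Suc j)) (Suc l)" "Bd u = y - y'"
      using X1 by (auto simp: exact_at_def)
    have "Bd (ThC s u) = ThC s (y - y')" using u(2) by (simp flip: ThC_Bd)
    also have "\<dots> = z" using y(2) y' by (simp add: ThC_diff C_Suc)
    finally show False using z(3) C_ThC[OF u(1)] by blast
  qed
  have span: "\<exists>a. \<exists>u\<in>C (Suc s) \<tau> (Suc j) (Suc l). w' - (\<lambda>\<rho> \<mu>. a * Bd y \<rho> \<mu>) = Bd u"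
    if w': "w' \<in> C (Suc s) \<tau> j (Suc l)" "Bd w' = 0" for w'
  proof -
    obtain y' where y': "y' \<in> C s \<tau> (Suc j) (Suc l)" "Bd y' = w'"
      using X2 w' by (auto simp: exact_at_def C_Suc)
    have "Bd (ThC s y') = 0" using w'(1) y'(2) by (simp add: C_Suc flip: ThC_Bd)
    then obtain a u where u: "u \<in> C s \<tau> (Suc (Suc j)) l" "ThC s y' - (\<lambda>\<rho> \<mu>. a * z \<rho> \<mu>) = Bd u"
      using z(4) C_ThC[OF y'(1)] by blast
    obtain u' where u': "u' \<in> C s \<tau> (Suc (Suc j)) (Suc l)" "ThC s u' = u" using surj[OF u(1)] by blast
    \<comment> \<open>The difference of the two lifts is corrected by the boundary of
      \<open>u'\<close> so that the form \<open>s\<close> kills it; this correction is invisible to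
      \<open>Bd\<close>.\<close>
    define x where "x = y' - (\<lambda>\<rho> \<mu>. a * y \<rho> \<mu>) - Bd u'"
    have "x \<in> C s \<tau> (Suc j) (Suc l)" unfolding x_def
      by (intro C_diff C_scale y' y Bd_C u')
    moreover have "ThC s x = 0"
      by (simp add: x_def ThC_diff ThC_scale y(2) ThC_Bd u'(2) u(2))
    ultimately have "x \<in> C (Suc s) \<tau> (Suc j) (Suc l)" by (simp add: C_Suc)
    moreover have "w' - (\<lambda>\<rho> \<mu>. a * Bd y \<rho> \<mu>) = Bd x"
      by (simp add: x_def Bd_diff Bd_scale y'(2) Bd_Bd[OF u'(1)])
    ultimately show ?thesis by blast
  qed
  have "Bd (Bd y) = 0" by (rule Bd_Bd[OF y(1)])
  then show ?case
    unfolding add_Suc_right s_def[symmetric] j_def[symmetric] using wC nb span by blast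
qed

lemma deg0_C:
  assumes "f \<in> E s (star \<tau>)" "homog i f"
  shows "(\<lambda>\<rho>. if \<rho> = {} then f else 0) \<in> C s \<tau> 0 i" "Bd (\<lambda>\<rho>. if \<rho> = {} then f else 0) = 0"
proof -
  show *: "(\<lambda>\<rho>. if \<rho> = {} then f else 0) \<in> C s \<tau> 0 i"
    by (rule C_I) (use assms \<tau> in \<open>auto simp: link_iff split: if_splits\<close>)
  show "Bd (\<lambda>\<rho>. if \<rho> = {} then f else 0) = 0"
    by (intro ext) (auto simp: Bd_def bnd_def intro!: sum.neutral)
qed

text \<open>A function on the star is a cycle concentrated at the empty face. A filling of it is a
  decomposition into functions on the stars of the larger faces
  \<open>insert v \<tau>\<close>.\<close>

lemma E_decompose:
  assumes X: "exact_at s \<tau> 0 i" and f: "f \<in> E s (star \<tau>)" "homog i f"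
  obtains h where "h \<in> C s \<tau> 1 i" "Bd h {} = f"
proof -
  obtain h where "h \<in> C s \<tau> (Suc 0) i" "Bd h = (\<lambda>\<rho>. if \<rho> = {} then f else 0)"
    using X deg0_C[OF f] unfolding exact_at_def by blast
  then show ?thesis using that[of h] by simp
qed

text \<open>Decompose the function over the larger stars, solve there by the induction hypothesis,
  and add up the solutions.\<close>

lemma regular_step: "s < d \<Longrightarrow> regular \<tau> s"
  unfolding regular_def
proof (intro allI ballI impI)
  fix i f assume s: "s < d" and f: "f \<in> E s (star \<tau>)" "homog i f"
  have "exact_at s \<tau> 0 i"
  proof (cases "s \<le> card \<tau>")
    case True
    then show ?thesis by (rule exact_low) (use nonfacet in simp)
  next
    case False
    \<comment> \<open>Position (0, n) acquires homology only with the last form, and here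
      \<open>s < d\<close>.\<close>
    have "exact_at (card \<tau> + (s - card \<tau>)) \<tau> 0 i" by (rule exact_high) (use False s in auto)
    then show ?thesis using False by simp
  qed
  then obtain h where h: "h \<in> C s \<tau> 1 i" "Bd h {} = f" using f by (rule E_decompose)
  have "\<exists>h'\<in>C s \<tau> 1 (Suc i). ThC s h' = h"
    by (rule ThC_surj[OF _ h(1)]) (use IH_regular s in auto)
  then obtain h' where h': "h' \<in> C s \<tau> 1 (Suc i)" "ThC s h' = h" by blast
  have "h' \<in> C s \<tau> (Suc 0) (Suc i)" using h' by simp
  then have "Bd h' {} \<in> E s (star (\<tau> \<union> {}))" by (rule C_E[OF Bd_C])
  moreover have "Th s (Bd h' {}) = ThC s (Bd h') {}" by (simp add: ThC_def)
  moreover have "\<dots> = f" by (simp only: ThC_Bd h'(2) h(2))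
  ultimately show "\<exists>f'\<in>E s (star \<tau>). Th s f' = f" by auto
qed

lemma IH_generates:
  assumes "v \<in> link_verts \<tau>"
  obtains \<psi> where "generates d (star (insert v \<tau>)) (n - 1) \<psi>"
    "\<And>F. F \<in> \<Delta> \<Longrightarrow> insert v \<tau> \<subseteq> F \<Longrightarrow> card F = d \<Longrightarrow> \<psi> (ind (F - insert v \<tau>)) \<noteq> 0"
proof -
  have v: "v \<notin> \<tau>" "insert v \<tau> \<in> \<Delta>" using assms by (auto simp: link_verts_def)
  then have "gorenstein_star (insert v \<tau>)" using IH by blast
  moreover have "d - card (insert v \<tau>) = n - 1" using v finite_face[OF \<tau>] by simp
  ultimately show ?thesis using that unfolding gorenstein_star_def by metis
qed

lemma C_1_vertex:
  assumes h: "h \<in> C s \<tau> 1 i"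
  shows "Bd h {} = (\<Sum>v\<in>link_verts \<tau>. h {v})" "h {v} \<in> E s (star (insert v \<tau>))"
proof -
  have "Bd h {} = (\<Sum>v\<in>V. h {v})" by (simp add: Bd_sum)
  also have "\<dots> = (\<Sum>v\<in>link_verts \<tau>. h {v})"
  proof (rule sum.mono_neutral_right[OF finite_V])
    show "link_verts \<tau> \<subseteq> V" by (auto simp: link_verts_def face_in_V)
    have "h {v} = 0" if "v \<notin> link_verts \<tau>" for v using C_supp[OF h, of "{v}"] that by (auto simp: link_vert_iff)
    then show "\<forall>v\<in>V - link_verts \<tau>. h {v} = 0" by blast
  qed
  finally show "Bd h {} = (\<Sum>v\<in>link_verts \<tau>. h {v})" .
  show "h {v} \<in> E s (star (insert v \<tau>))" using C_E[OF h, of "{v}"] by simp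
qed

text \<open>The function is a sum of functions on larger stars, whose duals end already in degree
  \<open>n - 1\<close>.\<close>

lemma vanish_above:
  assumes f: "f \<in> E d (star \<tau>)" "homog i f" "n < i"
  shows "f = 0"
proof -
  have "exact_at (card \<tau> + n) \<tau> 0 i" by (rule exact_high) (use f in auto)
  then have X: "exact_at d \<tau> 0 i" using nonfacet by simp
  obtain h where h: "h \<in> C d \<tau> 1 i" "Bd h {} = f" by (rule E_decompose[OF X f(1,2)])
  have "h {v} = 0" if v: "v \<in> link_verts \<tau>" for v
  proof -
    obtain \<psi> where "generates d (star (insert v \<tau>)) (n - 1) \<psi>" using IH_generates[OF v] by blast
    moreover have "n - 1 < i" using f(3) by simp
    ultimately show ?thesis by (rule generatesD(3)[OF _ C_1_vertex(2)[OF h(1)] C_homog[OF h(1)]])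
  qed
  then show ?thesis using C_1_vertex(1)[OF h(1)] h(2) by simp
qed

text \<open>The homology at position 0 in degree \<open>n\<close> is one-dimensional. It is all of
  the dual in that degree: the possible boundaries come from larger stars, whose duals vanish in
  degree \<open>n\<close>.\<close>

lemma top_degree:
  obtains \<psi> where "\<psi> \<in> E d (star \<tau>)" "homog n \<psi>" "\<psi> \<noteq> 0"
    "\<And>f. f \<in> E d (star \<tau>) \<Longrightarrow> homog n f \<Longrightarrow> \<exists>a. f = (\<lambda>\<mu>. a * \<psi> \<mu>)"
proof -
  have dn: "card \<tau> + n = d" using nonfacet by simp
  obtain z where z: "z \<in> C d \<tau> 0 n" "Bd z = 0" "\<forall>u\<in>C d \<tau> (Suc 0) n. Bd u \<noteq> z"
    "\<forall>z'\<in>C d \<tau> 0 n. Bd z' = 0 \<longrightarrow> (\<exists>a. \<exists>u\<in>C d \<tau> (Suc 0) n. z' - (\<lambda>\<rho> \<mu>. a * z \<rho> \<mu>) = Bd u)"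
    using homology_1[of n] unfolding dn diff_self_eq_0 by blast
  have z0: "z \<rho> = 0" if "\<rho> \<noteq> {}" for \<rho> using C_supp[OF z(1), of \<rho>] that finite_link[of \<rho> \<tau>] by auto
  show ?thesis
  proof (rule that[of "z {}"])
    show "z {} \<in> E d (star \<tau>)" using C_E[OF z(1), of "{}"] by simp
    show "homog n (z {})" by (rule C_homog[OF z(1)])
    show "z {} \<noteq> 0"
    proof
      assume "z {} = 0"
      then have "z = 0" using z0 by (intro ext) (metis zero_fun_apply)
      then show False using z(3) C_zero Bd_zero by blast
    qed
    fix f assume f: "f \<in> E d (star \<tau>)" "homog n f"
    obtain a u where u: "u \<in> C d \<tau> (Suc 0) n" "(\<lambda>\<rho>. if \<rho> = {} then f else 0) - (\<lambda>\<rho> \<mu>. a * z \<rho> \<mu>) = Bd u"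
      using z(4) deg0_C[OF f] by blast
    have "u {v} = 0" if v: "v \<in> link_verts \<tau>" for v
    proof -
      obtain \<psi> where "generates d (star (insert v \<tau>)) (n - 1) \<psi>" using IH_generates[OF v] by blast
      moreover have "u {v} \<in> E d (star (insert v \<tau>))" using C_1_vertex(2)[of u d n v] u(1) by simp
      moreover have "n - 1 < n" using nonfacet by simp
      ultimately show ?thesis using generatesD(3)[OF _ _ C_homog[OF u(1)]] by blast
    qed
    then have "Bd u {} = 0" using C_1_vertex(1)[of u] u(1) by simp
    then have "f \<mu> = a * z {} \<mu>" for \<mu> using fun_cong[OF fun_cong[OF u(2), of "{}"], of \<mu>] by simp
    then show "\<exists>a. f = (\<lambda>\<mu>. a * z {} \<mu>)" by blast
  qed
qed

lemma star_vertex: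
  assumes f: "f \<in> E s (star \<tau>)" "f \<mu> \<noteq> 0" "x \<in> keys \<mu>" "x \<notin> \<tau>"
  shows "x \<in> link_verts \<tau>"
proof -
  have "keys \<mu> \<union> \<tau> \<in> \<Delta>" using E_keys[OF f(1,2)] by (simp add: star_iff)
  then have "insert x \<tau> \<in> \<Delta>" by (rule down) (use f in auto)
  then show ?thesis using f by (simp add: link_verts_def)
qed

lemma shift_in_star: "f \<in> E s (star \<tau>) \<Longrightarrow> act (pvar v) f \<in> E s (star (insert v \<tau>))"
  unfolding pvar_def by (rule E_act_link) (auto simp: star_iff)

text \<open>Contracting \<psi> by a vertex \<open>v\<close> of the link gives a multiple
  \<open>lam v\<close> of the generator of the larger star. If all these scalars are nonzero, every
  function decomposed over the larger stars is a contraction of \<psi>; connectedness of the link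
  spreads nonvanishing from one vertex to all.\<close>

lemma gorenstein_step: "gorenstein_star \<tau>"
proof -
  obtain \<psi> where \<psi>: "\<psi> \<in> E d (star \<tau>)" "homog n \<psi>" "\<psi> \<noteq> 0"
    and top: "\<And>f. f \<in> E d (star \<tau>) \<Longrightarrow> homog n f \<Longrightarrow> \<exists>a. f = (\<lambda>\<mu>. a * \<psi> \<mu>)"
    by (rule top_degree) blast
  have n1: "n = Suc (n - 1)" using nonfacet by simp
  have "\<exists>\<psi>'. generates d (star (insert v \<tau>)) (n - 1) \<psi>' \<and>
       (\<forall>F\<in>\<Delta>. insert v \<tau> \<subseteq> F \<longrightarrow> card F = d \<longrightarrow> \<psi>' (ind (F - insert v \<tau>)) \<noteq> 0)"
    if v: "v \<in> link_verts \<tau>" for v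
    by (rule IH_generates[OF v]) blast
  then obtain \<Psi> where gen: "\<And>v. v \<in> link_verts \<tau> \<Longrightarrow> generates d (star (insert v \<tau>)) (n - 1) (\<Psi> v)"
    and facet: "\<And>v F. v \<in> link_verts \<tau> \<Longrightarrow> F \<in> \<Delta> \<Longrightarrow> insert v \<tau> \<subseteq> F \<Longrightarrow> card F = d \<Longrightarrow> \<Psi> v (ind (F - insert v \<tau>)) \<noteq> 0"
    by metis
  have hsh: "homog (n - 1) (act (pvar v) \<psi>)" for v
    by (rule homog_act[of 1]) (use \<psi>(2) n1 in auto)
  have "\<exists>a. act (pvar v) \<psi> = (\<lambda>\<mu>. a * \<Psi> v \<mu>)" if v: "v \<in> link_verts \<tau>" for v
  proof -
    obtain p where "hpoly 0 p" "act (pvar v) \<psi> = act p (\<Psi> v)"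
      using generatesD(4)[OF gen[OF v] shift_in_star[OF \<psi>(1)] hsh] by auto
    then have "act (pvar v) \<psi> = (\<lambda>\<mu>. lookup p 0 * \<Psi> v \<mu>)" using act_hpoly_0 by metis
    then show ?thesis by blast
  qed
  then obtain lam where lam: "\<And>v. v \<in> link_verts \<tau> \<Longrightarrow> act (pvar v) \<psi> = (\<lambda>\<mu>. lam v * \<Psi> v \<mu>)" by metis
  obtain \<mu>0 where \<mu>0: "\<psi> \<mu>0 \<noteq> 0" using \<psi>(3) by (auto simp: fun_eq_iff)
  have deg: "mdeg \<mu>0 = n" using \<psi>(2) \<mu>0 by (simp add: homog_def)
  \<comment> \<open>The next fact keeps too many scalars from vanishing: \<open>d\<close> forms kill
    all nonconstant monomials on a single face, so \<psi>, having positive degree, cannot live on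
    one.\<close>
  have tV: "\<sigma> \<subseteq> V" if "\<sigma> \<in> \<Delta>" for \<sigma> using that faces_subset by blast
  have supp: False if \<sigma>: "\<sigma> \<in> \<Delta>" and sub: "\<And>\<mu>. \<psi> \<mu> \<noteq> 0 \<Longrightarrow> keys \<mu> \<subseteq> \<sigma>" for \<sigma>
  proof -
    have "\<psi> \<in> E d (Pow \<sigma>)" using \<psi>(1) sub by (auto simp: E_def)
    moreover have "\<mu>0 \<noteq> 0" using deg nonfacet by auto
    ultimately show False using E_Pow_eq_0[OF tV[OF \<sigma>] nonsing_faces[OF \<sigma>]] card_le[OF \<sigma>] \<mu>0 by blast
  qed
  have shift0: "\<psi> \<mu> = 0" if "v \<in> link_verts \<tau>" "lam v = 0" "v \<in> keys \<mu>" for v \<mu>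
  proof -
    obtain \<nu> where "\<mu> = \<nu> + evar v" using in_keys_imp_evar_add \<open>v \<in> keys \<mu>\<close> by metis
    then show ?thesis using fun_cong[OF lam[OF that(1)], of \<nu>] that(2) by simp
  qed
  obtain w where w: "w \<in> link_verts \<tau>" "lam w \<noteq> 0"
  proof (rule ccontr)
    assume "\<not> thesis"
    then have all0: "\<And>v. v \<in> link_verts \<tau> \<Longrightarrow> lam v = 0" using that by blast
    have "keys \<mu> \<subseteq> \<tau>" if "\<psi> \<mu> \<noteq> 0" for \<mu>
      using star_vertex[OF \<psi>(1) that] shift0 all0 that by blast
    then show False using supp[OF \<tau>] by blast
  qed
  have lam_nz: "lam v \<noteq> 0" if v: "v \<in> link_verts \<tau>" for v
  proof
    assume v0: "lam v = 0"
    have vw: "v \<noteq> w" using v0 w by blast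
    show False
    proof (cases "n = 1")
      case True
      \<comment> \<open>The link consists of the two points \<open>v\<close> and \<open>w\<close>.
        With \<open>lam v = 0\<close>, all of \<psi> would live on
        \<open>insert w \<tau>\<close>.\<close>
      have iw: "insert w \<tau> \<in> \<Delta>" using w by (simp add: link_verts_def)
      have "keys \<mu> \<subseteq> insert w \<tau>" if m: "\<psi> \<mu> \<noteq> 0" for \<mu>
      proof
        fix x assume x: "x \<in> keys \<mu>"
        show "x \<in> insert w \<tau>"
        proof (rule ccontr)
          assume nx: "x \<notin> insert w \<tau>"
          then have "x \<in> link_verts \<tau>" using star_vertex[OF \<psi>(1) m x] by blast
          then have "x = v" using link_verts_rank_1[OF \<tau> True w(1) _ v] vw nx by blast
          then show False using shift0[OF v v0] x m by blast
        qed
      qed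
      then show False using supp[OF iw] by blast
    next
      case False
      then have n2: "2 \<le> n" using nonfacet by simp
      \<comment> \<open>Zero scalars spread along edges. For an edge {x, y} of the link take a facet
        containing it and \<tau>: if \<open>lam x = 0\<close>, then \<psi> vanishes on the monomial
        of \<open>F - \<tau>\<close>. That value is \<open>lam y\<close> times a nonzero value of
        the generator at \<open>y\<close>, so \<open>lam y = 0\<close>.\<close>
      have "w \<in> {x \<in> link_verts \<tau>. lam x = 0}"
      proof (rule link_verts_connected[OF \<tau> n2 v _ w(1)])
        show "v \<in> {x \<in> link_verts \<tau>. lam x = 0}" using v v0 by blast
        fix x y assume x: "x \<in> {x \<in> link_verts \<tau>. lam x = 0}" and xy: "x \<noteq> y" "{x, y} \<in> link \<Delta> \<tau>"
        then have yl: "y \<in> link_verts \<tau>" using link_down[of "{x, y}" \<tau> "{y}"] by (simp add: link_vert_iff)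
        have nt: "x \<notin> \<tau>" "y \<notin> \<tau>" "insert x (insert y \<tau>) \<in> \<Delta>" using xy by (auto simp: link_iff)
        obtain F where F: "F \<in> \<Delta>" "insert x (insert y \<tau>) \<subseteq> F" "card F = d" using facet_ext[OF nt(3)] by blast
        have fF: "finite F" using finite_face F by blast
        define \<nu> where "\<nu> = ind (F - insert x (insert y \<tau>))"
        have eq: "F - insert y \<tau> = insert x (F - insert x (insert y \<tau>))" using F(2) xy nt by auto
        have ind: "ind (F - insert y \<tau>) = \<nu> + evar x"
          unfolding \<nu>_def eq by (rule ind_insert) (use fF in auto)
        have "\<Psi> y (\<nu> + evar x) \<noteq> 0" using facet[OF yl F(1) _ F(3)] F(2) ind by simp
        moreover have "lam y * \<Psi> y (\<nu> + evar x) = \<psi> (\<nu> + evar x + evar y)"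
          using fun_cong[OF lam[OF yl], of "\<nu> + evar x"] by simp
        moreover have "\<psi> (\<nu> + evar x + evar y) = 0"
          using shift0[of x] x by (simp add: keys_add_nat)
        ultimately show "y \<in> {x \<in> link_verts \<tau>. lam x = 0}" using yl by simp
      qed
      then show False using w by blast
    qed
  qed
  have "generates d (star \<tau>) n \<psi>"
    unfolding generates_def
  proof (intro conjI allI ballI impI)
    fix i f assume f: "f \<in> E d (star \<tau>)" "homog i f"
    show "f = 0" if "n < i" using vanish_above f that by blast
    show "\<exists>p. hpoly (n - i) p \<and> f = act p \<psi>" if i: "i \<le> n"
    proof (cases "i = n")
      case True
      then obtain a where "f = (\<lambda>\<mu>. a * \<psi> \<mu>)" using top f by blast
      then show ?thesis using True by (intro exI[of _ "const_poly a"]) simp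
    next
      case False
      have "exact_at (card \<tau> + n) \<tau> 0 i" by (rule exact_high) (use False in auto)
      then have X: "exact_at d \<tau> 0 i" using nonfacet by simp
      obtain h where h: "h \<in> C d \<tau> 1 i" "Bd h {} = f" by (rule E_decompose[OF X f])
      have "\<exists>p. hpoly (n - 1 - i) p \<and> h {v} = act p (\<Psi> v)" if v: "v \<in> link_verts \<tau>" for v
        using generatesD(4)[OF gen[OF v] C_1_vertex(2)[OF h(1)] C_homog[OF h(1)]] False i by auto
      then obtain p where p: "\<And>v. v \<in> link_verts \<tau> \<Longrightarrow> hpoly (n - 1 - i) (p v)" "\<And>v. v \<in> link_verts \<tau> \<Longrightarrow> h {v} = act (p v) (\<Psi> v)"
        by metis
      \<comment> \<open>Contracting \<psi> by the variable \<open>v\<close> gives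
        \<open>lam v\<close> times \<open>\<Psi> v\<close>, so dividing by \<open>lam v\<close>
        turns contractions of \<open>\<Psi> v\<close> into contractions of \<psi>.\<close>
      define q where "q v = const_poly (inverse (lam v)) * (p v * pvar v)" for v
      have "act (q v) \<psi> = h {v}" if v: "v \<in> link_verts \<tau>" for v
        unfolding q_def act_mult lam[OF v] act_scale_right using lam_nz[OF v] p(2)[OF v] by (simp add: mult.assoc[symmetric])
      then have "f = act (\<Sum>v\<in>link_verts \<tau>. q v) \<psi>"
        using C_1_vertex(1)[OF h(1)] h(2) by (simp add: act_sum_left)
      moreover have "hpoly (n - i) (\<Sum>v\<in>link_verts \<tau>. q v)"
      proof (rule hpoly_sum)
        fix v assume "v \<in> link_verts \<tau>"
        then have "hpoly (n - 1 - i + 1) (p v * pvar v)" using p(1) by (intro hpoly_mult) auto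
        moreover have "n - 1 - i + 1 = n - i" using False i by simp
        ultimately show "hpoly (n - i) (q v)" unfolding q_def using hpoly_const_mult by metis
      qed
      ultimately show ?thesis by blast
    qed
  qed (use \<psi> in auto)
  moreover have "\<psi> (ind (F - \<tau>)) \<noteq> 0" if F: "F \<in> \<Delta>" "\<tau> \<subseteq> F" "card F = d" for F
  proof -
    have "F \<noteq> \<tau>" using F nonfacet by blast
    then obtain v where v: "v \<in> F" "v \<notin> \<tau>" using F(2) by blast
    have "insert v \<tau> \<in> \<Delta>" by (rule down[OF F(1)]) (use v F in auto)
    then have vl: "v \<in> link_verts \<tau>" using v by (simp add: link_verts_def)
    have eq: "F - \<tau> = insert v (F - insert v \<tau>)" using v by blast
    have "ind (F - \<tau>) = ind (F - insert v \<tau>) + evar v"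
      unfolding eq by (rule ind_insert) (use finite_face[OF F(1)] in auto)
    then have "\<psi> (ind (F - \<tau>)) = lam v * \<Psi> v (ind (F - insert v \<tau>))"
      using fun_cong[OF lam[OF vl], of "ind (F - insert v \<tau>)"] by simp
    then show ?thesis using lam_nz[OF vl] facet[OF vl F(1) _ F(3)] v F by simp
  qed
  ultimately show ?thesis unfolding gorenstein_star_def using regular_step by blast
qed

end

text \<open>The star of a facet is a simplex, and \<open>d\<close> independent forms reduce its ring
  to the field; the dual generator is the function that is 1 at the constant monomial.\<close>

lemma gorenstein_facet:
  assumes \<tau>: "\<tau> \<in> \<Delta>" "card \<tau> = d"
  shows "gorenstein_star \<tau>"
proof -
  have star: "star \<tau> = Pow \<tau>"
  proof (intro equalityI subsetI)
    fix \<eta> assume "\<eta> \<in> star \<tau>"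
    then have u: "\<eta> \<union> \<tau> \<in> \<Delta>" by (simp add: star_iff)
    then have "\<tau> = \<eta> \<union> \<tau>" using card_le[OF u] \<tau>(2) by (intro card_seteq finite_face) auto
    then show "\<eta> \<in> Pow \<tau>" by blast
  next
    fix \<eta> assume "\<eta> \<in> Pow \<tau>"
    then have "\<eta> \<union> \<tau> = \<tau>" by blast
    then show "\<eta> \<in> star \<tau>" using \<tau> by (simp add: star_iff)
  qed
  have tV: "\<tau> \<subseteq> V" using \<tau> faces_subset by blast
  have "regular \<tau> s" if "s < d" for s
    unfolding regular_def star using Th_surj_Pow[OF tV nonsing_faces[OF \<tau>(1)]] that \<tau>(2) by blast
  moreover define e :: "('v \<Rightarrow>\<^sub>0 nat) \<Rightarrow> 'f" where "e \<mu> = (if \<mu> = 0 then 1 else 0)" for \<mu>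
  have he: "homog 0 e" by (auto simp: homog_def e_def)
  have "Th k e = 0" for k by (rule Th_homog_0[OF he])
  then have eE: "e \<in> E d (Pow \<tau>)" by (intro E_I) (auto simp: e_def split: if_splits)
  have z: "f \<mu> = 0" if "f \<in> E d (Pow \<tau>)" "\<mu> \<noteq> 0" for f \<mu>
    using E_Pow_eq_0[OF tV nonsing_faces[OF \<tau>(1)]] that \<tau>(2) by blast
  have "generates d (star \<tau>) 0 e"
    unfolding generates_def star
  proof (intro conjI allI ballI impI eE he)
    fix i f assume f: "f \<in> E d (Pow \<tau>)" "homog i f"
    show "f = 0" if "0 < i"
      using z[OF f(1)] f(2) that by (intro ext) (metis homog_def mdeg_zero not_less0 zero_fun_apply)
    show "\<exists>p. hpoly (0 - i) p \<and> f = act p e" if "i \<le> 0"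
    proof -
      have "f = act (const_poly (f 0)) e"
        unfolding act_const_poly by (rule ext) (use z[OF f(1)] in \<open>simp add: e_def\<close>)
      then show ?thesis by (intro exI[of _ "const_poly (f 0)"]) simp
    qed
  qed
  moreover have "e (ind (F - \<tau>)) \<noteq> 0" if F: "F \<in> \<Delta>" "\<tau> \<subseteq> F" "card F = d" for F
  proof -
    have "F = \<tau>" using F \<tau> finite_face by (metis card_subset_eq)
    then show ?thesis by (simp add: e_def)
  qed
  ultimately show ?thesis unfolding gorenstein_star_def using \<tau>(2) by auto
qed

theorem gorenstein_all: "\<tau> \<in> \<Delta> \<Longrightarrow> gorenstein_star \<tau>"
proof (induction "d - card \<tau>" arbitrary: \<tau> rule: less_induct)
  case (less \<tau>)
  show ?case
  proof (cases "card \<tau> = d")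
    case False
    then have lt: "card \<tau> < d" using card_le[OF less.prems] by simp
    show ?thesis
    proof (rule gorenstein_step[OF less.prems lt])
      fix \<tau>' assume \<tau>': "\<tau>' \<in> \<Delta>" "\<tau> \<subset> \<tau>'"
      have "card \<tau> < card \<tau>'" using \<tau>' finite_face psubset_card_mono by blast
      then show "gorenstein_star \<tau>'" using less.hyps[of \<tau>'] \<tau>' lt by simp
    qed
  qed (use gorenstein_facet less.prems in blast)
qed

corollary fundamental_dual:
  obtains \<psi> where "generates d \<Delta> d \<psi>" "\<And>F. F \<in> \<Delta> \<Longrightarrow> card F = d \<Longrightarrow> \<psi> (ind F) \<noteq> 0"
  using gorenstein_all[OF empty_face] unfolding gorenstein_star_def star_empty by auto

text \<open>The links of the faces \<open>A \<union> \<rho>\<close> for \<open>\<rho>\<close> in the boundary of \<open>B\<close> are connected, so none of them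
  can have a vertex outside \<open>B\<close>.\<close>

lemma face_containing_A:
  assumes A: "A \<noteq> {}" "A \<inter> B = {}" "finite B" "card A + card B = d + 1"
    and AB: "\<And>\<rho>. \<rho> \<subset> B \<Longrightarrow> A \<union> \<rho> \<in> \<Delta>" and B: "A \<union> B \<notin> \<Delta>"
    and \<sigma>: "\<sigma> \<in> \<Delta>" "A \<subseteq> \<sigma>"
  shows "\<sigma> \<subseteq> A \<union> B"
proof -
  have fA: "finite A" using finite_face \<sigma> finite_subset by blast
  have main: "u \<in> A \<union> B" if "\<rho> \<subset> B" "insert u (A \<union> \<rho>) \<in> \<Delta>" for \<rho> u
    using that
  proof (induction "card B - card \<rho>" arbitrary: \<rho> u rule: less_induct)
    case (less \<rho> u)
    define \<tau> where "\<tau> = A \<union> \<rho>"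
    have \<tau>: "\<tau> \<in> \<Delta>" using AB less.prems by (simp add: \<tau>_def)
    have f\<rho>: "finite \<rho>" using less.prems A finite_subset by blast
    have c\<tau>: "card \<tau> = card A + card \<rho>" unfolding \<tau>_def using fA f\<rho> A less.prems by (intro card_Un_disjoint) auto
    have c\<rho>: "card \<rho> < card B" using less.prems A psubset_card_mono by blast
    have verts: "x \<in> link_verts \<tau>" if x: "x \<in> B" "x \<notin> \<rho>" and nB: "insert x \<rho> \<noteq> B" for x
    proof -
      have "A \<union> insert x \<rho> \<in> \<Delta>" by (rule AB) (use x nB less.prems in auto)
      then show ?thesis using x A by (auto simp: link_verts_def \<tau>_def)
    qed
    show ?case
    proof (rule ccontr)
      assume u: "u \<notin> A \<union> B"
      then have u\<tau>: "u \<notin> \<tau>" using less.prems by (auto simp: \<tau>_def)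
      have ul: "u \<in> link_verts \<tau>" using u\<tau> less.prems by (simp add: link_verts_def \<tau>_def)
      have "card (insert u \<tau>) \<le> d" using card_le less.prems by (simp add: \<tau>_def)
      then have "card \<tau> < d" using u\<tau> finite_face[OF \<tau>] by simp
      \<comment> \<open>With \<open>u\<close> present,
        \<open>card A + card \<rho> < d = card A + card B - 1\<close>, so at least two elements of
        \<open>B\<close> are missing from \<open>\<rho>\<close>.\<close>
      then have rB: "card \<rho> + 2 \<le> card B" using c\<tau> A c\<rho> by simp
      have nB: "insert x \<rho> \<noteq> B" for x
      proof
        assume "insert x \<rho> = B"
        then have "card B \<le> Suc (card \<rho>)" using f\<rho> by (auto simp: card_insert_if)
        then show False using rB by simp
      qed
      obtain x where x: "x \<in> B" "x \<notin> \<rho>" using less.prems by blast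
      show False
      proof (cases "card \<rho> + 2 = card B")
        case True
        \<comment> \<open>The link is a 0-sphere and already has the vertices \<open>x\<close> and
          \<open>y\<close> of \<open>B\<close>; there is no room for \<open>u\<close>.\<close>
        then have d1: "d - card \<tau> = 1" using c\<tau> A by simp
        obtain y where y: "y \<in> B" "y \<notin> \<rho>" "y \<noteq> x" using nB[of x] x less.prems by blast
        show False using link_verts_rank_1[OF \<tau> d1 ul verts[OF x nB] verts[OF y(1,2) nB]] u x y by blast
      next
        case False
        then have d2: "2 \<le> d - card \<tau>" using c\<tau> A rB by simp
        have "u \<in> B"
        \<comment> \<open>\<open>B\<close> is closed under adjacency in this link: for a neighbour
          \<open>y\<close> of \<open>x\<close> in \<open>B\<close>, the induction hypothesis for
          \<open>insert x \<rho>\<close> puts \<open>y\<close> into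
          \<open>A \<union> B\<close>.\<close>
        proof (rule link_verts_connected[OF \<tau> d2 verts[OF x nB] x(1) ul])
          fix x y assume xy: "x \<in> B" "x \<noteq> y" "{x, y} \<in> link \<Delta> \<tau>"
          then have nt: "x \<notin> \<tau>" "y \<notin> \<tau>" "insert y (insert x \<tau>) \<in> \<Delta>" by (auto simp: link_iff insert_commute)
          have eq: "insert y (A \<union> insert x \<rho>) = insert y (insert x \<tau>)" by (auto simp: \<tau>_def)
          have "x \<notin> \<rho>" using nt by (auto simp: \<tau>_def)
          then have "card (insert x \<rho>) = Suc (card \<rho>)" using f\<rho> by simp
          then have "card B - card (insert x \<rho>) < card B - card \<rho>" using c\<rho> by simp
          moreover have "insert x \<rho> \<subset> B" using nB xy less.prems by blast
          ultimately have "y \<in> A \<union> B" using less.hyps[of "insert x \<rho>" y] nt(3) eq by simp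
          then show "y \<in> B" using nt by (auto simp: \<tau>_def)
        qed
        then show False using u by blast
      qed
    qed
  qed
  show ?thesis
  proof
    fix u assume u: "u \<in> \<sigma>"
    show "u \<in> A \<union> B"
    proof (cases "B = {}")
      case True
      then show ?thesis using B down[OF \<sigma>] by auto
    next
      case False
      have "insert u (A \<union> {}) \<in> \<Delta>" by (rule down[OF \<sigma>(1)]) (use u \<sigma> in auto)
      then show ?thesis using main[of "{}" u] False by blast
    qed
  qed
qed

end

section \<open>Bistellar moves\<close>

text \<open>Evaluation at a point is a common eigenvector of all contractions, with the values of
  the polynomials as eigenvalues. This also yields the multiplicativity of
  \<open>poly_value\<close>.\<close>

lemma act_msub: "act p (msub k) = (\<lambda>\<mu>. poly_value p k * msub k \<mu>)"
  by (rule ext) (simp add: act_def poly_value_msub msub_add sum_distrib_left sum_distrib_right ac_simps)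

lemma poly_value_act: "poly_value p k = act p (msub k) 0"
  by (simp add: act_msub)

lemma poly_value_mult: "poly_value (p * q) k = poly_value p k * poly_value q k"
  unfolding poly_value_act act_mult by (simp only: act_msub act_scale_right) simp

lemma poly_value_diff: "poly_value (p - q) k = poly_value p k - poly_value q k"
  by (simp add: poly_value_act act_diff_left)

lemma poly_value_single [simp]: "poly_value (Poly_Mapping.single \<mu> a) k = a * msub k \<mu>"
  by (simp add: poly_value_act)

lemma poly_value_const [simp]: "poly_value (const_poly a) k = a"
  by (simp add: const_poly_def)

lemma poly_value_pvar [simp]: "poly_value (pvar x) k = k x"
  by (simp add: pvar_def)

lemma poly_value_sum: "poly_value (\<Sum>i\<in>I. p i) k = (\<Sum>i\<in>I. poly_value (p i) k)"
  by (simp add: poly_value_act act_sum_left sum_fun_apply)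

lemma poly_value_prod: "poly_value (\<Prod>i\<in>I. p i) k = (\<Prod>i\<in>I. poly_value (p i) k)"
proof (induction I rule: infinite_finite_induct)
  case (insert x F)
  then show ?case by (simp add: poly_value_mult)
qed (simp_all add: poly_value_act)

lemma poly_value_linear_form: "poly_value (linear_form V a) k = (\<Sum>v\<in>V. a v * k v)"
  by (simp add: linear_form_def poly_value_sum poly_value_mult)

text \<open>Evaluation of forms of degree \<open>i\<close> at the point \<open>k\<close>, as a
  function on monomials.\<close>

definition point_dual :: "('x \<Rightarrow> 'f::field) \<Rightarrow> nat \<Rightarrow> ('x \<Rightarrow>\<^sub>0 nat) \<Rightarrow> 'f" where
  "point_dual k i = proj i (msub k)"

lemma point_dual_apply: "point_dual k i \<mu> = (if mdeg \<mu> = i then msub k \<mu> else 0)"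
  by (simp add: point_dual_def proj_def)

lemma homog_point_dual [simp]: "homog i (point_dual k i)"
  by (simp add: point_dual_def)

lemma act_point_dual:
  assumes "hpoly j p" "j \<le> i"
  shows "act p (point_dual k i) = (\<lambda>\<mu>. poly_value p k * point_dual k (i - j) \<mu>)"
proof
  fix \<mu>
  have "act p (point_dual k i) \<mu> = (\<Sum>\<nu>\<in>keys p. if mdeg \<mu> = i - j then lookup p \<nu> * (msub k \<mu> * msub k \<nu>) else 0)"
    unfolding act_def
    by (rule sum.cong) (use assms in \<open>auto simp: point_dual_apply hpoly_def msub_add\<close>)
  also have "\<dots> = poly_value p k * point_dual k (i - j) \<mu>"
    by (simp add: point_dual_apply poly_value_msub sum_distrib_left sum_distrib_right ac_simps)
  finally show "act p (point_dual k i) \<mu> = poly_value p k * point_dual k (i - j) \<mu>" .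
qed

section \<open>The middle condition under a change of the dual generator\<close>

lemma point_dual_nonzero: "k u \<noteq> 0 \<Longrightarrow> point_dual k i (Poly_Mapping.single u i) \<noteq> 0"
  by (auto simp: point_dual_apply msub_eq_0_iff)

text \<open>Injectivity of multiplication by \<omega> from degree \<open>m\<close>, modulo the
  annihilator of \<psi>. All variables are allowed in \<open>p\<close>, so both complexes are tested
  on the same polynomials.\<close>

definition mid_injective :: "('x, 'f::field) mpoly \<Rightarrow> nat \<Rightarrow> (('x \<Rightarrow>\<^sub>0 nat) \<Rightarrow> 'f) \<Rightarrow> bool" where
  "mid_injective \<omega> m \<psi> \<longleftrightarrow> (\<forall>p. hpoly m p \<longrightarrow> act (\<omega> * p) \<psi> = 0 \<longrightarrow> act p \<psi> = 0)"

text \<open>If \<omega> p kills \<psi>', then \<omega> p \<psi> is a multiple of an evaluation.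
  Applying x_S, which kills \<psi> but not the evaluation, shows that the multiple is 0; then p acts
  alike on both generators. Conversely, a multiple of x_S can be subtracted from p so that p
  vanishes at k without changing p \<psi>. Both directions require x_S to fit into degree m.\<close>

lemma mid_injective_point_dual:
  assumes d: "d = 2 * m + 1" and \<omega>: "hpoly 1 \<omega>" "poly_value \<omega> k \<noteq> 0"
    and S: "finite S" "card S \<le> m" "\<And>s. s \<in> S \<Longrightarrow> k s \<noteq> 0" and u: "k u \<noteq> 0"
    and \<psi>S: "act (Poly_Mapping.single (ind S) 1) \<psi> = 0"
    and \<psi>': "\<psi>' = \<psi> - (\<lambda>\<mu>. a * point_dual k d \<mu>)"
  shows "mid_injective \<omega> m \<psi> \<longleftrightarrow> mid_injective \<omega> m \<psi>'"
proof -
  have kS: "msub k (ind S) \<noteq> 0" using S by (auto simp: msub_eq_0_iff keys_ind)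
  have act': "act p \<psi>' = act p \<psi> - (\<lambda>\<mu>. a * (poly_value p k * point_dual k (d - j) \<mu>))"
    if "hpoly j p" "j \<le> d" for p j
    unfolding \<psi>' act_diff_right act_scale_right by (simp only: act_point_dual[OF that])
  have h\<omega>: "hpoly (Suc m) (\<omega> * p)" if "hpoly m p" for p
    using hpoly_mult[OF \<omega>(1) that] by simp
  have act\<omega>: "act (\<omega> * p) \<psi>' = act (\<omega> * p) \<psi> - (\<lambda>\<mu>. a * (poly_value \<omega> k * poly_value p k * point_dual k m \<mu>))"
    if "hpoly m p" for p
    using act'[OF h\<omega>[OF that]] d by (simp add: poly_value_mult)
  have actp: "act p \<psi>' = act p \<psi> - (\<lambda>\<mu>. a * (poly_value p k * point_dual k (Suc m) \<mu>))" if "hpoly m p" for p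
    using act'[OF that] d by simp
  show ?thesis
    unfolding mid_injective_def
  proof (intro iffI allI impI)
    fix p assume mid: "\<forall>p. hpoly m p \<longrightarrow> act (\<omega> * p) \<psi> = 0 \<longrightarrow> act p \<psi> = 0"
      and p: "hpoly m p" "act (\<omega> * p) \<psi>' = 0"
    let ?D = "Poly_Mapping.single (ind S) (1::'b)"
    have hD: "hpoly (card S) ?D" using hpoly_single[of "ind S" "1::'b"] S by (simp only: mdeg_ind)
    define b where "b = a * (poly_value \<omega> k * poly_value p k)"
    have eq: "act (\<omega> * p) \<psi> = (\<lambda>\<mu>. b * point_dual k m \<mu>)"
      using act\<omega>[OF p(1)] p(2) by (simp add: fun_eq_iff b_def mult.assoc)
    have "act ?D (act (\<omega> * p) \<psi>) = 0" by (subst act_commute) (simp only: \<psi>S act_zero_right)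
    then have "(\<lambda>\<mu>. b * (msub k (ind S) * point_dual k (m - card S) \<mu>)) = 0"
      unfolding eq act_scale_right act_point_dual[OF hD S(2)] by simp
    then have "b * (msub k (ind S) * point_dual k (m - card S) (Poly_Mapping.single u (m - card S))) = 0"
      by (rule fun_cong[of _ _ "Poly_Mapping.single u (m - card S)", THEN trans]) simp
    then have b0: "b = 0" using kS point_dual_nonzero[of k u, OF u] by simp
    then have "act (\<omega> * p) \<psi> = 0" using eq by (simp add: fun_eq_iff)
    then have "act p \<psi> = 0" using mid p by blast
    moreover have "a * poly_value p k = 0" using b0 \<omega>(2) by (simp add: b_def)
    then have "a * (poly_value p k * point_dual k (Suc m) \<mu>) = 0" for \<mu> by (simp only: mult.assoc[symmetric] mult_zero_left)
    ultimately show "act p \<psi>' = 0" unfolding actp[OF p(1)] by (simp add: fun_eq_iff)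
  next
    fix p assume mid: "\<forall>p. hpoly m p \<longrightarrow> act (\<omega> * p) \<psi>' = 0 \<longrightarrow> act p \<psi>' = 0"
      and p: "hpoly m p" "act (\<omega> * p) \<psi> = 0"
    \<comment> \<open>x_S filled up to degree \<open>m\<close> by a power of a variable that is
      nonzero at \<open>k\<close>.\<close>
    define \<nu> where "\<nu> = Poly_Mapping.single u (m - card S) + ind S"
    define q where "q = Poly_Mapping.single \<nu> (1::'b)"
    have qk: "poly_value q k \<noteq> 0" using kS u by (simp add: q_def \<nu>_def msub_add msub_eq_0_iff) 
    have hq: "hpoly m q" using hpoly_single[of \<nu> "1::'b"] S by (simp add: \<nu>_def q_def mdeg_ind)
    have q\<psi>: "act q \<psi> = 0"
    proof -
      have "q = Poly_Mapping.single (Poly_Mapping.single u (m - card S)) 1 * Poly_Mapping.single (ind S) 1"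
        by (simp add: q_def \<nu>_def mult_single)
      then show ?thesis by (simp only: act_mult \<psi>S act_zero_right)
    qed
    define r where "r = p - const_poly (poly_value p k / poly_value q k) * q"
    have hr: "hpoly m r" unfolding r_def by (intro hpoly_diff p hpoly_const_mult hq)
    have rk: "poly_value r k = 0" using qk by (simp add: r_def poly_value_diff poly_value_mult)
    have r\<psi>: "act r \<psi> = act p \<psi>"
      unfolding r_def act_diff_left act_mult q\<psi> act_zero_right by simp
    have "act (\<omega> * r) \<psi> = 0" using p(2) by (simp only: act_mult r\<psi>)
    then have "act (\<omega> * r) \<psi>' = 0" unfolding act\<omega>[OF hr] rk by (simp add: fun_eq_iff)
    then have "act r \<psi>' = 0" using mid hr by blast
    then show "act p \<psi> = 0" unfolding actp[OF hr] rk r\<psi> by (simp add: fun_eq_iff)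
  qed
qed

section \<open>Duality across a bistellar move\<close>

context coeff_rows
begin

text \<open>\<open>k\<close> is the last column of the inverse of the matrix \<open>c\<close> on the columns \<open>U\<close>; its entries are
  maximal minors, hence nonzero.\<close>

lemma nonsing_kernel:
  assumes U: "U \<subseteq> V" "card U = Suc d" "nonsing U" and sub: "\<And>u. u \<in> U \<Longrightarrow> nonsing (U - {u})"
  obtains k :: "'v \<Rightarrow> 'f" where "\<And>u. u \<in> U \<Longrightarrow> k u \<noteq> 0" "\<And>u. u \<notin> U \<Longrightarrow> k u = 0"
    "\<And>j. j \<le> d \<Longrightarrow> (\<Sum>v\<in>V. c (j, v) * k v) = (if j = d then 1 else 0)"
    "\<And>f u \<mu>. f \<in> E d (Pow U) \<Longrightarrow> f (\<mu> + evar u) = k u * Th d f \<mu>"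
proof -
  have fin: "finite U" using U finite_V finite_subset by blast
  obtain G :: "'v \<Rightarrow> nat \<Rightarrow> 'f" where G:
    "\<forall>u\<in>U. \<forall>v\<in>U. (\<Sum>k<card U. G u k * c (k, v)) = (if u = v then 1 else 0)"
    "\<forall>k<card U. \<forall>l<card U. (\<Sum>v\<in>U. c (k, v) * G v l) = (if k = l then 1 else 0)"
    using U(3) unfolding nonsing_def by blast
  define k where "k u = (if u \<in> U then G u d else 0)" for u
  have sumU: "(\<Sum>v\<in>V. c (j, v) * k v) = (\<Sum>v\<in>U. c (j, v) * k v)" for j
    by (rule sum.mono_neutral_right) (use finite_V U in \<open>auto simp: k_def\<close>)
  have row: "(\<Sum>v\<in>V. c (j, v) * k v) = (if j = d then 1 else 0)" if "j \<le> d" for j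
  proof -
    have "(\<Sum>v\<in>U. c (j, v) * k v) = (\<Sum>v\<in>U. c (j, v) * G v d)" by (rule sum.cong) (auto simp: k_def)
    then show ?thesis unfolding sumU using G(2) U(2) that by simp
  qed
  show ?thesis
  proof (rule that[of k])
    show "f (\<mu> + evar u) = k u * Th d f \<mu>" if f: "f \<in> E d (Pow U)" for f u \<mu>
    proof (cases "u \<in> U")
      case True
      have "f (\<mu> + evar u) = (\<Sum>j<card U. G u j * Th j f \<mu>)"
        by (rule nonsing_shift[OF U(1) _ f True]) (use G(1) in blast)
      also have "\<dots> = (\<Sum>j<d. G u j * Th j f \<mu>) + G u d * Th d f \<mu>" by (simp add: U(2))
      also have "(\<Sum>j<d. G u j * Th j f \<mu>) = 0" by (rule sum.neutral) (use E_Th[OF f] in auto)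
      finally show ?thesis using True by (simp add: k_def)
    next
      case False
      have "f (\<mu> + evar u) = 0" by (rule E_keys'[OF f]) (use False in \<open>auto simp: keys_add_nat\<close>)
      then show ?thesis using False by (simp add: k_def)
    qed
    show "k u \<noteq> 0" if u: "u \<in> U" for u
    proof
      assume k0: "k u = 0"
      have cU: "card (U - {u}) = d" using U(2) u fin by simp
      obtain H :: "'v \<Rightarrow> nat \<Rightarrow> 'f" where H:
        "\<forall>x\<in>U - {u}. \<forall>v\<in>U - {u}. (\<Sum>j<d. H x j * c (j, v)) = (if x = v then 1 else 0)"
        using sub[OF u] unfolding nonsing_def cU by blast
      have zero: "k x = 0" if x: "x \<in> U - {u}" for x
      proof -
        have "k x = (\<Sum>v\<in>U - {u}. if x = v then k v else 0)" using x fin by simp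
        also have "\<dots> = (\<Sum>v\<in>U - {u}. \<Sum>j<d. H x j * c (j, v) * k v)"
          by (rule sum.cong) (use H x in \<open>auto simp flip: sum_distrib_right\<close>)
        also have "\<dots> = (\<Sum>j<d. H x j * (\<Sum>v\<in>U - {u}. c (j, v) * k v))"
          by (subst sum.swap) (simp add: sum_distrib_left mult.assoc)
        also have "\<dots> = 0"
        proof (rule sum.neutral, rule ballI)
          fix j assume "j \<in> {..<d}"
          moreover have "(\<Sum>v\<in>U - {u}. c (j, v) * k v) = (\<Sum>v\<in>U. c (j, v) * k v)"
            using k0 u fin by (simp add: sum.remove)
          ultimately show "H x j * (\<Sum>v\<in>U - {u}. c (j, v) * k v) = 0" using row[of j] sumU[of j] by simp
        qed
        finally show ?thesis .
      qed
      then have "(\<Sum>v\<in>U. c (d, v) * k v) = 0" using k0 by (intro sum.neutral) auto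
      then show False using row[of d] sumU[of d] by simp
    qed
  qed (use row in \<open>auto simp: k_def\<close>)
qed

context
  fixes U :: "'v set" and d :: nat and k :: "'v \<Rightarrow> 'f"
  assumes kU: "\<And>u. u \<in> U \<Longrightarrow> k u \<noteq> 0" and k_out: "\<And>u. u \<notin> U \<Longrightarrow> k u = 0"
    and k_row: "\<And>j. j \<le> d \<Longrightarrow> (\<Sum>v\<in>V. c (j, v) * k v) = (if j = d then 1 else 0)"
    and k_shift: "\<And>f u \<mu>. f \<in> E d (Pow U) \<Longrightarrow> f (\<mu> + evar u) = k u * Th d f \<mu>"
begin

lemma point_dual_E: "point_dual k i \<in> E d (Pow U)"
proof (rule E_I)
  show "keys \<mu> \<in> Pow U" if "point_dual k i \<mu> \<noteq> 0" for \<mu>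
    using that k_out by (auto simp: point_dual_apply msub_eq_0_iff split: if_splits)
  fix j assume j: "j < d"
  show "Th j (point_dual k i) = 0"
  proof
    fix \<mu>
    have "(\<Sum>v\<in>V. c (j, v) * msub k (\<mu> + evar v)) = msub k \<mu> * (\<Sum>v\<in>V. c (j, v) * k v)"
      by (simp add: msub_add sum_distrib_left ac_simps)
    then have "Th j (msub k) \<mu> = 0" using k_row[of j] j by (simp add: Th_apply)
    then show "Th j (point_dual k i) \<mu> = 0 \<mu>" by (simp add: point_dual_def Th_proj)
  qed
qed

text \<open>Modulo \<open>d\<close> forms the ring of the simplex on \<open>d + 1\<close> vertices
  is a polynomial ring in one variable. The form \<open>d\<close> serves as this variable: by
  \<open>k_shift\<close>, its action on \<open>f\<close> determines \<open>f\<close> in positive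
  degree.\<close>

lemma E_simplex: "f \<in> E d (Pow U) \<Longrightarrow> homog i f \<Longrightarrow> \<exists>a. f = (\<lambda>\<mu>. a * point_dual k i \<mu>)"
proof (induction i arbitrary: f)
  case 0
  have "f = (\<lambda>\<mu>. f 0 * point_dual k 0 \<mu>)"
    using 0(2) by (intro ext) (auto simp: homog_def point_dual_apply mdeg_eq_0_iff)
  then show ?case by blast
next
  case (Suc i)
  have "Th d f \<in> E d (Pow U)" using Suc.prems(1) by (rule E_Th_closed) auto
  moreover have "homog i (Th d f)" using Suc.prems(2) by (rule homog_Th)
  ultimately obtain a where a: "Th d f = (\<lambda>\<mu>. a * point_dual k i \<mu>)" using Suc.IH by blast
  have "f \<mu> = a * point_dual k (Suc i) \<mu>" for \<mu>
  proof (cases "\<mu> = 0")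
    case True
    then show ?thesis using Suc.prems(2) by (auto simp: homog_def point_dual_apply)
  next
    case False
    then obtain u where "u \<in> keys \<mu>" by (meson all_not_in_conv keys_eq_empty)
    then obtain \<nu> where \<nu>: "\<mu> = \<nu> + evar u" by (rule in_keys_imp_evar_add)
    then show ?thesis using k_shift[OF Suc.prems(1), of \<nu> u] a by (simp add: point_dual_apply msub_add)
  qed
  then show ?case by blast
qed

text \<open>To reach \<open>f\<close> from \<psi>', first cancel its x_B-part by a contraction of
  \<psi>'. The rest lies in the dual of \<open>X\<close>, hence is r \<psi>. Replacing \<psi> by
  \<psi>' costs an evaluation times r(k). This error vanishes if the degree is at least |A|;
  otherwise it is again a contraction of \<psi>'.\<close>

lemma bistellar_generates:
  assumes gen: "generates d X d \<psi>"
    and Xdown: "\<And>\<sigma> \<tau>. \<sigma> \<in> X \<Longrightarrow> \<tau> \<subseteq> \<sigma> \<Longrightarrow> \<tau> \<in> X"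
    and AB: "U = A \<union> B" "A \<inter> B = {}" "finite A" "finite B" "A \<noteq> {}" "B \<noteq> {}" "card A + card B = d + 1"
    and XA: "\<And>\<sigma>. \<sigma> \<in> X \<Longrightarrow> A \<subseteq> \<sigma> \<Longrightarrow> \<sigma> \<subseteq> A \<union> B"
    and XB: "\<And>\<sigma>. \<sigma> \<in> X \<Longrightarrow> \<not> B \<subseteq> \<sigma>"
    and Xin: "\<And>\<sigma>. \<sigma> \<subseteq> A \<union> B \<Longrightarrow> \<not> B \<subseteq> \<sigma> \<Longrightarrow> \<sigma> \<in> X"
    and X': "\<And>\<sigma>. \<sigma> \<in> X' \<longleftrightarrow> \<not> A \<subseteq> \<sigma> \<and> (\<sigma> \<in> X \<or> \<sigma> \<subseteq> A \<union> B)"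
    and F: "A \<subseteq> F" "finite F" "\<psi> (ind F) \<noteq> 0"
  shows "\<exists>a. generates d X' d (\<psi> - (\<lambda>\<mu>. a * point_dual k d \<mu>))"
proof -
  have cA: "card A \<le> d" "card B \<le> d" "card A \<ge> 1" "card B \<ge> 1"
    using AB card_gt_0_iff[of A] card_gt_0_iff[of B] by simp_all
  have \<psi>: "\<psi> \<in> E d X" "homog d \<psi>" using generatesD[OF gen] by blast+
  have down: "\<And>\<sigma> \<tau>. \<sigma> \<in> Pow U \<Longrightarrow> \<tau> \<subseteq> \<sigma> \<Longrightarrow> \<tau> \<in> Pow U" by blast
  define DA where "DA = Poly_Mapping.single (ind A) (1::'f)"
  define DB where "DB = Poly_Mapping.single (ind B) (1::'f)"
  have kA: "msub k (ind A) \<noteq> 0" and kB: "msub k (ind B) \<noteq> 0"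
    using kU AB by (auto simp: msub_eq_0_iff keys_ind)
  have hDA: "hpoly (card A) DA" unfolding DA_def using hpoly_single[of "ind A" "1::'f"] AB by (simp only: mdeg_ind)
  have hDB: "hpoly (card B) DB" unfolding DB_def using hpoly_single[of "ind B" "1::'f"] AB by (simp only: mdeg_ind)
  have DA: "act DA f = (\<lambda>\<mu>. f (\<mu> + ind A))" for f by (simp add: DA_def)
  have DB: "act DB f = (\<lambda>\<mu>. f (\<mu> + ind B))" for f by (simp add: DB_def)
  have vDA: "poly_value DA k = msub k (ind A)" by (simp add: DA_def)
  have vDB: "poly_value DB k = msub k (ind B)" by (simp add: DB_def)
  have "act DA \<psi> \<in> E d (Pow U)"
    unfolding DA_def by (rule E_act_link[OF \<psi>(1)]) (use XA AB in \<open>auto simp: keys_ind\<close>)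
  moreover have "homog (d - card A) (act DA \<psi>)"
    by (rule homog_act[OF hDA]) (use \<psi>(2) cA in simp)
  ultimately obtain e where e: "act DA \<psi> = (\<lambda>\<mu>. e * point_dual k (d - card A) \<mu>)" using E_simplex by blast
  have e0: "e \<noteq> 0"
  proof
    assume "e = 0"
    then have "act DA \<psi> (ind (F - A)) = 0" using e by simp
    moreover have "ind (F - A) + ind A = ind F"
      using F by (intro poly_mapping_eqI) (auto simp: lookup_add lookup_ind finite_subset)
    ultimately show False using F(3) by (simp add: DA)
  qed
  \<comment> \<open>Chosen so that x_A kills \<psi>'. The facet \<open>F\<close> guarantees
    \<open>a \<noteq> 0\<close>, which gives \<psi>' a nonzero x_B-part.\<close>
  define a where "a = e / msub k (ind A)"
  have a0: "a \<noteq> 0" using e0 kA by (simp add: a_def)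
  define \<psi>' where "\<psi>' = \<psi> - (\<lambda>\<mu>. a * point_dual k d \<mu>)"
  have act': "act p \<psi>' = act p \<psi> - (\<lambda>\<mu>. a * (poly_value p k * point_dual k (d - j) \<mu>))"
    if "hpoly j p" "j \<le> d" for p j
    unfolding \<psi>'_def act_diff_right act_scale_right by (simp only: act_point_dual[OF that])
  have DB\<psi>: "act DB \<psi> = 0"
  proof
    fix \<mu>
    have "\<not> keys (\<mu> + ind B) \<in> X" using XB AB by (auto simp: keys_add_nat keys_ind)
    then show "act DB \<psi> \<mu> = 0 \<mu>" using E_keys'[OF \<psi>(1)] by (simp add: DB)
  qed
  have DA\<psi>': "act DA \<psi>' = 0"
    unfolding act'[OF hDA cA(1)] e vDA using kA by (simp add: a_def fun_eq_iff)
  have contains_A: "f \<mu> = 0" if f: "act DA f = 0" and sub: "A \<subseteq> keys \<mu>" for f \<mu>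
  proof -
    obtain \<nu> where "\<mu> = \<nu> + ind A" using ind_dvd[OF AB(3) sub] by blast
    then show ?thesis using f unfolding DA by (simp add: fun_eq_iff)
  qed
  have contains_B: "f \<mu> = 0" if f: "act DB f = 0" and sub: "B \<subseteq> keys \<mu>" for f \<mu>
  proof -
    obtain \<nu> where "\<mu> = \<nu> + ind B" using ind_dvd[OF AB(4) sub] by blast
    then show ?thesis using f unfolding DB by (simp add: fun_eq_iff)
  qed
  have \<psi>'E: "\<psi>' \<in> E d X'"
  proof (rule E_I)
    fix \<mu> assume nz: "\<psi>' \<mu> \<noteq> 0"
    then have "\<not> A \<subseteq> keys \<mu>" using contains_A[OF DA\<psi>'] by blast
    moreover have "\<psi> \<mu> \<noteq> 0 \<or> point_dual k d \<mu> \<noteq> 0" using nz by (auto simp: \<psi>'_def)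
    then have "keys \<mu> \<in> X \<or> keys \<mu> \<subseteq> A \<union> B"
      using E_keys[OF \<psi>(1)] E_keys[OF point_dual_E] AB(1) by blast
    ultimately show "keys \<mu> \<in> X'" using X' by blast
  next
    fix j assume "j < d"
    \<comment> \<open>\<open>UNIV\<close> imposes no condition on supports, so only the operators
      are compared.\<close>
    then show "Th j \<psi>' = 0"
      unfolding \<psi>'_def using E_Th[OF E_diff[OF E_mono[OF \<psi>(1), of UNIV] E_scale[OF E_mono[OF point_dual_E, of UNIV]]]] by blast
  qed
  have h\<psi>': "homog d \<psi>'" unfolding \<psi>'_def by (intro homog_diff \<psi> homog_scale homog_point_dual)
  obtain u where u: "u \<in> B" using AB by blast
  have ku: "k u \<noteq> 0" using kU u AB by blast
  have reduce: "f \<in> E d X" if f: "f \<in> E d X'" "act DB f = 0" for f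
  proof (rule E_I)
    fix \<mu> assume nz: "f \<mu> \<noteq> 0"
    then have "keys \<mu> \<in> X'" using E_keys[OF f(1)] by blast
    moreover have "\<not> B \<subseteq> keys \<mu>" using contains_B[OF f(2)] nz by blast
    ultimately show "keys \<mu> \<in> X" using X' Xin by blast
  qed (use E_Th[OF f(1)] in blast)
  have DBf: "act DB f \<in> E d (Pow U)" if f: "f \<in> E d X'" for f
    unfolding DB_def by (rule E_act_link[OF f]) (use X' XB AB in \<open>auto simp: keys_ind\<close>)
  have DBlow: "act DB f = 0" if f: "homog i f" "i < card B" for f i
    using f AB by (intro ext) (auto simp: DB homog_def mdeg_ind)
  have DBhigh: "\<exists>b. act DB f = (\<lambda>\<mu>. b * point_dual k (i - card B) \<mu>)" if f: "f \<in> E d X'" "homog i f" "card B \<le> i" for f i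
  proof (rule E_simplex[OF DBf[OF f(1)]])
    show "homog (i - card B) (act DB f)" by (rule homog_act[OF hDB]) (use f in simp)
  qed
  have "generates d X' d \<psi>'"
    unfolding generates_def
  proof (intro conjI allI ballI impI \<psi>'E h\<psi>')
    fix i f assume f: "f \<in> E d X'" "homog i f"
    show "f = 0" if i: "d < i"
    proof -
      obtain b where b: "act DB f = (\<lambda>\<mu>. b * point_dual k (i - card B) \<mu>)"
        using DBhigh[OF f] i cA by auto
      obtain v where v: "v \<in> A" using AB by blast
      \<comment> \<open>A test monomial of degree \<open>i - card B\<close> divisible by x_A; it
        exists because \<open>i \<ge> d + 1 = card A + card B\<close>. Its product with x_B involves
        all of A \<union> B, which is not a face of \<open>X'\<close>, and this forces
        \<open>b = 0\<close>.\<close>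
      define \<nu> where "\<nu> = Poly_Mapping.single v (i - card B - card A) + ind A"
      have "\<not> keys (\<nu> + ind B) \<in> X'" using X' AB by (auto simp: \<nu>_def keys_add_nat keys_ind)
      then have "act DB f \<nu> = 0" using E_keys'[OF f(1)] by (simp add: DB)
      moreover have "mdeg \<nu> = i - card B" using i AB by (simp add: \<nu>_def mdeg_ind)
      moreover have "msub k \<nu> \<noteq> 0" using kA kU v AB by (simp add: \<nu>_def msub_add msub_eq_0_iff)
      ultimately have "b = 0" using b by (simp add: point_dual_apply)
      then have "act DB f = 0" using b by (simp add: fun_eq_iff)
      then show ?thesis using generatesD(3)[OF gen reduce[OF f(1)] f(2) i] by blast
    qed
    show "\<exists>p. hpoly (d - i) p \<and> f = act p \<psi>'" if i: "i \<le> d"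
    proof -
      define q where "q = Poly_Mapping.single (Poly_Mapping.single u (d - i)) (1::'f)"
      have hq: "hpoly (d - i) q" unfolding q_def using hpoly_single[of "Poly_Mapping.single u (d - i)" "1::'f"] by simp
      have qk: "poly_value q k \<noteq> 0" using ku by (simp add: q_def msub_eq_0_iff)
      \<comment> \<open>The x_B-parts of \<open>f\<close> and of q \<psi>' are multiples of the same
        evaluation. Since x_B kills \<psi>, the multiple for q \<psi>' is \<open>- y\<close>, which
        is nonzero; hence the choice \<open>- b / y\<close>.\<close>
      have "\<exists>t. act DB (f - (\<lambda>\<mu>. t * act q \<psi>' \<mu>)) = 0"
      proof (cases "card B \<le> i")
        case True
        obtain b where b: "act DB f = (\<lambda>\<mu>. b * point_dual k (i - card B) \<mu>)" using DBhigh[OF f True] by blast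
        have hp: "hpoly (card B + (d - i)) (DB * q)" by (rule hpoly_mult[OF hDB hq])
        have "card B + (d - i) \<le> d" "d - (card B + (d - i)) = i - card B" using True i by auto
        then have "act (DB * q) \<psi>' = act (DB * q) \<psi> - (\<lambda>\<mu>. a * (poly_value (DB * q) k * point_dual k (i - card B) \<mu>))"
          using act'[OF hp] by simp
        moreover have "act (DB * q) \<psi> = 0" by (subst mult.commute) (simp only: act_mult DB\<psi> act_zero_right)
        ultimately have DBq: "act DB (act q \<psi>') = 0 - (\<lambda>\<mu>. a * (poly_value (DB * q) k * point_dual k (i - card B) \<mu>))"
          by (simp only: act_mult)
        define y where "y = a * poly_value (DB * q) k"
        have y0: "y \<noteq> 0" using a0 qk kB by (simp add: y_def poly_value_mult vDB)
        have "act DB (f - (\<lambda>\<mu>. (- b / y) * act q \<psi>' \<mu>)) = 0"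
          unfolding act_diff_right act_scale_right DBq b
          using y0 by (simp add: fun_eq_iff y_def[symmetric] mult.assoc[symmetric])
        then show ?thesis by blast
      next
        case False
        then have "act DB f = 0" using DBlow f by simp
        then show ?thesis by (intro exI[of _ 0]) (simp add: fun_diff_def)
      qed
      then obtain t where t: "act DB (f - (\<lambda>\<mu>. t * act q \<psi>' \<mu>)) = 0" by blast
      define f1 where "f1 = f - (\<lambda>\<mu>. t * act q \<psi>' \<mu>)"
      have q\<psi>'E: "act q \<psi>' \<in> E d UNIV" by (rule E_act[OF E_mono[OF \<psi>'E]]) auto
      have f1E: "f1 \<in> E d X"
      proof (rule E_I)
        fix \<mu> assume nz: "f1 \<mu> \<noteq> 0"
        have nB: "\<not> B \<subseteq> keys \<mu>" using contains_B[of f1] t nz by (auto simp: f1_def)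
        have "f \<mu> \<noteq> 0 \<or> \<psi>' (\<mu> + Poly_Mapping.single u (d - i)) \<noteq> 0"
          using nz by (auto simp: f1_def q_def)
        then show "keys \<mu> \<in> X"
        proof
          assume "f \<mu> \<noteq> 0"
          then have "keys \<mu> \<in> X'" by (rule E_keys[OF f(1)])
          then have "keys \<mu> \<in> X \<or> keys \<mu> \<subseteq> A \<union> B" using X' by simp
          then show ?thesis using Xin nB by blast
        next
          assume nz: "\<psi>' (\<mu> + Poly_Mapping.single u (d - i)) \<noteq> 0"
          then have "\<psi> (\<mu> + Poly_Mapping.single u (d - i)) \<noteq> 0 \<or> point_dual k d (\<mu> + Poly_Mapping.single u (d - i)) \<noteq> 0"
            by (auto simp: \<psi>'_def)
          then show ?thesis
          proof
            assume nz\<psi>: "\<psi> (\<mu> + Poly_Mapping.single u (d - i)) \<noteq> 0"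
            have "act q \<psi> \<mu> \<noteq> 0" using nz\<psi> by (simp add: q_def)
            moreover have "act q \<psi> \<in> E d X" using \<psi>(1) by (rule E_act) (rule Xdown)
            ultimately show ?thesis by (simp add: E_keys)
          next
            assume "point_dual k d (\<mu> + Poly_Mapping.single u (d - i)) \<noteq> 0"
            then have "keys (\<mu> + Poly_Mapping.single u (d - i)) \<in> Pow U" by (rule E_keys[OF point_dual_E])
            then have "keys \<mu> \<subseteq> A \<union> B" using AB(1) by (simp add: keys_add_nat)
            then show ?thesis using Xin nB by blast
          qed
        qed
      next
        fix j assume "j < d"
        then show "Th j f1 = 0" unfolding f1_def
          using E_Th[OF E_diff[OF E_mono[OF f(1), of UNIV] E_scale[OF q\<psi>'E]]] by blast
      qed
      have hq\<psi>': "homog i (act q \<psi>')" by (rule homog_act[OF hq]) (use h\<psi>' i in simp)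
      have hf1: "homog i f1" unfolding f1_def by (intro homog_diff f homog_scale hq\<psi>')
      obtain r where r: "hpoly (d - i) r" "f1 = act r \<psi>" using generatesD(4)[OF gen f1E hf1 i] by blast
      have r': "act r \<psi>' = f1 - (\<lambda>\<mu>. a * (poly_value r k * point_dual k i \<mu>))"
        using act'[OF r(1)] i r(2) by simp
      have "\<exists>s. hpoly (d - i) s \<and> act s \<psi>' = (\<lambda>\<mu>. a * (poly_value r k * point_dual k i \<mu>))"
      proof (cases "i < card A")
        case False
        \<comment> \<open>x_A kills \<open>f\<close> and \<psi>', hence \<open>f1\<close>, but takes
          \<psi> to a nonzero multiple of an evaluation. Therefore \<open>r\<close> vanishes at
          \<open>k\<close>.\<close>
        have DAf: "act DA f = 0"
        proof
          fix \<mu>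
          have "\<not> keys (\<mu> + ind A) \<in> X'" using X' AB by (auto simp: keys_add_nat keys_ind)
          then show "act DA f \<mu> = 0 \<mu>" using E_keys'[OF f(1)] by (simp add: DA)
        qed
        have "act DA (act q \<psi>') = 0" by (subst act_commute) (simp only: DA\<psi>' act_zero_right)
        then have "act DA f1 = 0" unfolding f1_def act_diff_right act_scale_right DAf by (simp add: fun_eq_iff)
        then have "act r (act DA \<psi>) = 0" unfolding r(2) by (subst act_commute)
        moreover have "d - i \<le> d - card A" "d - card A - (d - i) = i - card A" using False i by auto
        ultimately have "(\<lambda>\<mu>. e * (poly_value r k * point_dual k (i - card A) \<mu>)) = 0"
          unfolding e act_scale_right using act_point_dual[OF r(1), of "d - card A" k] by simp
        then have "e * (poly_value r k * point_dual k (i - card A) (Poly_Mapping.single u (i - card A))) = 0"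
          by (rule fun_cong[THEN trans]) simp
        then have "poly_value r k = 0" using e0 point_dual_nonzero[of k u, OF ku] by simp
        then show ?thesis by (intro exI[of _ 0]) (simp add: fun_eq_iff)
      next
        case True
        \<comment> \<open>Now a monomial of degree \<open>d - i\<close> divisible by x_B exists. It
          kills \<psi>, so on \<psi>' it produces exactly a nonzero multiple of the evaluation in
          degree \<open>i\<close>.\<close>
        then have iB: "card B \<le> d - i" using AB by simp
        define \<nu> where "\<nu> = Poly_Mapping.single u (d - i - card B) + ind B"
        define s where "s = Poly_Mapping.single \<nu> (1::'f)"
        have "mdeg \<nu> = d - i" using iB AB by (simp add: \<nu>_def mdeg_ind)
        then have hs: "hpoly (d - i) s" unfolding s_def using hpoly_single[of \<nu> "1::'f"] by simp
        have sk: "poly_value s k \<noteq> 0" using kB ku by (simp add: s_def \<nu>_def msub_add msub_eq_0_iff)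
        have "s = Poly_Mapping.single (Poly_Mapping.single u (d - i - card B)) 1 * DB"
          by (simp add: s_def \<nu>_def DB_def mult_single)
        then have "act s \<psi> = 0" by (simp only: act_mult DB\<psi> act_zero_right)
        then have s\<psi>': "act s \<psi>' = 0 - (\<lambda>\<mu>. a * (poly_value s k * point_dual k i \<mu>))"
          using act'[OF hs] i by simp
        show ?thesis
          by (rule exI[of _ "const_poly (- poly_value r k / poly_value s k) * s"])
             (use sk hs in \<open>simp add: act_mult s\<psi>' hpoly_const_mult fun_eq_iff\<close>)
      qed
      then obtain s where s: "hpoly (d - i) s" "act s \<psi>' = (\<lambda>\<mu>. a * (poly_value r k * point_dual k i \<mu>))" by blast
      define p where "p = const_poly t * q + (r + s)"
      have "hpoly (d - i) p" unfolding p_def by (intro hpoly_add hpoly_const_mult hq r s)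
      moreover have "f = act p \<psi>'"
        unfolding p_def act_add_left act_mult r' s(2) by (rule ext) (simp add: f1_def)
      ultimately show ?thesis by blast
    qed
  qed
  then show ?thesis unfolding \<psi>'_def by blast
qed

end

end

section \<open>The Artinian quotient\<close>

lemma polys_in_single: "keys \<mu> \<subseteq> X \<Longrightarrow> Poly_Mapping.single \<mu> a \<in> polys_in X"
  by (auto simp: polys_in_def)

lemma polys_in_const [simp]: "const_poly a \<in> polys_in X"
  by (auto simp: polys_in_def const_poly_def)

lemma polys_in_one [simp]: "1 \<in> polys_in X"
  by (auto simp: polys_in_def)

lemma polys_in_zero [simp]: "0 \<in> polys_in X"
  by (auto simp: polys_in_def)

lemma polys_in_uminus: "p \<in> polys_in X \<Longrightarrow> - p \<in> polys_in X"
  by (auto simp: polys_in_def)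

lemma polys_in_diff: "p \<in> polys_in X \<Longrightarrow> q \<in> polys_in X \<Longrightarrow> p - q \<in> polys_in X"
  using polys_in_add[of p X "- q"] polys_in_uminus[of q X] by simp

lemma polys_in_sum: "(\<And>i. i \<in> I \<Longrightarrow> p i \<in> polys_in X) \<Longrightarrow> sum p I \<in> polys_in X"
  by (induction I rule: infinite_finite_induct) (auto intro: polys_in_add)

lemma polys_in_pvar: "x \<in> X \<Longrightarrow> pvar x \<in> polys_in X"
  by (auto simp: polys_in_def pvar_def)

lemma polys_in_linear_form: "linear_form X a \<in> polys_in X"
  unfolding linear_form_def by (intro polys_in_sum polys_in_mult polys_in_const polys_in_pvar)

lemma prod_pvar: "finite \<sigma> \<Longrightarrow> (\<Prod>v\<in>\<sigma>. pvar v) = Poly_Mapping.single (ind \<sigma>) 1"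
  by (induction \<sigma> rule: finite_induct) (auto simp: ind_insert pvar_def mult_single add.commute)

lemma homogeneous_part_iff: "p \<in> homogeneous_part X i \<longleftrightarrow> p \<in> polys_in X \<and> hpoly i p"
  by (auto simp: homogeneous_part_def hpoly_def mdeg_def)

lemma finite_monomials:
  assumes "finite W"
  shows "finite {\<nu> :: 'x \<Rightarrow>\<^sub>0 nat. keys \<nu> \<subseteq> W \<and> mdeg \<nu> \<le> n}"
proof (induction n)
  case 0
  show ?case by (rule finite_subset[of _ "{0}"]) (auto simp: mdeg_eq_0_iff)
next
  case (Suc n)
  let ?M = "\<lambda>n. {\<nu> :: 'x \<Rightarrow>\<^sub>0 nat. keys \<nu> \<subseteq> W \<and> mdeg \<nu> \<le> n}"
  have "?M (Suc n) \<subseteq> insert 0 ((\<lambda>(\<nu>, x). \<nu> + evar x) ` (?M n \<times> W))"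
  proof
    fix \<nu> assume \<nu>: "\<nu> \<in> ?M (Suc n)"
    show "\<nu> \<in> insert 0 ((\<lambda>(\<nu>, x). \<nu> + evar x) ` (?M n \<times> W))"
    proof (cases "\<nu> = 0")
      case False
      then obtain x where x: "x \<in> keys \<nu>" by (meson all_not_in_conv keys_eq_empty)
      then obtain \<nu>' where "\<nu> = \<nu>' + evar x" by (rule in_keys_imp_evar_add)
      then show ?thesis using \<nu> by (intro insertI2 image_eqI[of _ _ "(\<nu>', x)"]) (auto simp: keys_add_nat)
    qed simp
  qed
  then show ?case by (rule finite_subset) (use Suc assms in simp)
qed

lemma const_poly_simps:
  "const_poly (a + b) = const_poly a + const_poly b" "const_poly (a * b) = const_poly a * const_poly b"
  "const_poly 1 = 1" "const_poly 0 = 0" "const_poly (- a) = - const_poly a"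
  by (simp_all add: const_poly_def single_add mult_single single_uminus)

section \<open>Linear functionals on the polynomial ring\<close>

definition mpoly_scale :: "'f::field \<Rightarrow> ('x, 'f) mpoly \<Rightarrow> ('x, 'f) mpoly" where
  "mpoly_scale a p = const_poly a * p"

lemma vector_space_mpoly_scale: "vector_space mpoly_scale"
  by (rule vector_space.intro)
     (simp_all only: mpoly_scale_def const_poly_simps distrib_left distrib_right mult.assoc mult_1)

interpretation mpoly_space: vector_space mpoly_scale
  by (rule vector_space_mpoly_scale)

text \<open>The coordinate at \<open>p\<close> in a basis of the whole ring that extends a basis of
  \<open>S\<close> together with \<open>p\<close>.\<close>

lemma separating_functional:
  fixes S :: "('x, 'f::field) mpoly set"
  assumes "mpoly_space.subspace S" "p \<notin> S"
  obtains \<Lambda> :: "('x, 'f) mpoly \<Rightarrow> 'f" where "\<And>x y. \<Lambda> (x + y) = \<Lambda> x + \<Lambda> y" "\<And>a x. \<Lambda> (const_poly a * x) = a * \<Lambda> x"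
    "\<And>s. s \<in> S \<Longrightarrow> \<Lambda> s = 0" "\<Lambda> p = 1"
proof -
  obtain B where B: "B \<subseteq> S" "mpoly_space.independent B" "S \<subseteq> mpoly_space.span B"
    by (rule mpoly_space.basis_exists[of S])
  have "mpoly_space.span B \<subseteq> S" using B(1) assms(1) by (rule mpoly_space.span_minimal)
  then have pB: "p \<notin> mpoly_space.span B" using assms(2) by blast
  then have ind: "mpoly_space.independent (insert p B)"
    by (rule mpoly_space.independent_insertI) (rule B(2))
  define B' where "B' = mpoly_space.extend_basis (insert p B)"
  have B': "mpoly_space.independent B'" "mpoly_space.span B' = UNIV" "insert p B \<subseteq> B'"
    using mpoly_space.independent_extend_basis[OF ind] mpoly_space.span_extend_basis[OF ind]
      mpoly_space.extend_basis_superset[OF ind] by (simp_all add: B'_def)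
  show ?thesis
  proof (rule that[of "\<lambda>x. mpoly_space.representation B' x p"])
    show "mpoly_space.representation B' (x + y) p = mpoly_space.representation B' x p + mpoly_space.representation B' y p" for x y
      using mpoly_space.representation_add[OF B'(1), of y x] B'(2) by simp
    show "mpoly_space.representation B' (const_poly a * x) p = a * mpoly_space.representation B' x p" for a x
      using mpoly_space.representation_scale[OF B'(1), of x a] B'(2) by (simp add: mpoly_scale_def)
    show "mpoly_space.representation B' s p = 0" if s: "s \<in> S" for s
    proof -
      have "mpoly_space.representation B' s = mpoly_space.representation B s"
        by (rule mpoly_space.representation_extend[OF B'(1)]) (use B(3) B'(3) s in auto)
      moreover have "p \<notin> B" using pB mpoly_space.span_base[of p B] by blast
      ultimately show ?thesis using mpoly_space.representation_ne_zero[of B s p] by auto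
    qed
    show "mpoly_space.representation B' p p = 1"
      using mpoly_space.representation_basis[OF B'(1), of p] B'(3) by simp
  qed
qed

text \<open>\<open>V\<close> may be larger than the vertex set, which lets two complexes share one
  coefficient point. On functions supported on \<Delta>, the forms over \<open>V\<close> and over
  the vertices of \<Delta> act alike.\<close>

locale inverse_system = coeff_rows V c
  for V :: "'v::linorder set" and c :: "nat \<times> 'v \<Rightarrow> 'f::field" +
  fixes \<Delta> :: "'v set set" and d :: nat and \<psi> :: "('v \<Rightarrow>\<^sub>0 nat) \<Rightarrow> 'f"
  assumes complex: "simplicial_complex \<Delta>" and rank: "rank_of \<Delta> = d" and verts: "\<Union>\<Delta> \<subseteq> V"
    and gen: "generates d \<Delta> d \<psi>"
begin

abbreviation "W \<equiv> \<Union>\<Delta>"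
abbreviation "R \<equiv> poly_ring W :: ('v, 'f) mpoly ring"
abbreviation "FR \<equiv> face_ring \<Delta> :: ('v, 'f) mpoly set ring"

definition \<theta> :: "nat \<Rightarrow> ('v, 'f) mpoly" where "\<theta> = (\<lambda>i. linear_form W (\<lambda>v. c (i, v)))"

abbreviation "J \<equiv> theta_ideal \<Delta> \<theta>"
abbreviation "AQ \<equiv> artinian_quotient \<Delta> \<theta>"
abbreviation "cls \<equiv> artinian_class \<Delta> \<theta>"

text \<open>The preimage of \<Theta> in the polynomial ring. The artinian quotient is
  \<open>R\<close> modulo this ideal, which avoids reasoning with cosets of cosets.\<close>

definition ann :: "('v, 'f) mpoly set" where
  "ann = {p \<in> polys_in W. face_class \<Delta> p \<in> J}"

definition N :: "('v, 'f) mpoly set" where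
  "N = {p \<in> polys_in W. \<forall>f\<in>E d \<Delta>. act p f = 0}"

lemma down: "\<sigma> \<in> \<Delta> \<Longrightarrow> \<tau> \<subseteq> \<sigma> \<Longrightarrow> \<tau> \<in> \<Delta>"
  using complex unfolding simplicial_complex_def by blast

lemma fin_W: "finite W"
  using complex by (simp add: simplicial_complex_def)

lemma carrier_R: "carrier R = polys_in W"
  by (simp add: poly_ring_def)

lemma R_ops: "x \<oplus>\<^bsub>R\<^esub> y = x + y" "x \<otimes>\<^bsub>R\<^esub> y = x * y" "\<zero>\<^bsub>R\<^esub> = 0" "\<one>\<^bsub>R\<^esub> = 1"
  by (simp_all add: poly_ring_def)

interpretation R: cring R
  by (rule cring_poly_ring)

lemma R_uminus: "p \<in> polys_in W \<Longrightarrow> \<ominus>\<^bsub>R\<^esub> p = - p"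
  by (rule R.minus_equality) (auto simp: R_ops carrier_R polys_in_uminus)

lemma R_minus: "p \<in> polys_in W \<Longrightarrow> q \<in> polys_in W \<Longrightarrow> p \<ominus>\<^bsub>R\<^esub> q = p - q"
  by (simp add: a_minus_def R_uminus R_ops)

lemma act_theta: "f \<in> E s \<Delta> \<Longrightarrow> act (linear_form W (\<lambda>v. c (i, v))) f = Th i f"
proof
  fix \<mu> assume f: "f \<in> E s \<Delta>"
  have "f (\<mu> + evar v) = 0" if "v \<notin> W" for v
    by (rule E_keys'[OF f]) (use that in \<open>auto simp: keys_add_nat\<close>)
  then have "(\<Sum>v\<in>V. c (i, v) * f (\<mu> + evar v)) = (\<Sum>v\<in>W. c (i, v) * f (\<mu> + evar v))"
    by (intro sum.mono_neutral_right finite_V verts) auto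
  then show "act (linear_form W (\<lambda>v. c (i, v))) f \<mu> = Th i f \<mu>"
    by (simp add: act_linear_form Th_apply)
qed

lemma N_ideal: "ideal N R"
proof (rule idealI)
  show "ring R" by (rule R.ring_axioms)
  show "subgroup N (add_monoid R)"
  proof (rule R.add.subgroupI)
    show "N \<noteq> {}" unfolding N_def by (rule ex_in_conv[THEN iffD1]) (rule exI[of _ 0], simp)
    show "\<ominus>\<^bsub>R\<^esub> a \<in> N" if "a \<in> N" for a
      using that by (auto simp: N_def R_uminus polys_in_uminus act_uminus_left)
    show "a \<oplus>\<^bsub>R\<^esub> b \<in> N" if "a \<in> N" "b \<in> N" for a b
      using that by (auto simp: N_def R_ops polys_in_add act_add_left)
  qed (auto simp: N_def carrier_R)
  show "x \<otimes>\<^bsub>R\<^esub> a \<in> N" if "a \<in> N" "x \<in> carrier R" for a x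
    using that by (auto simp: N_def R_ops carrier_R polys_in_mult act_mult simp flip: zero_fun_def)
  show "a \<otimes>\<^bsub>R\<^esub> x \<in> N" if "a \<in> N" "x \<in> carrier R" for a x
    using that by (auto simp: N_def R_ops carrier_R polys_in_mult act_mult act_commute[of a x] simp flip: zero_fun_def)
qed

lemma face_gens_carrier: "{\<Prod>v\<in>\<sigma>. pvar v | \<sigma>. \<sigma> \<subseteq> W \<and> \<sigma> \<notin> \<Delta>} \<subseteq> carrier R"
proof -
  have "(\<Prod>v\<in>\<sigma>. pvar v) \<in> polys_in W" if "\<sigma> \<subseteq> W" for \<sigma>
    using that finite_subset[OF that fin_W] by (simp add: prod_pvar polys_in_single keys_ind)
  then show ?thesis by (auto simp: carrier_R)
qed

interpretation I: ideal "face_ideal \<Delta>" R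
  unfolding face_ideal_def by (rule R.genideal_ideal[OF face_gens_carrier])

interpretation FR: cring FR
  unfolding face_ring_def by (rule I.quotient_is_cring) (rule R.is_cring)

interpretation fc: ring_hom_ring R FR "face_class \<Delta>"
proof -
  have "face_class \<Delta> = (+>\<^bsub>R\<^esub>) (face_ideal \<Delta>)" by (rule ext) (simp add: face_class_def)
  then show "ring_hom_ring R FR (face_class \<Delta>)" using I.rcos_ring_hom_ring by (simp add: face_ring_def)
qed

lemma FR_carrier: "x \<in> carrier FR \<Longrightarrow> \<exists>p\<in>polys_in W. x = face_class \<Delta> p"
  by (auto simp: face_ring_def FactRing_def A_RCOSETS_def' face_class_def carrier_R)

lemma fc_closed: "p \<in> polys_in W \<Longrightarrow> face_class \<Delta> p \<in> carrier FR"
  using fc.hom_closed[of p] by (simp add: carrier_R)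

lemma fc_eq:
  fixes p q :: "('v, 'f) mpoly"
  shows "p \<in> polys_in W \<Longrightarrow> q \<in> polys_in W \<Longrightarrow> face_class \<Delta> p = face_class \<Delta> q \<longleftrightarrow> p - q \<in> face_ideal \<Delta>"
  using R.quotient_eq_iff_same_a_r_cos[OF I.is_ideal, of p q] by (simp add: carrier_R R_minus face_class_def)

lemma theta_carrier: "\<theta> i \<in> polys_in W"
  by (simp add: \<theta>_def polys_in_linear_form)

interpretation J: ideal J FR
  unfolding theta_ideal_def
  by (rule FR.genideal_ideal) (use theta_carrier fc.hom_closed in \<open>auto simp: carrier_R\<close>)

interpretation AQ: cring AQ
  unfolding artinian_quotient_def by (rule J.quotient_is_cring) (rule FR.is_cring)

interpretation cls: ring_hom_ring R AQ cls
proof (rule ring_hom_ringI2)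
  have "(+>\<^bsub>FR\<^esub>) J \<circ> face_class \<Delta> \<in> Ring.ring_hom R (FR Quot J)"
    by (rule ring_hom_trans[OF fc.homh J.rcos_ring_hom])
  moreover have "cls = (+>\<^bsub>FR\<^esub>) J \<circ> face_class \<Delta>" by (rule ext) (simp add: artinian_class_def)
  ultimately show "cls \<in> Ring.ring_hom R AQ" by (simp add: artinian_quotient_def)
qed (rule R.ring_axioms AQ.ring_axioms)+

lemma cls_eq: "p \<in> polys_in W \<Longrightarrow> q \<in> polys_in W \<Longrightarrow> cls p = cls q \<longleftrightarrow> p - q \<in> ann"
proof -
  assume p: "p \<in> polys_in W" and q: "q \<in> polys_in W"
  have "face_class \<Delta> p \<ominus>\<^bsub>FR\<^esub> face_class \<Delta> q = face_class \<Delta> (p - q)"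
    using fc.hom_add[of p "\<ominus>\<^bsub>R\<^esub> q"] fc.hom_a_inv[of q] p q R.add.inv_closed[of q]
    by (simp add: a_minus_def carrier_R R_ops R_uminus)
  then show ?thesis
    using FR.quotient_eq_iff_same_a_r_cos[OF J.is_ideal fc.hom_closed fc.hom_closed, of p q] p q
    by (simp add: ann_def artinian_class_def carrier_R polys_in_diff)
qed

lemma AQ_carrier: "x \<in> carrier AQ \<Longrightarrow> \<exists>p\<in>polys_in W. x = cls p"
  using FR_carrier by (fastforce simp: artinian_quotient_def FactRing_def A_RCOSETS_def' artinian_class_def)

lemma ann_polys: "p \<in> ann \<Longrightarrow> p \<in> polys_in W"
  by (simp add: ann_def)

lemma ann_add: "p \<in> ann \<Longrightarrow> q \<in> ann \<Longrightarrow> p + q \<in> ann"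
  using fc.hom_add[of p q] J.a_closed[of "face_class \<Delta> p" "face_class \<Delta> q"]
  by (simp add: ann_def carrier_R R_ops polys_in_add)

lemma ann_mult: "q \<in> polys_in W \<Longrightarrow> p \<in> ann \<Longrightarrow> q * p \<in> ann"
  using fc.hom_mult[of q p] J.I_l_closed[of "face_class \<Delta> p" "face_class \<Delta> q"] fc.hom_closed[of q]
  by (simp add: ann_def carrier_R R_ops polys_in_mult)

lemma ann_zero: "0 \<in> ann"
  using fc.hom_zero J.zero_closed by (simp add: ann_def R_ops)

lemma ann_subspace: "mpoly_space.subspace ann"
  by (auto simp: mpoly_space.subspace_def mpoly_scale_def ann_add ann_mult ann_zero)

lemma ann_theta:
  assumes "i < d"
  shows "\<theta> i \<in> ann"
proof -
  have "(\<lambda>i. face_class \<Delta> (\<theta> i)) ` {..<rank_of \<Delta>} \<subseteq> J"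
    unfolding theta_ideal_def by (rule FR.genideal_self) (use theta_carrier fc_closed in blast)
  then show ?thesis using assms by (auto simp: ann_def theta_carrier rank)
qed

lemma ann_nonface:
  assumes "keys \<mu> \<subseteq> W" "keys \<mu> \<notin> \<Delta>"
  shows "Poly_Mapping.single \<mu> a \<in> ann"
proof -
  obtain \<nu> where \<nu>: "\<mu> = \<nu> + ind (keys \<mu>)" using ind_dvd[of "keys \<mu>" \<mu>] by auto
  then have "keys \<nu> \<subseteq> W" using assms(1) by (metis keys_add_nat le_sup_iff)
  define x where "x = Poly_Mapping.single (ind (keys \<mu>)) (1::'f)"
  have xW: "x \<in> polys_in W" using assms by (simp add: x_def polys_in_single keys_ind)
  have "x \<in> {\<Prod>v\<in>\<sigma>. pvar v | \<sigma>. \<sigma> \<subseteq> W \<and> \<sigma> \<notin> \<Delta>}"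
    using assms unfolding x_def by (intro CollectI exI[of _ "keys \<mu>"]) (simp add: prod_pvar)
  then have "x \<in> face_ideal \<Delta>"
    unfolding face_ideal_def by (rule subsetD[OF R.genideal_self[OF face_gens_carrier]])
  then have "face_class \<Delta> x = face_class \<Delta> 0" using fc_eq[OF xW polys_in_zero] by simp
  then have "x \<in> ann" using ann_zero xW by (simp add: ann_def)
  then have "Poly_Mapping.single \<nu> a * x \<in> ann"
    using \<open>keys \<nu> \<subseteq> W\<close> by (intro ann_mult polys_in_single)
  moreover have "Poly_Mapping.single \<nu> a * x = Poly_Mapping.single (\<nu> + ind (keys \<mu>)) a"
    by (simp add: x_def mult_single)
  ultimately show ?thesis using \<nu> by simp
qed

lemma face_ideal_N: "face_ideal \<Delta> \<subseteq> N"
  unfolding face_ideal_def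
proof (rule R.genideal_minimal[OF N_ideal], rule subsetI)
  fix x :: "('v, 'f) mpoly" assume "x \<in> {\<Prod>v\<in>\<sigma>. pvar v | \<sigma>. \<sigma> \<subseteq> W \<and> \<sigma> \<notin> \<Delta>}"
  then obtain \<sigma> where \<sigma>: "\<sigma> \<subseteq> W" "\<sigma> \<notin> \<Delta>" "x = (\<Prod>v\<in>\<sigma>. pvar v)" by blast
  have fin: "finite \<sigma>" using \<sigma>(1) fin_W by (rule finite_subset)
  have "f (\<mu> + ind \<sigma>) = 0" if f: "f \<in> E d \<Delta>" for f \<mu>
    by (rule E_keys'[OF f]) (use \<sigma>(2) down[of "keys (\<mu> + ind \<sigma>)" \<sigma>] fin in \<open>auto simp: keys_add_nat keys_ind\<close>)
  then show "x \<in> N"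
    using \<sigma> fin by (auto simp: N_def prod_pvar polys_in_single keys_ind fun_eq_iff)
qed

text \<open>\<Theta> is minimal among ideals of the face ring, so the image of \<open>N\<close> must
  be shown to be such an ideal. Since \<open>N\<close> contains the Stanley-Reisner ideal,
  membership in the image pulls back.\<close>

lemma ann_N: "ann \<subseteq> N"
proof -
  have "ideal (face_class \<Delta> ` N) FR"
  proof (rule idealI)
    show "ring FR" by (rule FR.ring_axioms)
    have NR: "N \<subseteq> carrier R" by (auto simp: N_def carrier_R)
    interpret N: ideal N R by (rule N_ideal)
    show "subgroup (face_class \<Delta> ` N) (add_monoid FR)"
    proof (rule FR.add.subgroupI)
      show "face_class \<Delta> ` N \<subseteq> carrier FR" using fc_closed by (auto simp: N_def)
      show "face_class \<Delta> ` N \<noteq> {}" using N.zero_closed by (simp only: image_is_empty) blast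
      show "\<ominus>\<^bsub>FR\<^esub> a \<in> face_class \<Delta> ` N" if "a \<in> face_class \<Delta> ` N" for a
      proof -
        from that obtain p where p: "p \<in> N" "a = face_class \<Delta> p" by (rule imageE)
        have "\<ominus>\<^bsub>FR\<^esub> a = face_class \<Delta> (\<ominus>\<^bsub>R\<^esub> p)" using fc.hom_a_inv[OF subsetD[OF NR p(1)]] p(2) by simp
        then show ?thesis using N.a_inv_closed[OF p(1)] by (simp only: imageI)
      qed
      show "a \<oplus>\<^bsub>FR\<^esub> b \<in> face_class \<Delta> ` N" if "a \<in> face_class \<Delta> ` N" "b \<in> face_class \<Delta> ` N" for a b
      proof -
        from that(1) obtain p where p: "p \<in> N" "a = face_class \<Delta> p" by (rule imageE)
        from that(2) obtain q where q: "q \<in> N" "b = face_class \<Delta> q" by (rule imageE)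
        have "a \<oplus>\<^bsub>FR\<^esub> b = face_class \<Delta> (p \<oplus>\<^bsub>R\<^esub> q)"
          using fc.hom_add[OF subsetD[OF NR p(1)] subsetD[OF NR q(1)]] p(2) q(2) by simp
        then show ?thesis using N.a_closed[OF p(1) q(1)] by (simp only: imageI)
      qed
    qed
    show "x \<otimes>\<^bsub>FR\<^esub> a \<in> face_class \<Delta> ` N" if "a \<in> face_class \<Delta> ` N" "x \<in> carrier FR" for a x
    proof -
      from that(1) obtain p where p: "p \<in> N" "a = face_class \<Delta> p" by (rule imageE)
      from FR_carrier[OF that(2)] obtain q where q: "q \<in> carrier R" "x = face_class \<Delta> q" unfolding carrier_R by (rule bexE)
      have "x \<otimes>\<^bsub>FR\<^esub> a = face_class \<Delta> (q \<otimes>\<^bsub>R\<^esub> p)"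
        using fc.hom_mult[OF q(1) subsetD[OF NR p(1)]] p(2) q(2) by simp
      then show ?thesis using N.I_l_closed[OF p(1) q(1)] by (simp only: imageI)
    qed
    show "a \<otimes>\<^bsub>FR\<^esub> x \<in> face_class \<Delta> ` N" if "a \<in> face_class \<Delta> ` N" "x \<in> carrier FR" for a x
    proof -
      from that(1) obtain p where p: "p \<in> N" "a = face_class \<Delta> p" by (rule imageE)
      from FR_carrier[OF that(2)] obtain q where q: "q \<in> carrier R" "x = face_class \<Delta> q" unfolding carrier_R by (rule bexE)
      have "a \<otimes>\<^bsub>FR\<^esub> x = face_class \<Delta> (p \<otimes>\<^bsub>R\<^esub> q)"
        using fc.hom_mult[OF subsetD[OF NR p(1)] q(1)] p(2) q(2) by simp
      then show ?thesis using N.I_r_closed[OF p(1) q(1)] by (simp only: imageI)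
    qed
  qed
  moreover have "(\<lambda>i. face_class \<Delta> (\<theta> i)) ` {..<rank_of \<Delta>} \<subseteq> face_class \<Delta> ` N"
  proof -
    have "\<theta> i \<in> N" if "i < d" for i
      using that theta_carrier[of i] by (auto simp: N_def \<theta>_def act_theta E_Th)
    then show ?thesis by (auto simp: rank)
  qed
  ultimately have JN: "J \<subseteq> face_class \<Delta> ` N" unfolding theta_ideal_def by (rule FR.genideal_minimal)
  show ?thesis
  proof
    fix p assume p: "p \<in> ann"
    then have "face_class \<Delta> p \<in> face_class \<Delta> ` N" using JN by (auto simp: ann_def)
    then obtain q where q: "q \<in> N" "face_class \<Delta> p = face_class \<Delta> q" by (elim imageE)
    have qp: "q \<in> polys_in W" "p \<in> polys_in W" using q p by (auto simp: N_def ann_def)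
    then have "p - q \<in> N" using fc_eq[of p q] q(2) by (intro subsetD[OF face_ideal_N]) simp
    then show "p \<in> N" using q(1) qp by (auto simp: N_def act_diff_left)
  qed
qed

text \<open>A functional that vanishes on \<open>ann\<close>, cut down to degree \<open>i\<close>,
  belongs to the dual: it vanishes on nonface monomials, which bounds its support, and on multiples
  of the one-forms, so the operators kill it.\<close>

lemma separate:
  assumes S: "mpoly_space.subspace S" "ann \<subseteq> S" and q: "q \<in> polys_in W" "hpoly i q" "q \<notin> S"
  obtains f where "f \<in> E d \<Delta>" "homog i f" "act q f 0 \<noteq> 0"
    "\<And>s. s \<in> S \<Longrightarrow> s \<in> polys_in W \<Longrightarrow> hpoly i s \<Longrightarrow> act s f 0 = 0"
proof -
  obtain \<Lambda> where add: "\<And>x y. \<Lambda> (x + y) = \<Lambda> x + \<Lambda> y" and scale: "\<And>a x. \<Lambda> (const_poly a * x) = a * \<Lambda> x"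
    and S0: "\<And>s. s \<in> S \<Longrightarrow> \<Lambda> s = 0" and q1: "\<Lambda> q = (1::'f)"
    by (rule separating_functional[OF S(1) q(3)]) blast
  have sum: "\<Lambda> (\<Sum>x\<in>A. g x) = (\<Sum>x\<in>A. \<Lambda> (g x))" for A and g :: "'z \<Rightarrow> ('v, 'f) mpoly"
  proof (induction A rule: infinite_finite_induct)
    case (insert x F)
    then show ?case by (simp add: add)
  qed (use scale[of 0] in \<open>simp_all add: const_poly_simps\<close>)
  have single: "\<Lambda> (Poly_Mapping.single \<nu> a) = a * \<Lambda> (Poly_Mapping.single \<nu> 1)" for \<nu> a
    using scale[of a "Poly_Mapping.single \<nu> 1"] by (simp add: const_poly_def mult_single)
  define f where "f \<nu> = (if mdeg \<nu> = i \<and> keys \<nu> \<subseteq> W then \<Lambda> (Poly_Mapping.single \<nu> 1) else 0)" for \<nu>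
  have ev: "act p f 0 = \<Lambda> p" if "p \<in> polys_in W" "hpoly i p" for p
  proof -
    have "\<Lambda> p = (\<Sum>\<nu>\<in>keys p. \<Lambda> (Poly_Mapping.single \<nu> (lookup p \<nu>)))"
      by (subst mpoly_sum_singles) (rule sum)
    also have "\<dots> = (\<Sum>\<nu>\<in>keys p. lookup p \<nu> * f \<nu>)"
      using that by (intro sum.cong refl) (simp add: single[of _ "lookup p _"] f_def polys_in_def hpoly_def)
    finally show ?thesis by (simp add: act_def)
  qed
  show ?thesis
  proof (rule that[of f])
    show "f \<in> E d \<Delta>"
    proof (rule E_I)
      fix \<mu> assume nz: "f \<mu> \<noteq> 0"
      then have k: "keys \<mu> \<subseteq> W" "\<Lambda> (Poly_Mapping.single \<mu> 1) \<noteq> 0" by (auto simp: f_def split: if_splits)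
      then show "keys \<mu> \<in> \<Delta>" using ann_nonface[OF k(1), of 1] S0[of "Poly_Mapping.single \<mu> 1"] S(2) by auto
    next
      fix k assume k: "k < d"
      show "Th k f = 0"
      proof
        fix \<mu>
        show "Th k f \<mu> = 0 \<mu>"
        proof (cases "Suc (mdeg \<mu>) = i \<and> keys \<mu> \<subseteq> W")
          case True
          have "Th k f \<mu> = (\<Sum>v\<in>W. c (k, v) * f (\<mu> + evar v))"
            unfolding Th_apply
            by (rule sum.mono_neutral_right) (use finite_V verts in \<open>auto simp: f_def keys_add_nat\<close>)
          also have "\<dots> = (\<Sum>v\<in>W. \<Lambda> (Poly_Mapping.single (\<mu> + evar v) (c (k, v))))"
            using True by (intro sum.cong refl) (simp add: f_def keys_add_nat single[of _ "c (k, _)"])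
          also have "\<dots> = \<Lambda> (Poly_Mapping.single \<mu> 1 * \<theta> k)"
            by (simp add: \<theta>_def linear_form_def const_poly_mult_pvar sum_distrib_left mult_single sum)
          also have "\<dots> = 0"
            using True k by (intro S0 subsetD[OF S(2)] ann_mult ann_theta polys_in_single) auto
          finally show ?thesis by simp
        next
          case False
          then have "\<not> (mdeg (\<mu> + evar v) = i \<and> keys (\<mu> + evar v) \<subseteq> W)" for v
            unfolding keys_add_nat mdeg_add mdeg_single by (metis Un_subset_iff add_Suc_right add_0_right)
          then have "f (\<mu> + evar v) = 0" for v unfolding f_def by (simp only: if_False)
          then show ?thesis by (simp add: Th_apply)
        qed
      qed
    qed
    show "homog i f" by (auto simp: homog_def f_def split: if_splits)
    show "act q f 0 \<noteq> 0" using ev[OF q(1,2)] q1 by simp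
    show "act s f 0 = 0" if "s \<in> S" "s \<in> polys_in W" "hpoly i s" for s
      using ev that S0 by simp
  qed
qed

text \<open>A form outside \<open>ann\<close> is detected by some element of the dual in its own
  degree, and every such element is a contraction of \<psi>.\<close>

lemma ann_iff:
  assumes p: "p \<in> polys_in W" "hpoly i p"
  shows "p \<in> ann \<longleftrightarrow> act p \<psi> = 0"
proof
  assume "p \<in> ann"
  then have "p \<in> N" using ann_N by blast
  then show "act p \<psi> = 0" using generatesD(1)[OF gen] unfolding N_def by blast
next
  assume p0: "act p \<psi> = 0"
  show "p \<in> ann"
  proof (rule ccontr)
    assume "p \<notin> ann"
    then obtain f where f: "f \<in> E d \<Delta>" "homog i f" "act p f 0 \<noteq> 0"
      using separate[OF ann_subspace order_refl p] by blast
    show False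
    proof (cases "i \<le> d")
      case True
      then obtain r where "f = act r \<psi>" using generatesD(4)[OF gen f(1,2)] by blast
      then have "act p f = 0" using p0 by (simp add: act_commute[of p r] flip: zero_fun_def)
      then show False using f(3) by simp
    next
      case False
      then have "f = 0" using generatesD(3)[OF gen f(1,2)] by simp
      then show False using f(3) by (simp flip: zero_fun_def)
    qed
  qed
qed

lemma ann_high:
  assumes "p \<in> polys_in W" "hpoly i p" "d < i"
  shows "p \<in> ann"
proof (rule ccontr)
  assume "p \<notin> ann"
  then obtain f where f: "f \<in> E d \<Delta>" "homog i f" "act p f 0 \<noteq> 0"
    using separate[OF ann_subspace order_refl assms(1,2)] by blast
  then have "f = 0" using generatesD(3)[OF gen f(1,2) assms(3)] by simp
  then show False using f(3) by (simp flip: zero_fun_def)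
qed

text \<open>The dual always contains the function that is 1 at the constant monomial and 0
  elsewhere.\<close>

lemma dual_nonzero: "\<psi> \<noteq> 0"
proof
  assume \<psi>0: "\<psi> = 0"
  define e :: "('v \<Rightarrow>\<^sub>0 nat) \<Rightarrow> 'f" where "e \<mu> = (if \<mu> = 0 then 1 else 0)" for \<mu>
  have he: "homog 0 e" by (auto simp: homog_def e_def)
  have "{} \<in> \<Delta>" using complex by (simp add: simplicial_complex_def)
  moreover have "Th k e = 0" for k by (rule Th_homog_0[OF he])
  ultimately have "e \<in> E d \<Delta>" by (intro E_I) (auto simp: e_def split: if_splits)
  then obtain p where "e = act p \<psi>" using generatesD(4)[OF gen _ he] by blast
  then have "e 0 = 0" by (simp only: \<psi>0 act_zero_right zero_fun_apply)
  then show False by (simp add: e_def)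
qed

text \<open>All monomials of degree above \<open>d\<close> lie in \<open>ann\<close>, so the
  finitely many others span the quotient.\<close>

lemma lsop_holds: "lsop \<Delta> \<theta>"
  unfolding lsop_def
proof
  show "\<forall>i<rank_of \<Delta>. \<theta> i \<in> homogeneous_part W 1"
    by (simp add: homogeneous_part_iff theta_carrier) (simp add: \<theta>_def)
  define K where "K = range (\<lambda>a. const_poly a :: ('v, 'f) mpoly)"
  have K0: "subfield K R"
  proof (rule R.subfieldI)
    have "subring K R"
    proof (rule R.subringI)
      show "\<one>\<^bsub>R\<^esub> \<in> K" by (auto simp: K_def R_ops const_poly_simps(3)[symmetric])
      show "\<ominus>\<^bsub>R\<^esub> h \<in> K" if "h \<in> K" for h
        using that by (auto simp: K_def R_uminus const_poly_simps(5)[symmetric])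
      show "x \<otimes>\<^bsub>R\<^esub> y \<in> K" "x \<oplus>\<^bsub>R\<^esub> y \<in> K" if "x \<in> K" "y \<in> K" for x y
        using that by (auto simp: K_def R_ops const_poly_simps(1,2)[symmetric])
    qed (auto simp: K_def carrier_R)
    then show "subcring K R" by (rule R.subcringI') 
    show "Units (R\<lparr>carrier := K\<rparr>) = K - {\<zero>\<^bsub>R\<^esub>}"
    proof (intro equalityI subsetI)
      fix x assume "x \<in> Units (R\<lparr>carrier := K\<rparr>)"
      then obtain y where "x \<in> K" "x * y = 1" by (auto simp: Units_def R_ops)
      then show "x \<in> K - {\<zero>\<^bsub>R\<^esub>}" by (auto simp: R_ops)
    next
      fix x assume x: "x \<in> K - {\<zero>\<^bsub>R\<^esub>}"
      then obtain a where a: "x = const_poly a" by (auto simp: K_def)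
      have a0: "a \<noteq> 0"
      proof
        assume "a = 0"
        then show False using x a by (simp add: R_ops const_poly_simps(4))
      qed
      have "const_poly (inverse a) * x = 1" "x * const_poly (inverse a) = 1"
        using a0 by (simp_all add: a const_poly_simps(3) flip: const_poly_simps(2))
      then show "x \<in> Units (R\<lparr>carrier := K\<rparr>)"
        using x by (auto simp: Units_def R_ops K_def)
    qed
  qed
  have "1 \<notin> ann"
  proof
    assume "1 \<in> ann"
    then have "1 \<in> N" using ann_N by blast
    then have "act 1 \<psi> = 0" using generatesD(1)[OF gen] unfolding N_def by blast
    then show False using dual_nonzero by (simp flip: zero_fun_def)
  qed
  then have "\<one>\<^bsub>AQ\<^esub> \<noteq> \<zero>\<^bsub>AQ\<^esub>"
    using cls_eq[of 1 0] cls.hom_one cls.hom_zero by (simp add: R_ops)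
  then have K: "subfield (cls ` K) AQ" by (rule cls.img_is_subfield(2)[OF K0])
  define M where "M = {\<nu> :: 'v \<Rightarrow>\<^sub>0 nat. keys \<nu> \<subseteq> W \<and> mdeg \<nu> \<le> d}"
  have "finite ((\<lambda>\<nu>. cls (Poly_Mapping.single \<nu> 1)) ` M)"
    unfolding M_def by (intro finite_imageI finite_monomials fin_W)
  then obtain Us where Us: "set Us = (\<lambda>\<nu>. cls (Poly_Mapping.single \<nu> 1)) ` M" using finite_list by blast
  have UsC: "set Us \<subseteq> carrier AQ"
    unfolding Us by (auto simp: M_def carrier_R polys_in_single intro!: cls.hom_closed)
  have mono: "cls (Poly_Mapping.single \<nu> a) \<in> AQ.Span (cls ` K) Us" if \<nu>: "keys \<nu> \<subseteq> W" for \<nu> a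
  proof (cases "mdeg \<nu> \<le> d")
    case True
    have "cls (Poly_Mapping.single \<nu> 1) \<in> AQ.Span (cls ` K) Us"
      using AQ.Span_base_incl[OF K UsC] Us True \<nu> by (auto simp: M_def)
    moreover have "cls (const_poly a) \<in> cls ` K" by (auto simp: K_def)
    ultimately have "cls (const_poly a) \<otimes>\<^bsub>AQ\<^esub> cls (Poly_Mapping.single \<nu> 1) \<in> AQ.Span (cls ` K) Us"
      using AQ.Span_smult_closed[OF K UsC] by blast
    moreover have "cls (const_poly a) \<otimes>\<^bsub>AQ\<^esub> cls (Poly_Mapping.single \<nu> 1) = cls (Poly_Mapping.single \<nu> a)"
      using cls.hom_mult[of "const_poly a" "Poly_Mapping.single \<nu> 1"] \<nu>
      by (simp add: carrier_R R_ops polys_in_single) (simp add: const_poly_def mult_single)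
    ultimately show ?thesis by simp
  next
    case False
    have "Poly_Mapping.single \<nu> a \<in> ann"
      by (rule ann_high[OF polys_in_single[OF \<nu>] hpoly_single]) (use False in simp)
    then have "cls (Poly_Mapping.single \<nu> a) = \<zero>\<^bsub>AQ\<^esub>"
      using cls_eq[of "Poly_Mapping.single \<nu> a" 0] cls.hom_zero \<nu> by (simp add: R_ops polys_in_single)
    then show ?thesis using AQ.Span_subgroup_props(2)[OF K UsC] by simp
  qed
  have sums: "cls (\<Sum>\<nu>\<in>S. Poly_Mapping.single \<nu> (a \<nu>)) \<in> AQ.Span (cls ` K) Us"
    if "finite S" "\<And>\<nu>. \<nu> \<in> S \<Longrightarrow> keys \<nu> \<subseteq> W" for S and a :: "('v \<Rightarrow>\<^sub>0 nat) \<Rightarrow> 'f"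
    using that
  proof (induction S rule: finite_induct)
    case empty
    then show ?case using AQ.Span_subgroup_props(2)[OF K UsC] cls.hom_zero by (simp add: R_ops)
  next
    case (insert \<nu> S)
    have "(\<Sum>\<nu>\<in>S. Poly_Mapping.single \<nu> (a \<nu>)) \<in> polys_in W"
      by (rule polys_in_sum, rule polys_in_single, rule insert.prems) simp
    then have "cls (\<Sum>\<nu>\<in>insert \<nu> S. Poly_Mapping.single \<nu> (a \<nu>))
       = cls (Poly_Mapping.single \<nu> (a \<nu>)) \<oplus>\<^bsub>AQ\<^esub> cls (\<Sum>\<nu>\<in>S. Poly_Mapping.single \<nu> (a \<nu>))"
      using cls.hom_add[of "Poly_Mapping.single \<nu> (a \<nu>)" "\<Sum>\<nu>\<in>S. Poly_Mapping.single \<nu> (a \<nu>)"]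
        insert.hyps insert.prems[of \<nu>]
      by (simp add: carrier_R R_ops polys_in_single)
    moreover have "cls (Poly_Mapping.single \<nu> (a \<nu>)) \<in> AQ.Span (cls ` K) Us"
      by (rule mono, rule insert.prems) simp
    moreover have "cls (\<Sum>\<nu>\<in>S. Poly_Mapping.single \<nu> (a \<nu>)) \<in> AQ.Span (cls ` K) Us"
      by (rule insert.IH, rule insert.prems) simp
    ultimately show ?case
      using AQ.Span_subgroup_props(3)[OF K UsC] by (simp only:)
  qed
  have "carrier AQ \<subseteq> AQ.Span (cls ` K) Us"
  proof
    fix x assume "x \<in> carrier AQ"
    then obtain p where p: "p \<in> polys_in W" "x = cls p" using AQ_carrier by blast
    have "cls (\<Sum>\<nu>\<in>keys p. Poly_Mapping.single \<nu> (lookup p \<nu>)) \<in> AQ.Span (cls ` K) Us"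
      by (rule sums) (use p in \<open>auto simp: polys_in_def\<close>)
    then show "x \<in> AQ.Span (cls ` K) Us" using p(2) mpoly_sum_singles[of p] by simp
  qed
  then have "AQ.Span (cls ` K) Us = carrier AQ"
    using AQ.Span_subgroup_props(1)[OF K UsC] by blast
  then have "AQ.finite_dimension (cls ` K) (carrier AQ)"
    using AQ.Span_finite_dimension[OF K UsC] by simp
  moreover have "cls ` K = range (\<lambda>a. cls (const_poly a))" by (auto simp: K_def)
  ultimately show "AQ.finite_dimension (range (\<lambda>a. cls (const_poly a))) (carrier AQ)" by simp
qed

section \<open>The weak Lefschetz property in terms of the dual generator\<close>

definition \<omega> :: "('v, 'f) mpoly" where "\<omega> = linear_form W (\<lambda>v. c (d, v))"

lemma omega: "\<omega> \<in> polys_in W" "hpoly (Suc 0) \<omega>"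
  by (simp_all add: \<omega>_def polys_in_linear_form)

lemma comp_iff: "x \<in> artinian_component \<Delta> \<theta> i \<longleftrightarrow> (\<exists>p. p \<in> polys_in W \<and> hpoly i p \<and> x = cls p)"
  by (auto simp: artinian_component_def homogeneous_part_iff image_iff)

lemma omega_cls: "p \<in> polys_in W \<Longrightarrow> cls \<omega> \<otimes>\<^bsub>AQ\<^esub> cls p = cls (\<omega> * p)"
  using cls.hom_mult[of \<omega> p] omega by (simp add: carrier_R R_ops)

lemma hpoly_omega: "hpoly i p \<Longrightarrow> hpoly (Suc i) (\<omega> * p)"
  using hpoly_mult[OF omega(2), of i p] by simp

lemma inj_iff:
  "inj_on (\<lambda>x. cls \<omega> \<otimes>\<^bsub>AQ\<^esub> x) (artinian_component \<Delta> \<theta> i) \<longleftrightarrow>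
     (\<forall>p. p \<in> polys_in W \<longrightarrow> hpoly i p \<longrightarrow> \<omega> * p \<in> ann \<longrightarrow> p \<in> ann)" (is "?L \<longleftrightarrow> ?R")
proof
  assume L: ?L
  show ?R
  proof (intro allI impI)
    fix p assume p: "p \<in> polys_in W" "hpoly i p" "\<omega> * p \<in> ann"
    have "cls (\<omega> * p) = cls (\<omega> * 0)"
      using p omega by (subst cls_eq) (auto simp: polys_in_mult)
    then have "cls \<omega> \<otimes>\<^bsub>AQ\<^esub> cls p = cls \<omega> \<otimes>\<^bsub>AQ\<^esub> cls 0" using p by (simp only: omega_cls polys_in_zero)
    moreover have "cls p \<in> artinian_component \<Delta> \<theta> i" "cls 0 \<in> artinian_component \<Delta> \<theta> i"
      unfolding comp_iff using p by (metis, metis polys_in_zero hpoly_zero)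
    ultimately have "cls p = cls 0" using L by (auto dest: inj_onD)
    then show "p \<in> ann" using cls_eq[of p 0] p by simp
  qed
next
  assume R: ?R
  show ?L
  proof (rule inj_onI)
    fix x y assume "x \<in> artinian_component \<Delta> \<theta> i" "y \<in> artinian_component \<Delta> \<theta> i" and eq: "cls \<omega> \<otimes>\<^bsub>AQ\<^esub> x = cls \<omega> \<otimes>\<^bsub>AQ\<^esub> y"
    then obtain p q where p: "p \<in> polys_in W" "hpoly i p" "x = cls p" and q: "q \<in> polys_in W" "hpoly i q" "y = cls q"
      unfolding comp_iff by blast
    have "cls (\<omega> * p) = cls (\<omega> * q)" using eq p q by (simp add: omega_cls)
    then have "\<omega> * (p - q) \<in> ann"
      using cls_eq[of "\<omega> * p" "\<omega> * q"] p q omega by (simp add: polys_in_mult right_diff_distrib)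
    then have "p - q \<in> ann" using R p q polys_in_diff hpoly_diff by blast
    then show "x = y" using cls_eq p q by blast
  qed
qed

lemma surj_iff:
  "(\<lambda>x. cls \<omega> \<otimes>\<^bsub>AQ\<^esub> x) ` artinian_component \<Delta> \<theta> i = artinian_component \<Delta> \<theta> (Suc i) \<longleftrightarrow>
     (\<forall>q :: ('v, 'f) mpoly. q \<in> polys_in W \<longrightarrow> hpoly (Suc i) q \<longrightarrow> (\<exists>p. p \<in> polys_in W \<and> hpoly i p \<and> q - \<omega> * p \<in> ann))" (is "?L \<longleftrightarrow> ?R")
proof
  assume L: ?L
  show ?R
  proof (intro allI impI)
    fix q :: "('v, 'f) mpoly" assume q: "q \<in> polys_in W" "hpoly (Suc i) q"
    then have "cls q \<in> artinian_component \<Delta> \<theta> (Suc i)" unfolding comp_iff by blast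
    then obtain x where "x \<in> artinian_component \<Delta> \<theta> i" "cls q = cls \<omega> \<otimes>\<^bsub>AQ\<^esub> x" using L by blast
    then obtain p where p: "p \<in> polys_in W" "hpoly i p" "cls q = cls (\<omega> * p)" unfolding comp_iff using omega_cls by blast
    then show "\<exists>p. p \<in> polys_in W \<and> hpoly i p \<and> q - \<omega> * p \<in> ann"
      using cls_eq[of q "\<omega> * p"] q omega polys_in_mult by blast
  qed
next
  assume R: ?R
  show ?L
  proof (intro equalityI subsetI)
    fix y assume "y \<in> (\<lambda>x. cls \<omega> \<otimes>\<^bsub>AQ\<^esub> x) ` artinian_component \<Delta> \<theta> i"
    then obtain x where x: "x \<in> artinian_component \<Delta> \<theta> i" "y = cls \<omega> \<otimes>\<^bsub>AQ\<^esub> x" by blast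
    then obtain p where "p \<in> polys_in W" "hpoly i p" "y = cls (\<omega> * p)" unfolding comp_iff using omega_cls by blast
    then show "y \<in> artinian_component \<Delta> \<theta> (Suc i)"
      unfolding comp_iff using hpoly_omega polys_in_mult[OF omega(1)] by blast
  next
    fix y assume "y \<in> artinian_component \<Delta> \<theta> (Suc i)"
    then obtain q where q: "q \<in> polys_in W" "hpoly (Suc i) q" "y = cls q" unfolding comp_iff by blast
    then obtain p where p: "p \<in> polys_in W" "hpoly i p" "q - \<omega> * p \<in> ann" using R by blast
    then have "y = cls \<omega> \<otimes>\<^bsub>AQ\<^esub> cls p"
      using cls_eq[OF q(1) polys_in_mult[OF omega(1) p(1)]] q(3) omega_cls[OF p(1)] by simp
    moreover have "cls p \<in> artinian_component \<Delta> \<theta> i" unfolding comp_iff using p by blast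
    ultimately show "y \<in> (\<lambda>x. cls \<omega> \<otimes>\<^bsub>AQ\<^esub> x) ` artinian_component \<Delta> \<theta> i" by blast
  qed
qed

text \<open>Monomials with a variable outside the vertex set annihilate the dual. Dropping them
  reconciles \<open>mid_injective\<close>, which ranges over all polynomials, with the ring on
  \<open>W\<close>.\<close>

lemma act_truncate:
  assumes "hpoly i p"
  obtains p' where "p' \<in> polys_in W" "hpoly i p'" "\<And>f. f \<in> E d \<Delta> \<Longrightarrow> act p' f = act p f"
proof
  define p' where "p' = (\<Sum>\<nu>\<in>{\<nu> \<in> keys p. keys \<nu> \<subseteq> W}. Poly_Mapping.single \<nu> (lookup p \<nu>))"
  show "p' \<in> polys_in W" unfolding p'_def by (rule polys_in_sum) (auto intro: polys_in_single)
  show "hpoly i p'" unfolding p'_def by (rule hpoly_sum) (use assms in \<open>auto simp: hpoly_def\<close>)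
  show "act p' f = act p f" if f: "f \<in> E d \<Delta>" for f
  proof
    fix \<mu>
    have "f (\<mu> + \<nu>) = 0" if "\<not> keys \<nu> \<subseteq> W" for \<nu>
      by (rule E_keys'[OF f]) (use that in \<open>auto simp: keys_add_nat\<close>)
    then have "(\<Sum>\<nu>\<in>keys p. lookup p \<nu> * f (\<mu> + \<nu>)) = (\<Sum>\<nu>\<in>{\<nu> \<in> keys p. keys \<nu> \<subseteq> W}. lookup p \<nu> * f (\<mu> + \<nu>))"
      by (intro sum.mono_neutral_right) auto
    then show "act p' f \<mu> = act p f \<mu>"
      unfolding p'_def act_sum_left sum_fun_apply by (simp add: act_def[of p])
  qed
qed

lemma E_act_\<psi>: "act p \<psi> \<in> E d \<Delta>"
  by (rule E_act[OF generatesD(1)[OF gen]]) (rule down)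

lemma homog_act_\<psi>: "hpoly i p \<Longrightarrow> i \<le> d \<Longrightarrow> homog (d - i) (act p \<psi>)"
  by (rule homog_act) (use generatesD(2)[OF gen] in auto)

lemma mid_injective_iff:
  "mid_injective (linear_form V (\<lambda>v. c (d, v))) m \<psi> \<longleftrightarrow>
     (\<forall>p. p \<in> polys_in W \<longrightarrow> hpoly m p \<longrightarrow> act (\<omega> * p) \<psi> = 0 \<longrightarrow> act p \<psi> = 0)" (is "?L \<longleftrightarrow> ?R")
proof -
  have om: "act (linear_form V (\<lambda>v. c (d, v)) * p) \<psi> = act p (Th d \<psi>)" "act (\<omega> * p) \<psi> = act p (Th d \<psi>)" for p
    using act_theta[OF generatesD(1)[OF gen], of d]
    by (simp_all only: act_mult \<omega>_def act_commute[of _ p] Th_def[symmetric])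
  have TE: "Th d \<psi> \<in> E d \<Delta>" unfolding Th_def by (rule E_act_\<psi>)
  show ?thesis
  proof
    assume ?L
    then show ?R unfolding mid_injective_def om by blast
  next
    assume R: ?R
    show ?L
      unfolding mid_injective_def om
    proof (intro allI impI)
      fix p assume p: "hpoly m p" "act p (Th d \<psi>) = 0"
      obtain p' where p': "p' \<in> polys_in W" "hpoly m p'" "\<And>f. f \<in> E d \<Delta> \<Longrightarrow> act p' f = act p f"
        using act_truncate[OF p(1)] by blast
      have "act (\<omega> * p') \<psi> = 0" unfolding om p'(3)[OF TE] by (rule p(2))
      then have "act p' \<psi> = 0" using R p'(1,2) by blast
      then show "act p \<psi> = 0" using p'(3)[OF generatesD(1)[OF gen]] by simp
    qed
  qed
qed

context
  fixes m :: nat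
  assumes d: "d = 2 * m + 1"
    and mid: "\<And>p. p \<in> polys_in W \<Longrightarrow> hpoly m p \<Longrightarrow> act (\<omega> * p) \<psi> = 0 \<Longrightarrow> act p \<psi> = 0"
begin

text \<open>A nonzero p \<psi> has a nonzero value at a monomial of degree d - i, so some factor of
  degree m - i keeps the product with \<open>p\<close> outside \<open>ann\<close>. Multiplying by
  this factor commutes with \<omega>.\<close>

lemma inj_low:
  assumes i: "i \<le> m" and p: "p \<in> polys_in W" "hpoly i p" "\<omega> * p \<in> ann"
  shows "p \<in> ann"
proof (rule ccontr)
  assume "p \<notin> ann"
  then have "act p \<psi> \<noteq> 0" using ann_iff p by blast
  then obtain \<mu> where \<mu>: "act p \<psi> \<mu> \<noteq> 0" by (auto simp: fun_eq_iff)
  have "mdeg \<mu> = d - i" using homog_act_\<psi>[OF p(2)] \<mu> i d by (auto simp: homog_def)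
  then have "m - i \<le> mdeg \<mu>" using d by simp
  then obtain \<nu> \<rho> where \<nu>: "\<mu> = \<nu> + \<rho>" "mdeg \<nu> = m - i" by (rule mdeg_split)
  have "keys \<mu> \<in> \<Delta>" by (rule E_keys[OF E_act_\<psi> \<mu>])
  then have kW: "keys \<nu> \<subseteq> W" using \<nu>(1) by (auto simp: keys_add_nat)
  define x where "x = Poly_Mapping.single \<nu> (1::'f)"
  have x: "x \<in> polys_in W" "hpoly (m - i) x"
    using polys_in_single[OF kW] hpoly_single[of \<nu> "1::'f"] \<nu>(2) by (simp_all add: x_def)
  have "act (\<omega> * p) \<psi> = 0"
    using ann_iff[OF polys_in_mult[OF omega(1) p(1)] hpoly_omega[OF p(2)]] p(3) by blast
  then have "act (\<omega> * (x * p)) \<psi> = 0"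
    by (simp only: mult.left_commute[of \<omega>] act_mult[of x] act_zero_right)
  moreover have "hpoly m (x * p)" using hpoly_mult[OF x(2) p(2)] i by simp
  ultimately have "act (x * p) \<psi> = 0" using mid polys_in_mult[OF x(1) p(1)] by blast
  then have "act x (act p \<psi>) \<rho> = 0" by (simp only: act_mult zero_fun_apply)
  then show False using \<mu> \<nu>(1) by (simp add: x_def add.commute)
qed

text \<open>A failure of surjectivity gives a nonzero functional of degree m + 1 that vanishes on
  multiples of \<omega>. As d = 2 m + 1, it equals r \<psi> with r of degree m, and the vanishing
  says \<omega> r \<psi> = 0, against the middle condition.\<close>

lemma surj_mid:
  assumes q: "q \<in> polys_in W" "hpoly (Suc m) q"
  shows "\<exists>p. p \<in> polys_in W \<and> hpoly m p \<and> q - \<omega> * p \<in> ann"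
proof (rule ccontr)
  assume no: "\<not> ?thesis"
  define S where "S = {x. \<exists>p. p \<in> polys_in W \<and> hpoly m p \<and> x - \<omega> * p \<in> ann}"
  have "mpoly_space.subspace S"
    unfolding mpoly_space.subspace_def
  proof (intro conjI ballI allI)
    show "0 \<in> S" unfolding S_def by (rule CollectI, rule exI[of _ 0]) (simp add: ann_zero)
    show "x + y \<in> S" if xy: "x \<in> S" "y \<in> S" for x y
    proof -
      obtain p p' where p: "p \<in> polys_in W" "hpoly m p" "x - \<omega> * p \<in> ann"
        and p': "p' \<in> polys_in W" "hpoly m p'" "y - \<omega> * p' \<in> ann" using xy unfolding S_def by blast
      have eq: "(x + y) - \<omega> * (p + p') = (x - \<omega> * p) + (y - \<omega> * p')" by (simp add: distrib_left)
      have "(x + y) - \<omega> * (p + p') \<in> ann" unfolding eq by (rule ann_add[OF p(3) p'(3)])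
      then show ?thesis using polys_in_add[OF p(1) p'(1)] hpoly_add[OF p(2) p'(2)] unfolding S_def by blast
    qed
    show "mpoly_scale a x \<in> S" if x: "x \<in> S" for a x
    proof -
      obtain p where p: "p \<in> polys_in W" "hpoly m p" "x - \<omega> * p \<in> ann" using x unfolding S_def by blast
      have eq: "const_poly a * x - \<omega> * (const_poly a * p) = const_poly a * (x - \<omega> * p)"
        by (simp add: right_diff_distrib mult.left_commute)
      have "const_poly a * x - \<omega> * (const_poly a * p) \<in> ann" unfolding eq by (rule ann_mult[OF polys_in_const p(3)])
      then show ?thesis
        using polys_in_mult[OF polys_in_const p(1), of a] hpoly_const_mult[OF p(2), of a] unfolding S_def mpoly_scale_def by blast
    qed
  qed
  moreover have "ann \<subseteq> S" unfolding S_def by (rule subsetI, rule CollectI, rule exI[of _ 0]) simp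
  moreover have "q \<notin> S" using no by (simp add: S_def)
  ultimately obtain f where f: "f \<in> E d \<Delta>" "homog (Suc m) f" "act q f 0 \<noteq> 0"
    "\<And>s. s \<in> S \<Longrightarrow> s \<in> polys_in W \<Longrightarrow> hpoly (Suc m) s \<Longrightarrow> act s f 0 = 0"
    by (rule separate[OF _ _ q]) blast
  have "Suc m \<le> d" "d - Suc m = m" using d by auto
  then obtain r0 where r0: "hpoly m r0" "f = act r0 \<psi>" using generatesD(4)[OF gen f(1,2)] by auto
  obtain r where r: "r \<in> polys_in W" "hpoly m r" "act r \<psi> = f"
    using act_truncate[OF r0(1)] r0(2) generatesD(1)[OF gen] by metis
  have "act (\<omega> * r) \<psi> \<mu> = 0" for \<mu>
  proof (rule ccontr)
    assume nz: "act (\<omega> * r) \<psi> \<mu> \<noteq> 0"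
    have "mdeg \<mu> = m"
      using homog_act_\<psi>[OF hpoly_omega[OF r(2)]] nz \<open>Suc m \<le> d\<close> \<open>d - Suc m = m\<close> by (auto simp: homog_def)
    moreover have "keys \<mu> \<in> \<Delta>" by (rule E_keys[OF E_act_\<psi> nz])
    then have kW: "keys \<mu> \<subseteq> W" by blast
    define x where "x = Poly_Mapping.single \<mu> (1::'f)"
    ultimately have x: "x \<in> polys_in W" "hpoly m x"
      using polys_in_single[OF kW] hpoly_single[of \<mu> "1::'f"] by (simp_all add: x_def)
    have "\<omega> * x \<in> S" using x ann_zero unfolding S_def by (intro CollectI exI[of _ x]) simp
    then have "act (\<omega> * x) f 0 = 0" using f(4) x polys_in_mult[OF omega(1)] hpoly_omega by blast
    moreover have "act (\<omega> * x) f = act x (act (\<omega> * r) \<psi>)"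
      unfolding r(3)[symmetric] act_mult[symmetric] by (simp add: ac_simps)
    ultimately show False using nz by (simp add: x_def)
  qed
  then have "act (\<omega> * r) \<psi> = 0" by (simp add: fun_eq_iff)
  then have "f = 0" using mid r by blast
  then have "act q f 0 = 0" by (simp only: act_zero_right zero_fun_apply)
  then show False using f(3) by blast
qed

text \<open>The ring is generated in degree 1: split off from each monomial a factor of degree m + 1
  and lift that factor.\<close>

lemma surj_high:
  assumes i: "m \<le> i" and q: "q \<in> polys_in W" "hpoly (Suc i) q"
  shows "\<exists>p. p \<in> polys_in W \<and> hpoly i p \<and> q - \<omega> * p \<in> ann"
proof -
  have "\<exists>p. p \<in> polys_in W \<and> hpoly i p \<and> Poly_Mapping.single \<nu> (lookup q \<nu>) - \<omega> * p \<in> ann" if \<nu>: "\<nu> \<in> keys q" for \<nu>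
  proof -
    have k: "keys \<nu> \<subseteq> W" "mdeg \<nu> = Suc i" using q \<nu> by (auto simp: polys_in_def hpoly_def)
    then have "Suc m \<le> mdeg \<nu>" using i by simp
    then obtain \<nu>1 \<nu>2 where \<nu>12: "\<nu> = \<nu>1 + \<nu>2" "mdeg \<nu>1 = Suc m" by (rule mdeg_split)
    have kk: "keys \<nu>1 \<subseteq> W" "keys \<nu>2 \<subseteq> W" using k \<nu>12 by (auto simp: keys_add_nat)
    have d2: "mdeg \<nu>2 + m = i" using k \<nu>12 by simp
    have "hpoly (Suc m) (Poly_Mapping.single \<nu>1 (1::'f))" using hpoly_single[of \<nu>1 "1::'f"] \<nu>12(2) by simp
    then obtain p where p: "p \<in> polys_in W" "hpoly m p" "Poly_Mapping.single \<nu>1 1 - \<omega> * p \<in> ann"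
      using surj_mid[OF polys_in_single[OF kk(1)]] by blast
    define x where "x = Poly_Mapping.single \<nu>2 (lookup q \<nu>)"
    have x: "x \<in> polys_in W" "hpoly (mdeg \<nu>2) x" using kk by (auto simp: x_def polys_in_single)
    have "Poly_Mapping.single \<nu> (lookup q \<nu>) - \<omega> * (x * p) = x * (Poly_Mapping.single \<nu>1 1 - \<omega> * p)"
      by (simp add: right_diff_distrib x_def \<nu>12(1) mult_single ac_simps)
    then have "Poly_Mapping.single \<nu> (lookup q \<nu>) - \<omega> * (x * p) \<in> ann" using ann_mult[OF x(1) p(3)] by simp
    moreover have "hpoly i (x * p)" using hpoly_mult[OF x(2) p(2)] d2 by simp
    ultimately show ?thesis using polys_in_mult[OF x(1) p(1)] by blast
  qed
  then obtain P where P: "\<And>\<nu>. \<nu> \<in> keys q \<Longrightarrow> P \<nu> \<in> polys_in W" "\<And>\<nu>. \<nu> \<in> keys q \<Longrightarrow> hpoly i (P \<nu>)"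
    "\<And>\<nu>. \<nu> \<in> keys q \<Longrightarrow> Poly_Mapping.single \<nu> (lookup q \<nu>) - \<omega> * P \<nu> \<in> ann" by metis
  define p where "p = (\<Sum>\<nu>\<in>keys q. P \<nu>)"
  have "(\<Sum>\<nu>\<in>keys q. Poly_Mapping.single \<nu> (lookup q \<nu>)) - \<omega> * p = (\<Sum>\<nu>\<in>keys q. Poly_Mapping.single \<nu> (lookup q \<nu>) - \<omega> * P \<nu>)"
    by (simp add: p_def sum_subtractf sum_distrib_left)
  also have "\<dots> \<in> ann" by (rule mpoly_space.subspace_sum[OF ann_subspace]) (rule P(3))
  finally have "q - \<omega> * p \<in> ann" by (simp only: mpoly_sum_singles[of q, symmetric])
  moreover have "p \<in> polys_in W" "hpoly i p" unfolding p_def by (intro polys_in_sum hpoly_sum P; assumption)+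
  ultimately show ?thesis by blast
qed

end

text \<open>Degrees m and m + 1 are complementary, so \<omega> between them is self-adjoint for the
  pairing given by \<psi>. Surjectivity there implies injectivity, and either alternative of the
  definition yields the middle condition.\<close>

theorem weak_lefschetz_iff:
  assumes d: "d = 2 * m + 1"
  shows "weak_lefschetz_element \<Delta> \<theta> \<omega> \<longleftrightarrow> mid_injective (linear_form V (\<lambda>v. c (d, v))) m \<psi>"
proof -
  have wl: "weak_lefschetz_element \<Delta> \<theta> \<omega> \<longleftrightarrow>
    (\<forall>i<d. (\<forall>p. p \<in> polys_in W \<longrightarrow> hpoly i p \<longrightarrow> \<omega> * p \<in> ann \<longrightarrow> p \<in> ann) \<or>
      (\<forall>q. q \<in> polys_in W \<longrightarrow> hpoly (Suc i) q \<longrightarrow> (\<exists>p. p \<in> polys_in W \<and> hpoly i p \<and> q - \<omega> * p \<in> ann)))"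
    unfolding weak_lefschetz_element_def Let_def inj_iff surj_iff rank
    using omega by (simp add: homogeneous_part_iff)
  show ?thesis
    unfolding mid_injective_iff
  proof
    assume "weak_lefschetz_element \<Delta> \<theta> \<omega>"
    moreover have "m < d" using d by simp
    ultimately have alt: "(\<forall>p. p \<in> polys_in W \<longrightarrow> hpoly m p \<longrightarrow> \<omega> * p \<in> ann \<longrightarrow> p \<in> ann) \<or>
      (\<forall>q. q \<in> polys_in W \<longrightarrow> hpoly (Suc m) q \<longrightarrow> (\<exists>p. p \<in> polys_in W \<and> hpoly m p \<and> q - \<omega> * p \<in> ann))"
      unfolding wl by blast
    show "\<forall>p. p \<in> polys_in W \<longrightarrow> hpoly m p \<longrightarrow> act (\<omega> * p) \<psi> = 0 \<longrightarrow> act p \<psi> = 0"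
    proof (intro allI impI)
      fix p assume p: "p \<in> polys_in W" "hpoly m p" "act (\<omega> * p) \<psi> = 0"
      show "act p \<psi> = 0"
        using alt
      proof
        assume "\<forall>p. p \<in> polys_in W \<longrightarrow> hpoly m p \<longrightarrow> \<omega> * p \<in> ann \<longrightarrow> p \<in> ann"
        moreover have "\<omega> * p \<in> ann"
          using ann_iff[OF polys_in_mult[OF omega(1) p(1)] hpoly_omega[OF p(2)]] p(3) by blast
        ultimately show ?thesis using ann_iff p by blast
      next
        assume surj: "\<forall>q. q \<in> polys_in W \<longrightarrow> hpoly (Suc m) q \<longrightarrow> (\<exists>p. p \<in> polys_in W \<and> hpoly m p \<and> q - \<omega> * p \<in> ann)"
        show ?thesis
        proof (rule ccontr)
          assume "act p \<psi> \<noteq> 0"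
          then obtain \<mu> where \<mu>: "act p \<psi> \<mu> \<noteq> 0" by (auto simp: fun_eq_iff)
          have "mdeg \<mu> = d - m" using homog_act_\<psi>[OF p(2)] \<mu> d by (auto simp: homog_def)
          then have deg: "mdeg \<mu> = Suc m" using d by simp
          have "keys \<mu> \<in> \<Delta>" by (rule E_keys[OF E_act_\<psi> \<mu>])
          then have kW: "keys \<mu> \<subseteq> W" by blast
          define x where "x = Poly_Mapping.single \<mu> (1::'f)"
          have x: "x \<in> polys_in W" "hpoly (Suc m) x"
            using polys_in_single[OF kW] hpoly_single[of \<mu> "1::'f"] deg by (simp_all add: x_def)
          obtain r where r: "r \<in> polys_in W" "hpoly m r" "x - \<omega> * r \<in> ann" using surj x by blast
          have "hpoly (Suc m) (x - \<omega> * r)" by (intro hpoly_diff x hpoly_omega r)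
          then have "act (x - \<omega> * r) \<psi> = 0" using ann_iff[of "x - \<omega> * r"] r(3) ann_polys by blast
          then have xr: "act x \<psi> = act (\<omega> * r) \<psi>" by (simp only: act_diff_left right_minus_eq)
          \<comment> \<open>\<open>x\<close> may be replaced by \<omega> r, and the factor \<omega>
            then moves over to \<open>p\<close>.\<close>
          have "act x (act p \<psi>) = act p (act (\<omega> * r) \<psi>)" by (simp only: act_commute[of x p] xr)
          also have "\<dots> = act r (act (\<omega> * p) \<psi>)" unfolding act_mult[symmetric] by (simp add: ac_simps)
          also have "\<dots> = 0" by (simp only: p(3) act_zero_right)
          finally have "act x (act p \<psi>) 0 = 0" by (simp only: zero_fun_apply)
          then show False using \<mu> by (simp add: x_def)
        qed
      qed
    qed
  next
    assume mid: "\<forall>p. p \<in> polys_in W \<longrightarrow> hpoly m p \<longrightarrow> act (\<omega> * p) \<psi> = 0 \<longrightarrow> act p \<psi> = 0"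
    show "weak_lefschetz_element \<Delta> \<theta> \<omega>"
      unfolding wl
    proof (intro allI impI)
      fix i assume "i < d"
      show "(\<forall>p. p \<in> polys_in W \<longrightarrow> hpoly i p \<longrightarrow> \<omega> * p \<in> ann \<longrightarrow> p \<in> ann) \<or>
      (\<forall>q. q \<in> polys_in W \<longrightarrow> hpoly (Suc i) q \<longrightarrow> (\<exists>p. p \<in> polys_in W \<and> hpoly i p \<and> q - \<omega> * p \<in> ann))"
      proof (cases "i \<le> m")
        case True
        then show ?thesis using inj_low[OF d] mid by blast
      next
        case False
        then show ?thesis using surj_high[OF d, of i] mid by simp
      qed
    qed
  qed
qed

end

section \<open>Generic coefficients\<close>

lemma poly_value_power: "poly_value (p ^ n) k = poly_value p k ^ n"
  by (induction n) (simp_all add: poly_value_mult poly_value_act[of 1])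

lemma poly_value_of_msub: "poly_value (msub \<gamma> \<nu>) k = msub (\<lambda>x. poly_value (\<gamma> x) k) \<nu>"
  by (simp add: msub_def poly_value_prod poly_value_power)

lemma msub_times: "msub (\<lambda>x. a x * b x) \<nu> = msub a \<nu> * msub b \<nu>"
  by (simp add: msub_def power_mult_distrib prod.distrib)

lemma polys_in_power: "p \<in> polys_in X \<Longrightarrow> p ^ n \<in> polys_in X"
  by (induction n) (auto intro: polys_in_mult)

lemma polys_in_prod: "(\<And>i. i \<in> I \<Longrightarrow> p i \<in> polys_in X) \<Longrightarrow> prod p I \<in> polys_in X"
  by (induction I rule: infinite_finite_induct) (auto intro: polys_in_mult)

lemma polys_in_msub: "(\<And>x. \<gamma> x \<in> polys_in X) \<Longrightarrow> msub \<gamma> \<nu> \<in> polys_in X"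
  unfolding msub_def by (intro polys_in_prod polys_in_power)

lemma poly_value_cong:
  assumes "g \<in> polys_in X" "\<And>x. x \<in> X \<Longrightarrow> c x = c' x"
  shows "poly_value g c = poly_value g c'"
proof -
  have "x \<in> X" if "\<nu> \<in> Poly_Mapping.keys g" "x \<in> Poly_Mapping.keys \<nu>" for \<nu> x
    using assms(1) that unfolding polys_in_def by blast
  then show ?thesis
    unfolding poly_value_def
    by (intro sum.cong refl arg_cong[of _ _ "\<lambda>z. _ * z"] prod.cong) (simp add: assms(2))
qed

text \<open>Validity on a nonempty principal open set, with coordinates ranging over the whole index
  type. Conditions that involve different coordinates can then be combined directly.\<close>

definition generic :: "(('x \<Rightarrow> 'f::field) \<Rightarrow> bool) \<Rightarrow> bool" where
  "generic P \<longleftrightarrow> (\<exists>g. (\<exists>c. poly_value g c \<noteq> 0) \<and> (\<forall>c. poly_value g c \<noteq> 0 \<longrightarrow> P c))"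

lemma generic_mono: "generic P \<Longrightarrow> (\<And>c. P c \<Longrightarrow> Q c) \<Longrightarrow> generic Q"
  unfolding generic_def by blast

lemma generic_True: "generic (\<lambda>_. True)"
  unfolding generic_def by (rule exI[of _ 1]) (simp add: poly_value_act)

text \<open>Two nonzero polynomials are nonzero at a common point: restrict both to the line through
  points where they do not vanish.\<close>

lemma generic_conj:
  fixes P Q :: "('x \<Rightarrow> 'f::field) \<Rightarrow> bool"
  assumes inf: "infinite (UNIV :: 'f set)" and "generic P" "generic Q"
  shows "generic (\<lambda>c. P c \<and> Q c)"
proof -
  obtain g a where g: "poly_value g a \<noteq> 0" "\<And>c. poly_value g c \<noteq> 0 \<Longrightarrow> P c"
    using assms(2) unfolding generic_def by blast
  obtain h b where h: "poly_value h b \<noteq> 0" "\<And>c. poly_value h c \<noteq> 0 \<Longrightarrow> Q c"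
    using assms(3) unfolding generic_def by blast
  define l where "l x = [:a x, b x - a x:]" for x
  define line where "line t x = poly (l x) t" for t x
  have on_line: "\<exists>G. \<forall>t. poly G t = poly_value q (line t)" for q :: "('x, 'f) mpoly"
  proof -
    have "poly (msub l \<nu>) t = msub (line t) \<nu>" for \<nu> t
      by (simp add: msub_def poly_prod poly_power line_def)
    then have "poly (\<Sum>\<nu>\<in>Poly_Mapping.keys q. [:Poly_Mapping.lookup q \<nu>:] * msub l \<nu>) t = poly_value q (line t)" for t
      by (simp add: poly_sum poly_value_msub)
    then show ?thesis by blast
  qed
  obtain G where G: "\<And>t. poly G t = poly_value g (line t)" using on_line[of g] by blast
  obtain H where H: "\<And>t. poly H t = poly_value h (line t)" using on_line[of h] by blast
  have "line 0 = a" "line 1 = b" by (auto simp: line_def l_def)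
  then have "poly G 0 \<noteq> 0" "poly H 1 \<noteq> 0" using g(1) h(1) G H by simp_all
  then have "G * H \<noteq> 0" by auto
  then have "finite {t. poly (G * H) t = 0}" by (rule poly_roots_finite)
  then obtain t where "poly (G * H) t \<noteq> 0" using inf by (metis (mono_tags, lifting) UNIV_eq_I mem_Collect_eq)
  then have "poly_value (g * h) (line t) \<noteq> 0" by (simp add: poly_value_mult G H)
  moreover have "P c \<and> Q c" if "poly_value (g * h) c \<noteq> 0" for c
    using that g(2) h(2) by (simp add: poly_value_mult)
  ultimately show ?thesis unfolding generic_def by blast
qed

lemma generic_ball:
  assumes "infinite (UNIV :: 'f::field set)" "finite S" "\<And>s. s \<in> S \<Longrightarrow> generic (P s :: ('x \<Rightarrow> 'f) \<Rightarrow> bool)"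
  shows "generic (\<lambda>c. \<forall>s\<in>S. P s c)"
  using assms(2,3)
proof (induction S rule: finite_induct)
  case empty
  then show ?case using generic_True by simp
next
  case (insert s S)
  have "generic (\<lambda>c. P s c \<and> (\<forall>s\<in>S. P s c))" by (rule generic_conj[OF assms(1)]) (use insert in auto)
  then show ?case by (rule generic_mono) blast
qed

text \<open>One polynomial from the family defining a nonempty open set is nonzero somewhere.
  Conversely, a polynomial involving coordinates outside \<open>X\<close> becomes one on
  \<open>X\<close> when those coordinates are frozen at the values of a good point.\<close>

lemma holds_generically_iff:
  assumes cong: "\<And>c c' :: 'x \<Rightarrow> 'f::field. (\<And>x. x \<in> X \<Longrightarrow> c x = c' x) \<Longrightarrow> P c = P c'"
  shows "holds_generically X P \<longleftrightarrow> generic P"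
proof
  assume "holds_generically X P"
  then obtain U where U: "zariski_open X U" "U \<noteq> {}" "\<forall>c\<in>U. P c"
    unfolding holds_generically_def by blast
  obtain G where G: "G \<subseteq> polys_in X" "U = {c \<in> X \<rightarrow>\<^sub>E UNIV. \<exists>g\<in>G. poly_value g c \<noteq> 0}"
    using U(1) unfolding zariski_open_def by (elim exE conjE)
  obtain c0 where "c0 \<in> U" using U(2) by blast
  then obtain g where g: "g \<in> G" "poly_value g c0 \<noteq> 0" unfolding G(2) by blast
  have "P c" if "poly_value g c \<noteq> 0" for c
  proof -
    have "poly_value g (restrict c X) = poly_value g c" using g(1) G(1) by (intro poly_value_cong[of g X]) auto
    then have "\<exists>g\<in>G. poly_value g (restrict c X) \<noteq> 0" using g(1) that by (intro bexI[of _ g]) simp_all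
    then have "restrict c X \<in> U" unfolding G(2) by auto
    then have "P (restrict c X)" using U(3) by blast
    then show ?thesis using cong[of "restrict c X" c] by simp
  qed
  then show "generic P" unfolding generic_def using g(2) by blast
next
  assume "generic P"
  then obtain g c0 where g: "poly_value g c0 \<noteq> 0" "\<And>c. poly_value g c \<noteq> 0 \<Longrightarrow> P c"
    unfolding generic_def by blast
  define a where "a x = (if x \<in> X then 1 else c0 x)" for x
  define \<gamma> :: "'x \<Rightarrow> ('x, 'f) mpoly" where "\<gamma> x = (if x \<in> X then pvar x else 1)" for x
  define g' where "g' = (\<Sum>\<nu>\<in>Poly_Mapping.keys g. const_poly (Poly_Mapping.lookup g \<nu> * msub a \<nu>) * msub \<gamma> \<nu>)"
  define ov where "ov c x = (if x \<in> X then c x else c0 x)" for c x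
  have g'X: "g' \<in> polys_in X"
    unfolding g'_def by (intro polys_in_sum polys_in_mult polys_in_const polys_in_msub) (auto simp: \<gamma>_def polys_in_pvar)
  have val: "poly_value g' c = poly_value g (ov c)" for c
  proof -
    have "msub a \<nu> * msub (\<lambda>x. poly_value (\<gamma> x) c) \<nu> = msub (ov c) \<nu>" for \<nu>
      unfolding msub_times[symmetric]
      by (rule arg_cong[of _ _ "\<lambda>f. msub f \<nu>"]) (auto simp: a_def \<gamma>_def ov_def poly_value_act[of 1])
    then show ?thesis
      by (simp add: g'_def poly_value_sum poly_value_mult poly_value_of_msub mult.assoc poly_value_msub[of g])
  qed
  define U where "U = {c \<in> X \<rightarrow>\<^sub>E UNIV. \<exists>g\<in>{g'}. poly_value g c \<noteq> 0}"
  have "zariski_open X U" unfolding zariski_open_def U_def using g'X by blast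
  moreover have "restrict c0 X \<in> U"
  proof -
    have "ov (restrict c0 X) = c0" by (auto simp: ov_def)
    then show ?thesis using g(1) by (auto simp: U_def val)
  qed
  moreover have "P c" if "c \<in> U" for c
  proof -
    have "P (ov c)" using that g(2) by (auto simp: U_def val)
    then show ?thesis using cong[of "ov c" c] by (simp add: ov_def)
  qed
  ultimately show "holds_generically X P" unfolding holds_generically_def by blast
qed

text \<open>Invertibility is the nonvanishing of a determinant, a polynomial in the coefficients
  that is 1 at the identity matrix. The sorted list of \<sigma> provides the order of the
  columns.\<close>

lemma generic_nonsing:
  assumes fin: "finite (\<sigma> :: 'v::linorder set)"
  shows "generic (\<lambda>c :: nat \<times> 'v \<Rightarrow> 'f::field. coeff_rows.nonsing c \<sigma>)"
proof -
  define s where "s = card \<sigma>"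
  define xs where "xs = sorted_list_of_set \<sigma>"
  have xs: "length xs = s" "distinct xs" "set xs = \<sigma>" using fin by (auto simp: xs_def s_def)
  define M where "M c = mat s s (\<lambda>(i, j). c (i, xs ! j))" for c :: "nat \<times> 'v \<Rightarrow> 'f"
  have M: "M c \<in> carrier_mat s s" for c by (simp add: M_def)
  define g :: "(nat \<times> 'v, 'f) mpoly" where
    "g = (\<Sum>p\<in>{p. p permutes {0..<s}}. const_poly (signof p) * (\<Prod>i=0..<s. pvar (i, xs ! p i)))"
  have val: "poly_value g c = det (M c)" for c
  proof -
    have "poly_value g c = (\<Sum>p\<in>{p. p permutes {0..<s}}. signof p * (\<Prod>i=0..<s. c (i, xs ! p i)))"
      by (simp add: g_def poly_value_sum poly_value_mult poly_value_prod)
    also have "\<dots> = (\<Sum>p\<in>{p. p permutes {0..<s}}. signof p * (\<Prod>i=0..<s. M c $$ (i, p i)))"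
    proof (intro sum.cong refl arg_cong[of _ _ "\<lambda>z. _ * z"] prod.cong)
      fix p i assume "p \<in> {p. p permutes {0..<s}}" "i \<in> {0..<s}"
      then have "p i < s" "i < s" using permutes_in_image[of p "{0..<s}" i] by auto
      then show "c (i, xs ! p i) = M c $$ (i, p i)" by (simp add: M_def)
    qed
    also have "\<dots> = det (M c)" by (rule det_def'[OF M, symmetric])
    finally show ?thesis .
  qed
  have "M (\<lambda>(i, v). if i < s \<and> v = xs ! i then 1 else 0) = 1\<^sub>m s"
    by (rule eq_matI) (use xs in \<open>auto simp: M_def nth_eq_iff_index_eq\<close>)
  then have nz: "poly_value g (\<lambda>(i, v). if i < s \<and> v = xs ! i then 1 else 0) \<noteq> 0" by (simp add: val)
  have "coeff_rows.nonsing c \<sigma>" if "poly_value g c \<noteq> 0" for c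
  proof -
    interpret coeff_rows "{}" c by unfold_locales simp
    have "det (M c) \<noteq> 0" using that val by simp
    then have "M c \<in> Units (ring_mat TYPE('f) s ())" by (rule det_non_zero_imp_unit[OF M])
    then obtain N where N: "N \<in> carrier_mat s s" "N * M c = 1\<^sub>m s" "M c * N = 1\<^sub>m s"
      unfolding Units_def ring_mat_def by auto
    have bij: "bij_betw (\<lambda>j. xs ! j) {..<s} \<sigma>" using bij_betw_nth[OF xs(2)] xs by auto
    define ix where "ix = the_inv_into {..<s} (\<lambda>j. xs ! j)"
    have ix: "ix (xs ! j) = j" if "j < s" for j
      unfolding ix_def using that bij by (intro the_inv_into_f_f) (auto simp: bij_betw_def)
    have nth: "\<exists>j<s. v = xs ! j" if "v \<in> \<sigma>" for v using that xs by (metis in_set_conv_nth)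
    have NM: "(\<Sum>k<s. N $$ (i, k) * c (k, xs ! j)) = (if i = j then 1 else 0)" if "i < s" "j < s" for i j
    proof -
      have "(N * M c) $$ (i, j) = (\<Sum>k<s. N $$ (i, k) * c (k, xs ! j))"
        using that N(1) by (simp add: M_def scalar_prod_def atLeast0LessThan)
      then show ?thesis using N(2) that by simp
    qed
    have MN: "(\<Sum>j<s. c (k, xs ! j) * N $$ (j, l)) = (if k = l then 1 else 0)" if "k < s" "l < s" for k l
    proof -
      have "(M c * N) $$ (k, l) = (\<Sum>j<s. c (k, xs ! j) * N $$ (j, l))"
        using that N(1) by (simp add: M_def scalar_prod_def atLeast0LessThan)
      then show ?thesis using N(3) that by simp
    qed
    show ?thesis
      unfolding nonsing_def s_def[symmetric]
    proof (rule exI[of _ "\<lambda>u l. N $$ (ix u, l)"], intro conjI ballI allI impI)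
      fix u v assume "u \<in> \<sigma>" "v \<in> \<sigma>"
      then obtain i j where ij: "i < s" "u = xs ! i" "j < s" "v = xs ! j" using nth by blast
      have "(u = v) = (i = j)" using ij xs by (simp add: nth_eq_iff_index_eq)
      then show "(\<Sum>k<s. N $$ (ix u, k) * c (k, v)) = (if u = v then 1 else 0)"
        using NM[OF ij(1,3)] ij ix by simp
    next
      fix k l assume kl: "k < s" "l < s"
      have "(\<Sum>v\<in>\<sigma>. c (k, v) * N $$ (ix v, l)) = (\<Sum>j<s. c (k, xs ! j) * N $$ (ix (xs ! j), l))"
        by (rule sum.reindex_bij_betw[OF bij, symmetric])
      then show "(\<Sum>v\<in>\<sigma>. c (k, v) * N $$ (ix v, l)) = (if k = l then 1 else 0)"
        using MN[OF kl] ix by simp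
    qed
  qed
  then show ?thesis unfolding generic_def using nz by blast
qed

section \<open>The move at a fixed coefficient point\<close>

definition lefschetz_at :: "'v set set \<Rightarrow> (nat \<times> 'v \<Rightarrow> 'f::field) \<Rightarrow> bool" where
  "lefschetz_at \<Delta> c \<longleftrightarrow> lsop \<Delta> (\<lambda>i. linear_form (\<Union>\<Delta>) (\<lambda>v. c (i, v))) \<and>
     weak_lefschetz_element \<Delta> (\<lambda>i. linear_form (\<Union>\<Delta>) (\<lambda>v. c (i, v))) (linear_form (\<Union>\<Delta>) (\<lambda>v. c (rank_of \<Delta>, v)))"

text \<open>Makes \<open>lefschetz_at\<close> a property of the rows up to
  \<open>rank_of \<Delta>\<close> only, as the passage to \<open>generic\<close> requires.\<close>

lemma lefschetz_cong:
  assumes "\<And>i. i < rank_of \<Delta> \<Longrightarrow> \<theta> i = \<theta>' i"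
  shows "lsop \<Delta> \<theta> = lsop \<Delta> \<theta>'" "weak_lefschetz_element \<Delta> \<theta> = weak_lefschetz_element \<Delta> \<theta>'"
proof -
  have "theta_ideal \<Delta> \<theta> = theta_ideal \<Delta> \<theta>'"
    unfolding theta_ideal_def by (rule arg_cong[of _ _ "genideal _"], rule image_cong) (use assms in auto)
  then have *: "artinian_quotient \<Delta> \<theta> = artinian_quotient \<Delta> \<theta>'" "artinian_class \<Delta> \<theta> = artinian_class \<Delta> \<theta>'"
    by (auto simp: artinian_quotient_def artinian_class_def)
  then have "artinian_component \<Delta> \<theta> = artinian_component \<Delta> \<theta>'" by (auto simp: artinian_component_def)
  then show "lsop \<Delta> \<theta> = lsop \<Delta> \<theta>'" "weak_lefschetz_element \<Delta> \<theta> = weak_lefschetz_element \<Delta> \<theta>'"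
    using assms by (auto simp: lsop_def weak_lefschetz_element_def * fun_eq_iff)
qed

lemma has_weak_lefschetz_iff:
  "has_weak_lefschetz_elements TYPE('f::field) \<Delta> \<longleftrightarrow> generic (lefschetz_at \<Delta> :: (nat \<times> 'v \<Rightarrow> 'f) \<Rightarrow> bool)"
proof -
  have "lefschetz_at \<Delta> c = lefschetz_at \<Delta> c'"
    if eq: "\<And>x. x \<in> {0..rank_of \<Delta>} \<times> \<Union>\<Delta> \<Longrightarrow> c x = c' x" for c c' :: "nat \<times> 'v \<Rightarrow> 'f"
  proof -
    have l: "linear_form (\<Union>\<Delta>) (\<lambda>v. c (i, v)) = linear_form (\<Union>\<Delta>) (\<lambda>v. c' (i, v))" if "i \<le> rank_of \<Delta>" for i
      unfolding linear_form_def by (rule sum.cong) (use eq that in auto)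
    show ?thesis
      unfolding lefschetz_at_def l[OF order_refl]
      using lefschetz_cong[of \<Delta> "\<lambda>i. linear_form (\<Union>\<Delta>) (\<lambda>v. c (i, v))" "\<lambda>i. linear_form (\<Union>\<Delta>) (\<lambda>v. c' (i, v))"] l
      by simp
  qed
  then have "holds_generically ({0..rank_of \<Delta>} \<times> \<Union>\<Delta>) (lefschetz_at \<Delta> :: (nat \<times> 'v \<Rightarrow> 'f) \<Rightarrow> bool) \<longleftrightarrow> generic (lefschetz_at \<Delta> :: (nat \<times> 'v \<Rightarrow> 'f) \<Rightarrow> bool)"
    by (rule holds_generically_iff)
  then show ?thesis
    unfolding has_weak_lefschetz_elements_def Let_def lefschetz_at_def .
qed

lemma join_Pow_boundary:
  assumes "A \<inter> B = {}"
  shows "\<sigma> \<in> Pow A \<star> simplex_boundary B \<longleftrightarrow> \<sigma> \<subseteq> A \<union> B \<and> \<not> B \<subseteq> \<sigma>"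
proof
  assume "\<sigma> \<in> Pow A \<star> simplex_boundary B"
  then show "\<sigma> \<subseteq> A \<union> B \<and> \<not> B \<subseteq> \<sigma>" using assms unfolding join_def simplex_boundary_def by blast
next
  assume \<sigma>: "\<sigma> \<subseteq> A \<union> B \<and> \<not> B \<subseteq> \<sigma>"
  have "\<sigma> = (\<sigma> \<inter> A) \<union> (\<sigma> \<inter> B)" "\<sigma> \<inter> A \<in> Pow A" "\<sigma> \<inter> B \<in> simplex_boundary B"
    using \<sigma> by (auto simp: simplex_boundary_def)
  then show "\<sigma> \<in> Pow A \<star> simplex_boundary B" unfolding join_def by blast
qed

lemma join_boundary_Pow:
  "A \<inter> B = {} \<Longrightarrow> \<sigma> \<in> simplex_boundary A \<star> Pow B \<longleftrightarrow> \<sigma> \<subseteq> A \<union> B \<and> \<not> A \<subseteq> \<sigma>"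
proof -
  assume "A \<inter> B = {}"
  moreover have "simplex_boundary A \<star> Pow B = Pow B \<star> simplex_boundary A"
    unfolding join_def by (auto simp: Un_commute)
  ultimately show ?thesis using join_Pow_boundary[of B A \<sigma>] by (simp add: Int_commute Un_commute)
qed

lemma bistellar_lefschetz_at:
  fixes \<Delta> \<Delta>' :: "'v::linorder set set" and c :: "nat \<times> 'v \<Rightarrow> 'f::field"
  assumes \<Delta>: "simplicial_complex \<Delta>" "pure_complex \<Delta>" "rank_of \<Delta> = 2 * m + 1" "homology_sphere TYPE('f) \<Delta>"
    and move: "bistellar_move \<Delta> A B \<Delta>'" and neq: "card A \<noteq> card B"
    and good: "\<And>\<sigma>. \<sigma> \<subseteq> \<Union>\<Delta> \<union> A \<union> B \<Longrightarrow> coeff_rows.nonsing c \<sigma>"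
  shows "lefschetz_at \<Delta>' c \<longleftrightarrow> lefschetz_at \<Delta> c"
proof -
  define V where "V = \<Union>\<Delta> \<union> A \<union> B"
  define d where "d = 2 * m + 1"
  have AB: "finite A" "finite B" "A \<noteq> {}" "B \<noteq> {}" "A \<inter> B = {}" "card A + card B = d + 1"
    using move \<Delta>(3) by (auto simp: bistellar_move_def d_def)
  have ind: "{\<sigma> \<in> \<Delta>. \<sigma> \<subseteq> A \<union> B} = Pow A \<star> simplex_boundary B"
    and \<Delta>'_def: "\<Delta>' = (\<Delta> - Pow A \<star> simplex_boundary B) \<union> simplex_boundary A \<star> Pow B"
    using move by (auto simp: bistellar_move_def induced_subcomplex_def)
  have inAB: "\<sigma> \<in> \<Delta> \<longleftrightarrow> \<not> B \<subseteq> \<sigma>" if "\<sigma> \<subseteq> A \<union> B" for \<sigma>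
  proof -
    have "\<sigma> \<in> \<Delta> \<longleftrightarrow> \<sigma> \<in> Pow A \<star> simplex_boundary B" using ind that by blast
    then show ?thesis using join_Pow_boundary[OF AB(5)] that by simp
  qed
  have down: "\<tau> \<in> \<Delta>" if "\<sigma> \<in> \<Delta>" "\<tau> \<subseteq> \<sigma>" for \<sigma> \<tau>
    using \<Delta>(1) that unfolding simplicial_complex_def by blast
  have finV: "finite V" using \<Delta>(1) AB by (simp add: V_def simplicial_complex_def)
  have sub: "\<Delta> \<subseteq> Pow V" by (auto simp: V_def)
  have fin\<Delta>: "finite \<Delta>" using finite_subset[OF sub] finV by simp
  have card_le: "card \<sigma> \<le> d" if "\<sigma> \<in> \<Delta>" for \<sigma>
  proof -
    have "card \<sigma> \<le> Max (card ` \<Delta>)" using fin\<Delta> that by (intro Max_ge) auto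
    then show ?thesis using \<Delta>(3) by (simp add: rank_of_def d_def)
  qed
  interpret S: sphere_rows V c \<Delta> d
  proof unfold_locales
    show "finite V" by (rule finV)
    show "\<tau> \<in> \<Delta>" if "\<sigma> \<in> \<Delta>" "\<tau> \<subseteq> \<sigma>" for \<sigma> \<tau> using down that by blast
    show "{} \<in> \<Delta>" using \<Delta>(1) by (simp add: simplicial_complex_def)
    show "\<Delta> \<subseteq> Pow V" by (rule sub)
    show "card \<sigma> \<le> d" if "\<sigma> \<in> \<Delta>" for \<sigma> using card_le that by blast
    show "\<exists>F\<in>\<Delta>. \<sigma> \<subseteq> F \<and> card F = d" if \<sigma>: "\<sigma> \<in> \<Delta>" for \<sigma>
    proof -
      obtain F where F: "F \<in> \<Delta>" "\<sigma> \<subseteq> F" "\<forall>b\<in>\<Delta>. F \<subseteq> b \<longrightarrow> F = b"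
        using finite_has_maximal2[OF fin\<Delta> \<sigma>] by blast
      then have "facet \<Delta> F" unfolding facet_def by blast
      then have "card F = d" using \<Delta>(2,3) by (simp add: pure_complex_def d_def)
      then show ?thesis using F by blast
    qed
    show "homology_of_sphere TYPE('f) (d - card \<sigma>) (link \<Delta> \<sigma>)" if "\<sigma> \<in> \<Delta>" for \<sigma>
    proof (cases "\<sigma> = {}")
      case True
      have "link \<Delta> {} = \<Delta>" by (auto simp: link_def)
      then show ?thesis using True \<Delta>(3,4) by (simp add: homology_sphere_def d_def)
    next
      case False
      then show ?thesis using that \<Delta>(3,4) by (simp add: homology_sphere_def homology_manifold_def d_def)
    qed
    show "coeff_rows.nonsing c \<sigma>" if "\<sigma> \<in> \<Delta>" for \<sigma>
      by (rule good) (use that in auto)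
  qed
  \<comment> \<open>The move deletes only faces inside A \<union> B. By this fact every face
    containing \<open>A\<close> is among them, which gives the description \<open>X'\<close> of the
    new complex.\<close>
  have XA: "\<sigma> \<subseteq> A \<union> B" if "\<sigma> \<in> \<Delta>" "A \<subseteq> \<sigma>" for \<sigma>
  proof (rule S.face_containing_A[OF AB(3,5,2,6) _ _ that])
    show "A \<union> \<rho> \<in> \<Delta>" if "\<rho> \<subset> B" for \<rho>
      using inAB[of "A \<union> \<rho>"] that AB(5) by blast
    show "A \<union> B \<notin> \<Delta>" using inAB[of "A \<union> B"] by blast
  qed
  have XB: "\<not> B \<subseteq> \<sigma>" if "\<sigma> \<in> \<Delta>" for \<sigma>
    using down[OF that, of B] inAB[of B] by blast
  have X': "\<sigma> \<in> \<Delta>' \<longleftrightarrow> \<not> A \<subseteq> \<sigma> \<and> (\<sigma> \<in> \<Delta> \<or> \<sigma> \<subseteq> A \<union> B)" for \<sigma>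
    unfolding \<Delta>'_def Un_iff Diff_iff join_Pow_boundary[OF AB(5)] join_boundary_Pow[OF AB(5)]
    using XA XB by blast
  have UV: "A \<union> B \<subseteq> V" "card (A \<union> B) = Suc d" using AB by (auto simp: V_def card_Un_disjoint)
  obtain k :: "'v \<Rightarrow> 'f" where k: "\<And>u. u \<in> A \<union> B \<Longrightarrow> k u \<noteq> 0" "\<And>u. u \<notin> A \<union> B \<Longrightarrow> k u = 0"
    "\<And>j. j \<le> d \<Longrightarrow> (\<Sum>v\<in>V. c (j, v) * k v) = (if j = d then 1 else 0)"
    "\<And>f u \<mu>. f \<in> S.E d (Pow (A \<union> B)) \<Longrightarrow> f (\<mu> + evar u) = k u * S.Th d f \<mu>"
  proof (rule S.nonsing_kernel[OF UV])
    show "S.nonsing (A \<union> B)" by (rule good) auto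
    show "S.nonsing (A \<union> B - {u})" for u by (rule good) auto
  qed blast
  obtain \<psi> where \<psi>: "S.generates d \<Delta> d \<psi>" "\<And>F. F \<in> \<Delta> \<Longrightarrow> card F = d \<Longrightarrow> \<psi> (ind F) \<noteq> 0"
    by (rule S.fundamental_dual) blast
  have "A \<in> \<Delta>" using inAB[of A] AB by blast
  then obtain F where F: "F \<in> \<Delta>" "A \<subseteq> F" "card F = d" using S.facet_ext by blast
  have "\<exists>a. S.generates d \<Delta>' d (\<psi> - (\<lambda>\<mu>. a * point_dual k d \<mu>))"
  proof (rule S.bistellar_generates[where U = "A \<union> B" and A = A and B = B and X = \<Delta> and F = F])
    show "S.generates d \<Delta> d \<psi>" by (rule \<psi>(1))
    show "\<sigma> \<in> \<Delta>' \<longleftrightarrow> \<not> A \<subseteq> \<sigma> \<and> (\<sigma> \<in> \<Delta> \<or> \<sigma> \<subseteq> A \<union> B)" for \<sigma> by (rule X')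
    show "\<psi> (ind F) \<noteq> 0" by (rule \<psi>(2)[OF F(1,3)])
    show "finite F" by (rule S.finite_face[OF F(1)])
    show "\<sigma> \<in> \<Delta>" if "\<sigma> \<subseteq> A \<union> B" "\<not> B \<subseteq> \<sigma>" for \<sigma> using inAB that by blast
    show "\<tau> \<in> \<Delta>" if "\<sigma> \<in> \<Delta>" "\<tau> \<subseteq> \<sigma>" for \<sigma> \<tau> using down that by blast
  qed (use k AB F XA XB in auto)
  then obtain a where a: "S.generates d \<Delta>' d (\<psi> - (\<lambda>\<mu>. a * point_dual k d \<mu>))" by blast
  define \<psi>' where "\<psi>' = \<psi> - (\<lambda>\<mu>. a * point_dual k d \<mu>)"
  have V': "\<Union>\<Delta>' \<subseteq> V" using X' UV(1) by (auto simp: V_def)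
  have sc': "simplicial_complex \<Delta>'"
    unfolding simplicial_complex_def
  proof (intro conjI ballI allI impI)
    show "finite (\<Union>\<Delta>')" by (rule finite_subset[OF V' finV])
    show "{} \<in> \<Delta>'" using X' AB by blast
    show "\<tau> \<in> \<Delta>'" if "\<sigma> \<in> \<Delta>'" "\<tau> \<subseteq> \<sigma>" for \<sigma> \<tau>
    proof -
      have "\<not> A \<subseteq> \<sigma>" "\<sigma> \<in> \<Delta> \<or> \<sigma> \<subseteq> A \<union> B" using that(1) X'[of \<sigma>] by blast+
      then have "\<not> A \<subseteq> \<tau>" "\<tau> \<in> \<Delta> \<or> \<tau> \<subseteq> A \<union> B" using that(2) down[of \<sigma> \<tau>] by auto
      then show ?thesis using X'[of \<tau>] by blast
    qed
  qed
  have rank': "rank_of \<Delta>' = d"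
    unfolding rank_of_def
  proof (rule Max_eqI)
    have "\<Delta>' \<subseteq> Pow V" using V' by blast
    then show "finite (card ` \<Delta>')" using finite_subset finV by (metis finite_Pow_iff finite_imageI)
    fix y assume "y \<in> card ` \<Delta>'"
    then obtain \<sigma> where \<sigma>: "\<sigma> \<in> \<Delta>'" "y = card \<sigma>" by blast
    then consider "\<sigma> \<in> \<Delta>" | "\<sigma> \<subset> A \<union> B" using X' by blast
    then show "y \<le> d"
    proof cases
      case 1
      then show ?thesis using card_le \<sigma> by simp
    next
      case 2
      then have "card \<sigma> < Suc d" using psubset_card_mono[of "A \<union> B" \<sigma>] AB UV(2) by simp
      then show ?thesis using \<sigma> by simp
    qed
  next
    obtain u where u: "u \<in> A" using AB by blast
    have "A \<union> B - {u} \<in> \<Delta>'" using X' u by blast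
    moreover have "card (A \<union> B - {u}) = d" using UV(2) u AB by simp
    ultimately show "d \<in> card ` \<Delta>'" by force
  qed
  interpret I1: inverse_system V c \<Delta> d \<psi>
    by unfold_locales (use \<Delta> \<psi>(1) in \<open>auto simp: V_def d_def\<close>)
  interpret I2: inverse_system V c \<Delta>' d \<psi>'
    by unfold_locales (use sc' rank' V' a in \<open>simp_all add: \<psi>'_def\<close>)
  define om where "om = linear_form V (\<lambda>v. c (d, v))"
  have L1: "lefschetz_at \<Delta> c \<longleftrightarrow> mid_injective om m \<psi>"
    using I1.lsop_holds I1.weak_lefschetz_iff[OF d_def] \<Delta>(3)
    unfolding lefschetz_at_def I1.\<theta>_def I1.\<omega>_def om_def by (simp add: d_def)
  have L2: "lefschetz_at \<Delta>' c \<longleftrightarrow> mid_injective om m \<psi>'"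
    using I2.lsop_holds I2.weak_lefschetz_iff[OF d_def] rank'
    unfolding lefschetz_at_def I2.\<theta>_def I2.\<omega>_def om_def by simp
  have om: "hpoly 1 om" "poly_value om k \<noteq> 0"
    using k(3)[of d] by (simp_all add: om_def poly_value_linear_form)
  have vanish: "act (Poly_Mapping.single (ind D) 1) f = 0"
    if f: "f \<in> S.E d Y" and D: "finite D" "\<And>\<sigma>. \<sigma> \<in> Y \<Longrightarrow> \<not> D \<subseteq> \<sigma>" for f Y D
  proof
    fix \<mu>
    have "f (\<mu> + ind D) = 0" by (rule S.E_keys'[OF f]) (use D in \<open>auto simp: keys_add_nat keys_ind\<close>)
    then show "act (Poly_Mapping.single (ind D) 1) f \<mu> = 0 \<mu>" by simp
  qed
  have "mid_injective om m \<psi> \<longleftrightarrow> mid_injective om m \<psi>'"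
  proof (cases "card B \<le> m")
    case True
    obtain u where u: "u \<in> B" using AB by blast
    show ?thesis
    proof (rule mid_injective_point_dual[OF d_def om AB(2) True])
      show "act (Poly_Mapping.single (ind B) 1) \<psi> = 0"
        by (rule vanish[OF S.generatesD(1)[OF \<psi>(1)] AB(2) XB])
      show "k u \<noteq> 0" using k(1) u by blast
    qed (use k(1) \<psi>'_def in auto)
  next
    case False
    then have cA: "card A \<le> m" using AB(6) neq by (simp add: d_def)
    obtain u where u: "u \<in> A" using AB by blast
    have "mid_injective om m \<psi>' \<longleftrightarrow> mid_injective om m \<psi>"
    proof (rule mid_injective_point_dual[OF d_def om AB(1) cA])
      show "act (Poly_Mapping.single (ind A) 1) \<psi>' = 0"
        by (rule vanish[OF S.generatesD(1)[OF I2.gen] AB(1)]) (use X' in blast)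
      show "k u \<noteq> 0" using k(1) u by blast
      show "\<psi> = \<psi>' - (\<lambda>\<mu>. (- a) * point_dual k d \<mu>)" by (rule ext) (simp add: \<psi>'_def)
    qed (use k(1) in auto)
    then show ?thesis by blast
  qed
  then show ?thesis using L1 L2 by blast
qed

theorem theorem3p1:
  fixes \<Delta> \<Delta>' :: "'v::linorder set set" and A B :: "'v set" and m :: nat
  assumes "infinite (UNIV :: 'f::field set)"
    and "simplicial_complex \<Delta>" and "connected_complex \<Delta>" and "pure_complex \<Delta>"
    and "rank_of \<Delta> = 2 * m + 1"
    and "homology_sphere TYPE('f) \<Delta>"
    and "bistellar_move \<Delta> A B \<Delta>'"
    and "card A \<noteq> card B"
  shows "has_weak_lefschetz_elements TYPE('f) \<Delta>' \<longleftrightarrow> has_weak_lefschetz_elements TYPE('f) \<Delta>"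
proof -
  define S where "S = Pow (\<Union>\<Delta> \<union> A \<union> B)"
  have fin: "finite (\<Union>\<Delta> \<union> A \<union> B)"
    using assms(2,7) by (simp add: simplicial_complex_def bistellar_move_def)
  have good: "generic (\<lambda>c :: nat \<times> 'v \<Rightarrow> 'f. \<forall>\<sigma>\<in>S. coeff_rows.nonsing c \<sigma>)"
    by (rule generic_ball[OF assms(1)]) (use fin in \<open>auto simp: S_def intro: generic_nonsing finite_subset\<close>)
  have at: "lefschetz_at \<Delta>' c \<longleftrightarrow> lefschetz_at \<Delta> c" if "\<forall>\<sigma>\<in>S. coeff_rows.nonsing c \<sigma>" for c :: "nat \<times> 'v \<Rightarrow> 'f"
    by (rule bistellar_lefschetz_at[OF assms(2,4-8)]) (use that in \<open>auto simp: S_def\<close>)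
  \<comment> \<open>The two properties are compared only at good points, so a generic property is
    first intersected with the good set.\<close>
  have transfer: "generic (Q :: (nat \<times> 'v \<Rightarrow> 'f) \<Rightarrow> bool)"
    if "generic P" "\<And>c. \<forall>\<sigma>\<in>S. coeff_rows.nonsing c \<sigma> \<Longrightarrow> P c \<Longrightarrow> Q c" for P Q
    by (rule generic_mono[OF generic_conj[OF assms(1) good that(1)]]) (use that(2) in blast)
  show ?thesis
    unfolding has_weak_lefschetz_iff
    by (rule iffI; erule transfer) (use at in blast)+
qed

end
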